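(* Let $p$ be an odd prime, $\ell$ an odd prime distinct from $p$, $m\ge 1$ an integer, and assume $p$ is a primitive root modulo $2\ell^m$. Let $q=p^{e}$ with $e=\phi(2\ell^m)=(\ell-1)\ell^{m-1}$. Let $\alpha\in\mathbb{F}_p$, $\beta\in\mathbb{F}_q$, and let $\mathcal{C}_{\alpha,\beta}$ be the $p$-ary code with defining set $D=\{x\in\mathbb{F}_q^*: \mathrm{Tr}(x^{\frac{q-1}{2\ell^m}}+\beta x)=\alpha\}$. In $\mathbb{F}_p$ put $a_1=\ell^{m-1}(\ell-1)-\alpha$, $a_2=-\ell^{m-1}(\ell-1)-\alpha$, $a_3=\ell^{m-1}-\alpha$, $a_4=-\ell^{m-1}-\alpha$. Then $\mathcal{C}_{\alpha,\beta}$ has dimension $(\ell-1)\ell^{m-1}$, except when $\alpha\neq 0$, $\beta=0$ and none of $a_1,a_2,a_3,a_4$ is zero, in which case $\mathcal{C}_{\alpha,0}$ is an empty set. Precisely: (a) Suppose $\alpha=\beta=0$. Then $\mathcal{C}_{0,0}$ is a two-weight code. Specifically: (i) If $\ell\equiv 1\pmod p$, then $\mathcal{C}_{0,0}$ has length $\frac{(q-1)(\ell^m-\ell+1)}{\ell^m}$ and exactly two nonzero weights $w_1=\frac{p-1}{p\ell^m}\big((\ell^m-\ell+1)q-(\ell-1)\sqrt q\big)$ and $w_2=\frac{(p-1)(\ell^m-\ell+1)}{p\ell^m}(q+\sqrt q)$, with $A_{w_1}=\frac{(q-1)(\ell^m-\ell+1)}{\ell^m}$ and $A_{w_2}=\frac{(q-1)(\ell-1)}{\ell^m}$.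 (ii) If $\ell\not\equiv 1\pmod p$ and $m\ge 2$, then $\mathcal{C}_{0,0}$ has length $\frac{(q-1)(\ell^{m-1}-1)}{\ell^{m-1}}$ and exactly two nonzero weights $w_1=\frac{(p-1)(\ell^{m-1}-1)}{p\ell^{m-1}}(q+\sqrt q)$ and $w_2=\frac{p-1}{p\ell^{m-1}}\big((\ell^{m-1}-1)q-\sqrt q\big)$, with $A_{w_1}=\frac{q-1}{\ell^{m-1}}$ and $A_{w_2}=\frac{(q-1)(\ell^{m-1}-1)}{\ell^{m-1}}$. (b) Suppose $\alpha\ne 0$ and $\beta=0$. Then $\mathcal{C}_{\alpha,0}$ is a two-weight code if at least one of $a_1,a_2,a_3,a_4$ is zero. Furthermore: (i) If either $a_1$ or $a_2$ is zero and $a_3\ne0$, $a_4\neq 0$, then $\mathcal{C}_{\alpha,0}$ has length $\frac{q-1}{2\ell^m}$ and exactly two nonzero weights $w_1=\frac{p-1}{2p\ell^m}\big(q-(2\ell^m-1)\sqrt q\big)$ and $w_2=\frac{p-1}{2p\ell^m}(q+\sqrt q)$, with $A_{w_1}=\frac{q-1}{2\ell^m}$ and $A_{w_2}=\frac{(q-1)(2\ell^m-1)}{2\ell^m}$. (ii) If either $a_3$ or $a_4$ is zero and $a_1\ne0$, $a_2\ne0$, then $\mathcal{C}_{\alpha,0}$ has length $\frac{(q-1)(\ell-1)}{2\ell^m}$ and exactly two nonzero weights $w_1=\frac{(p-1)(\ell-1)}{2p\ell^m}(q+\sqrt q)$ and $w_2=\frac{p-1}{2p\ell^m}\big((\ell-1)q-(2\ell^m-\ell+1)\sqrt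 q\big)$, with $A_{w_1}=\frac{q-1}{2\ell^m}(2\ell^m-\ell+1)$ and $A_{w_2}=\frac{(q-1)(\ell-1)}{2\ell^m}$. (iii) If either $a_1=a_3=0$, $a_2\ne0$, $a_4\ne0$, or $a_2=a_4=0$, $a_1\neq0$, $a_3\ne0$, then $\mathcal{C}_{\alpha,0}$ has length $\frac{q-1}{2\ell^{m-1}}$ and exactly two nonzero weights $w_1=\frac{p-1}{2p\ell^{m-1}}\big(q-(2\ell^{m-1}-1)\sqrt q\big)$ and $w_2=\frac{p-1}{2p\ell^{m-1}}(q+\sqrt q)$, with $A_{w_1}=\frac{q-1}{2\ell^{m-1}}$ and $A_{w_2}=\frac{q-1}{2\ell^{m-1}}(2\ell^{m-1}-1)$. (c) Suppose $\alpha=0$ and $\beta\ne0$. Then $\mathcal{C}_{0,\beta}$ has at most $p+1$ nonzero weights, denoted $w_i$ ($1\le i\le p+1$). Additionally, the length $n$ of $\mathcal{C}_{0,\beta}$ and all possible nonzero weights $w_i$ are given below, where $k$ ranges over $0\le k\le p-1$: (i) If $\ell\equiv1\pmod p$ and $j_\beta\in J_1^{(2)}\cup J_3^{(2)}\cup J_1^{(3)}\cup J_3^{(3)}$: $n=\frac qp-\frac{\sqrt q+1}{\ell^m}(\ell^m-\ell+1)$, $w_1=\frac1{p\ell^m}\big((\ell-1)q-(\ell^m-\ell+1)\sqrt q\big)$, $w_{k+2}=\frac{p-1}{p^2}q-\frac{p-1-k}{p}\sqrt q$. (ii) If $\ell\equiv1\pmod p$ and $j_\beta\in\{0\}\cup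 J_2\cup J_1^{(1)}\cup J_3^{(1)}$: $n=\frac{q-p}p+\frac{(\sqrt q+1)(\ell-1)}{\ell^m}$, $w_1=\frac{\ell-1}{p\ell^m}(q+\sqrt q)$, $w_{k+2}=\frac{p-1}{p^2}q+\frac{p-1-k}{p}\sqrt q$. (iii) If $\ell\not\equiv1\pmod p$ and $j_\beta\in\{0,\ell^m\}\cup J_1^{(2)}\cup J_3^{(2)}\cup J_1^{(3)}\cup J_3^{(3)}$: $n=\frac qp+\frac{(\sqrt q+1)(-\ell^{m-1}+1)}{\ell^{m-1}}$, $w_1=\frac1{p\ell^{m-1}}q+\frac{1-\ell^{m-1}}{p\ell^{m-1}}\sqrt q$, $w_{k+2}=\frac{p-1}{p^2}q-\frac{p-1-k}{p}\sqrt q$. (iv) If $\ell\not\equiv1\pmod p$ and $j_\beta\in (J_2\setminus\{\ell^m\})\cup J_1^{(1)}\cup J_3^{(1)}$: $n=\frac qp+\frac{\sqrt q+1}{\ell^{m-1}}-1$, $w_1=\frac1{p\ell^{m-1}}(q+\sqrt q)$, $w_{k+2}=\frac{p-1}{p^2}q+\frac{p-1-k}{p}\sqrt q$. (d) Suppose $\alpha\ne0$ and $\beta\neq0$. If $a_1,a_2,a_3,a_4$ are all nonzero, then $\mathcal{C}_{\alpha,\beta}$ is a two-weight code of length $n=\frac qp$ with nonzero weights $w_1=\frac qp$ and $w_2=\frac{(p-1)q}{p^2}$, and $A_{w_1}=p-1$, $A_{w_2}=q-p$. Otherwise $\mathcal{C}_{\alpha,\beta}$ has at most $p+1$ nonzero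 weights, denoted $w_i$ ($1\le i\le p+1$), and the length $n$ of $\mathcal{C}_{\alpha,\beta}$ and all possible nonzero weights $w_i$ are given below, where $k$ ranges over $0\le k\le p-1$: (i) Assume either $a_1$ or $a_2$ is zero, and $a_3\ne0$, $a_4\ne0$. If $a_1=0$ and $j_\beta=0$, or $a_2=0$ and $j_\beta=\ell^m$, then $n=\frac{q-p}p+\frac{(\sqrt q+1)(2\ell^m-1)}{2\ell^m}$, $w_1=\frac{2\ell^m-1}{2p\ell^m}(q+\sqrt q)$, $w_{k+2}=\frac{p-1}{p^2}q+\frac{p-1-k}p\sqrt q$. If $a_1=0$ and $j_\beta\ne0$, or $a_2=0$ and $j_\beta\ne\ell^m$, then $n=\frac qp-\frac{\sqrt q+1}{2\ell^m}$, $w_1=\frac{2\ell^m-1}{2p\ell^m}q-\frac1{2p\ell^m}\sqrt q$, $w_{k+2}=\frac{p-1}{p^2}q-\frac{p-1-k}p\sqrt q$. (ii) Assume either $a_3$ or $a_4$ is zero, and $a_1\ne0$, $a_2\ne0$. If $a_3=0$ and $j_\beta\notin J_1^{(2)}\cup J_3^{(2)}$, or $a_4=0$ and $j_\beta\notin J_1^{(3)}\cup J_3^{(3)}$, then $n=\frac qp-\frac{(\sqrt q+1)(\ell-1)}{2\ell^m}$, $w_1=\frac{2\ell^m-\ell+1}{2p\ell^m}q-\frac{\ell-1}{2p\ell^m}\sqrt q$, $w_{k+2}=\frac{p-1}{p^2}q-\frac{p-1-k}p\sqrt q$. If $a_3=0$ and $j_\beta\in J_1^{(2)}\cup J_3^{(2)}$,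 or $a_4=0$ and $j_\beta\in J_1^{(3)}\cup J_3^{(3)}$, then $n=\frac{q-p}p+\frac{(\sqrt q+1)(2\ell^m-\ell+1)}{2\ell^m}$, $w_1=\frac{2\ell^m-\ell+1}{2p\ell^m}(q+\sqrt q)$, $w_{k+2}=\frac{p-1}{p^2}q+\frac{p-1-k}p\sqrt q$. (iii) Assume either $a_1=a_3=0$ and $a_2\ne0$, $a_4\ne0$, or $a_2=a_4=0$ and $a_1\ne0$, $a_3\neq0$. If $a_1=a_3=0$ and $j_\beta\in\{0\}\cup J_1^{(2)}\cup J_3^{(2)}$, or $a_2=a_4=0$ and $j_\beta\in\{\ell^m\}\cup J_1^{(3)}\cup J_3^{(3)}$, then $n=\frac{q-p}p+\frac{(\sqrt q+1)(2\ell^{m-1}-1)}{2\ell^{m-1}}$, $w_1=\frac{2\ell^{m-1}-1}{2p\ell^{m-1}}(q+\sqrt q)$, $w_{k+2}=\frac{p-1}{p^2}q+\frac{p-1-k}p\sqrt q$. If $a_1=a_3=0$ and $j_\beta\notin\{0\}\cup J_1^{(2)}\cup J_3^{(2)}$, or $a_2=a_4=0$ and $j_\beta\notin\{\ell^m\}\cup J_1^{(3)}\cup J_3^{(3)}$, then $n=\frac qp-\frac{\sqrt q+1}{2\ell^{m-1}}$, $w_1=\frac{2\ell^{m-1}-1}{2p\ell^{m-1}}q-\frac1{2p\ell^{m-1}}\sqrt q$, $w_{k+2}=\frac{p-1}{p^2}q-\frac{p-1-k}p\sqrt q$.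
   Context: $\mathrm{Tr}$ is the trace from $\mathbb{F}_q$ to $\mathbb{F}_p$; integers are reduced modulo $p$ when regarded as elements of $\mathbb{F}_p$. Writing $D=\{d_1,\dots,d_n\}$ (distinct elements), the code with defining set $D$ is $\mathcal{C}_{\alpha,\beta}=\{(\mathrm{Tr}(d_1x),\dots,\mathrm{Tr}(d_nx)):x\in\mathbb{F}_q\}\subseteq\mathbb{F}_p^n$; its length is $n=\#D$. $A_w$ denotes the number of codewords of Hamming weight $w$. A two-weight code is one with exactly two distinct nonzero weights. $\sqrt q=p^{e/2}$ ($e$ is even). Fix a primitive element $g$ of $\mathbb{F}_q$. For $b\in\mathbb{F}_q^*$, $\mathrm{Ind}(b)$ is the index of $b$ to the base $g$ (so $b=g^{\mathrm{Ind}(b)}$), and $j_b\in\{0,1,\dots,2\ell^m-1\}$ is the least nonnegative residue of $-\mathrm{Ind}(b)$ modulo $2\ell^m$. Let $J=\{0,1,\dots,2\ell^m-1\}$ and $J_1=\{j\in J:1\le j\le(\ell-1)\ell^{m-1}\}$, $J_2=\{j\in J:(\ell-1)\ell^{m-1}<j\le\ell^m\}$, $J_3=\{j\in J:\ell^m<j\le2\ell^m-\ell^{m-1}\}$; $J_1^{(1)}=\{j\in J_1:\ell^{m-1}\nmid j\}$, $J_1^{(2)}=\{j\in J_1:\ell^{m-1}\mid j,\ 2\nmid j\}$, $J_1^{(3)}=\{j\in J_1:2\ell^{m-1}\mid j\}$; $J_3$ is partitioned into $J_3^{(1)}=\{\ell^m+k\ell^{m-1}-u:1\le k\le\ell-1,\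 0<u\le\ell^{m-1}-1\}$, $J_3^{(2)}=\{\ell^m+k\ell^{m-1}:1\le k\le\ell-1,\ 2\mid k\}$, $J_3^{(3)}=\{\ell^m+k\ell^{m-1}:1\le k\le\ell-1,\ 2\nmid k\}$.
   Formalization: In (d)(i)-(iii), j_β is replaced by j_β+ℓ^m mod 2ℓ^m when (√q+1)/(2ℓ^m) is odd; dimension and two-weight claims exclude α=β=0, m=1, ℓ≢1 mod p (D empty), and, with the weights in (b)(i), exclude β=0, (p,ℓ,m)=(5,3,1), a1 or a2 zero (w1=0). *)

theory Defs
  imports
    "Berlekamp_Zassenhaus.Finite_Field"
    "HOL-Number_Theory.Residue_Primitive_Roots"
    "HOL-Library.Function_Algebras"
    Complex_Main
begin

text \<open>
  \<open>'p mod_ring\<close> with \<open>'p :: prime_card\<close> is the prime field with \<open>p = CARD('p)\<close> elements;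
  \<open>'q :: {field, finite}\<close> is the field with \<open>q = p ^ e\<close> elements.
\<close>

definition embed_Fp :: "'p::prime_card mod_ring \<Rightarrow> 'q::field" where
  "embed_Fp c = of_int (to_int_mod_ring c)"

text \<open>
  The trace of the extension of degree \<open>e\<close>: the sum \<open>x + x\<^sup>p + \<dots> + x ^ (p ^ (e - 1))\<close> lies in the
  prime subfield, and \<open>embed_Fp\<close> is injective when \<open>'q\<close> has characteristic \<open>p\<close>.
\<close>
definition field_trace :: "nat \<Rightarrow> 'q::field \<Rightarrow> 'p::prime_card mod_ring" where
  "field_trace e x = (THE c. embed_Fp c = (\<Sum>i<e. x ^ (CARD('p) ^ i)))"

definition primitive_element :: "'q::field \<Rightarrow> bool" where
  "primitive_element g \<longleftrightarrow> g \<noteq> 0 \<and> (\<forall>x. x \<noteq> 0 \<longrightarrow> (\<exists>k::nat. x = g ^ k))"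

definition ind :: "'q::field \<Rightarrow> 'q \<Rightarrow> nat" where
  "ind g b = (LEAST k. b = g ^ k)"

definition j_index :: "nat \<Rightarrow> nat \<Rightarrow> 'q::field \<Rightarrow> 'q \<Rightarrow> nat" where
  "j_index l m g b = nat ((- int (ind g b)) mod int (2 * l ^ m))"

definition defining_set ::
  "nat \<Rightarrow> nat \<Rightarrow> nat \<Rightarrow> 'p::prime_card mod_ring \<Rightarrow> 'q::{field,finite} \<Rightarrow> 'q set" where
  "defining_set l m e \<alpha> \<beta> =
     {x. x \<noteq> 0 \<and> field_trace e (x ^ ((CARD('q) - 1) div (2 * l ^ m)) + \<beta> * x) = \<alpha>}"

text \<open>
  A word of length \<open>n\<close> over the prime field is a function on the natural numbers vanishing from
  \<open>n\<close> on (positions are numbered from 0). For a list \<open>ds\<close> enumerating a defining set,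
  the code consists of the words \<open>(Tr (d\<^sub>1 x), \<dots>, Tr (d\<^sub>n x))\<close> for \<open>x\<close> in the big field.
\<close>
type_synonym 'p word = "nat \<Rightarrow> 'p mod_ring"

definition codeword :: "nat \<Rightarrow> 'q::field list \<Rightarrow> 'q \<Rightarrow> 'p::prime_card word" where
  "codeword e ds x = (\<lambda>i. if i < length ds then field_trace e (ds ! i * x) else 0)"

definition code :: "nat \<Rightarrow> 'q::field list \<Rightarrow> 'p::prime_card word set" where
  "code e ds = range (codeword e ds)"

definition word_scale :: "'p::prime_card mod_ring \<Rightarrow> 'p word \<Rightarrow> 'p word" where
  "word_scale c w = (\<lambda>i. c * w i)"

lemma vector_space_word_scale: "vector_space word_scale"
  by unfold_locales (auto simp: word_scale_def fun_eq_iff algebra_simps)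

definition code_dim :: "'p::prime_card word set \<Rightarrow> nat" where
  "code_dim C = vector_space.dim word_scale C"

definition hamming_weight :: "'p::prime_card word \<Rightarrow> nat" where
  "hamming_weight w = card {i. w i \<noteq> 0}"

definition nonzero_weights :: "'p::prime_card word set \<Rightarrow> nat set" where
  "nonzero_weights C = hamming_weight ` C - {0}"

definition two_weight_code :: "'p::prime_card word set \<Rightarrow> bool" where
  "two_weight_code C \<longleftrightarrow> card (nonzero_weights C) = 2"

text \<open>
  The weights are given by closed formulas over the reals, so the counting function
  \<open>A\<^sub>w\<close> takes a real argument.
\<close>
definition weight_count :: "'p::prime_card word set \<Rightarrow> real \<Rightarrow> nat" where
  "weight_count C w = card {c \<in> C. real (hamming_weight c) = w}"

definition J :: "nat \<Rightarrow> nat \<Rightarrow> nat set" where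
  "J l m = {0..<2 * l ^ m}"

definition J1 :: "nat \<Rightarrow> nat \<Rightarrow> nat set" where
  "J1 l m = {j \<in> J l m. 1 \<le> j \<and> j \<le> (l - 1) * l ^ (m - 1)}"

definition J2 :: "nat \<Rightarrow> nat \<Rightarrow> nat set" where
  "J2 l m = {j \<in> J l m. (l - 1) * l ^ (m - 1) < j \<and> j \<le> l ^ m}"

definition J1_1 :: "nat \<Rightarrow> nat \<Rightarrow> nat set" where
  "J1_1 l m = {j \<in> J1 l m. \<not> l ^ (m - 1) dvd j}"

definition J1_2 :: "nat \<Rightarrow> nat \<Rightarrow> nat set" where
  "J1_2 l m = {j \<in> J1 l m. l ^ (m - 1) dvd j \<and> \<not> 2 dvd j}"

definition J1_3 :: "nat \<Rightarrow> nat \<Rightarrow> nat set" where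
  "J1_3 l m = {j \<in> J1 l m. 2 * l ^ (m - 1) dvd j}"

definition J3_1 :: "nat \<Rightarrow> nat \<Rightarrow> nat set" where
  "J3_1 l m = {l ^ m + k * l ^ (m - 1) - u |k u.
     1 \<le> k \<and> k \<le> l - 1 \<and> 0 < u \<and> u \<le> l ^ (m - 1) - 1}"

definition J3_2 :: "nat \<Rightarrow> nat \<Rightarrow> nat set" where
  "J3_2 l m = {l ^ m + k * l ^ (m - 1) |k. 1 \<le> k \<and> k \<le> l - 1 \<and> 2 dvd k}"

definition J3_3 :: "nat \<Rightarrow> nat \<Rightarrow> nat set" where
  "J3_3 l m = {l ^ m + k * l ^ (m - 1) |k. 1 \<le> k \<and> k \<le> l - 1 \<and> \<not> 2 dvd k}"

text \<open>
  The two values of the Gauss periods of order \<open>2 * l ^ m\<close> are \<open>(-\<surd>q - 1) / (2 * l ^ m)\<close>, taken on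
  all cyclotomic classes but one, and \<open>((2 * l ^ m - 1) * \<surd>q - 1) / (2 * l ^ m)\<close> on the remaining one.
  That exceptional class is the class 0 if \<open>(\<surd>q + 1) / (2 * l ^ m)\<close> is even, and the class \<open>l ^ m\<close>
  if it is odd. For \<open>\<alpha> \<noteq> 0\<close>, \<open>\<beta> \<noteq> 0\<close> the published conditions on \<open>j\<^sub>\<beta>\<close> are correct in the even
  case, where \<open>j_adj\<close> is \<open>j\<^sub>\<beta>\<close> itself; in the odd case they have to be read with
  \<open>j\<^sub>\<beta> + l ^ m\<close> modulo \<open>2 * l ^ m\<close> in place of \<open>j\<^sub>\<beta>\<close>. For example, with \<open>p = 5\<close>, \<open>l = 3\<close>, \<open>m = 1\<close>,
  \<open>\<alpha> = 2\<close>, \<open>\<beta> = 1\<close> the defining set has 4 elements, whereas \<open>j\<^sub>\<beta> = 0\<close> without the shift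
  would predict 9. For \<open>\<alpha> = 0\<close> the conditions need no shift.

  Two degenerate cases with \<open>\<beta> = 0\<close> have to be kept out of the dimension and two-weight claims:
  for \<open>\<alpha> = 0\<close>, \<open>m = 1\<close> and \<open>l\<close> not congruent to 1 modulo \<open>p\<close> the defining set is empty; for
  \<open>(p, l, m) = (5, 3, 1)\<close> and \<open>\<alpha> = 2\<close> or \<open>\<alpha> = -2\<close> the code has dimension 1 instead of 2, and
  the formula for the first weight gives 0.
\<close>
definition j_adj :: "nat \<Rightarrow> nat \<Rightarrow> nat \<Rightarrow> nat \<Rightarrow> nat \<Rightarrow> nat" where
  "j_adj p e l m j =
     (if even ((p ^ (e div 2) + 1) div (2 * l ^ m)) then j else (j + l ^ m) mod (2 * l ^ m))"

end

theory Submission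
  imports Defs
begin

text \<open>
  Put \<open>r = \<surd>q = p ^ (e / 2)\<close>. Since \<open>p\<close> is a primitive root modulo \<open>2 * l ^ m\<close>, the modulus
  divides \<open>r + 1\<close>, so every nonzero element of the subfield of order \<open>r\<close> has trivial
  \<open>((q - 1) / (2 * l ^ m))\<close>-th power. Hence \<open>T x = Tr (x ^ ((q - 1) / (2 * l ^ m)))\<close> is constant on the punctured lines over this
  subfield. On such a line \<open>x \<mapsto> Tr (\<beta> * x)\<close> is balanced, except on the one line through
  \<open>w / \<beta>\<close>, where \<open>w ^ r = - w\<close> and it vanishes. With \<open>\<kappa>\<close> the number of lines in the defining set
  \<open>D 0\<close> for \<open>\<beta> = 0\<close>, and \<open>\<delta> \<beta> = 1\<close> or \<open>0\<close> according to whether \<open>T (w / \<beta>) = \<alpha>\<close>, counting line by line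
  gives \<open>|D \<beta>| = q / p - \<kappa> + r * \<delta> \<beta>\<close> for \<open>\<beta> \<noteq> 0\<close>. The weight of the codeword of \<open>y\<close> follows without
  characters from the pencil identity
  \<open>p * |{x \<in> D \<beta>. Tr (y * x) = 0}| = (\<Sum>c. |D (\<beta> + c * y)|) - (q - q / p)\<close>.

  The values of \<open>T\<close> are traces of \<open>2 * l ^ m\<close>-th roots of unity. The conjugates of \<open>\<theta> ^ i\<close> are all
  \<open>\<theta> ^ (i * a)\<close> with \<open>a\<close> prime to \<open>2 * l ^ m\<close>, so the trace of \<open>\<theta> ^ i\<close> is a Ramanujan sum.
\<close>

section \<open>Finite fields and the absolute trace\<close>

text \<open>Two obstacles shape the proof. The first is that dimension and weight counts require
  every nonzero \<open>y\<close> to give a nonzero word. For \<open>\<beta> = 0\<close> the weights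
  are proportional to \<open>kappa\<close> and \<open>kappa - 1\<close>, so \<open>kappa = 1\<close>
  must be excluded. Since \<open>kappa = sigma * (r + 1) / (2 * l ^ m)\<close>, where
  \<open>sigma\<close> counts the exponent classes modulo \<open>2 * l ^ m\<close> on which
  \<open>T\<close> equals \<open>\<alpha>\<close>, this value forces \<open>sigma = 1\<close> and
  \<open>r + 1 = 2 * l ^ m\<close>. That exponential equation has two solutions, and only (5, 3, 1)
  is compatible with \<open>sigma = 1\<close>. For \<open>\<beta> \<noteq> 0\<close> the tight case
  is \<open>r = p\<close>, which needs a geometric argument. The second is to express
  \<open>T (w / \<beta>)\<close> by the index of \<open>\<beta>\<close>. Here \<open>w\<close> is
  \<open>g ^ ((r + 1) div 2)\<close>, whose contribution is 1 or -1 according to the parity of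
  \<open>(r + 1) div (2 * l ^ m)\<close>; the sign -1 is a shift of the index by
  \<open>l ^ m\<close>. This is the origin of \<open>j_adj\<close>. What stays undetermined for
  \<open>\<beta> \<noteq> 0\<close> is how many members of the pencil have \<open>delta\<close>
  equal to 1. That number takes at most \<open>p\<close> values in each case, and these are
  parametrised by \<open>k\<close>.\<close>

lemma power_CARD_eq_same:
  fixes x :: "'a::{field,finite}"
  shows "x ^ CARD('a) = x"
proof (cases "x = 0")
  case False
  let ?U = "UNIV - {0 :: 'a}"
  \<comment> \<open>Multiplication by \<open>x\<close> permutes the nonzero elements; cancelling
    their product leaves the power of \<open>x\<close>.\<close>
  have "(\<Prod>y\<in>?U. x * y) = \<Prod>?U"
    by (rule prod.reindex_bij_witness[of _ "\<lambda>y. y / x" "\<lambda>y. x * y"]) (use False in auto)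
  then have "x ^ card ?U * \<Prod>?U = 1 * \<Prod>?U"
    by (simp add: prod.distrib)
  moreover have "\<Prod>?U \<noteq> 0"
    by simp
  ultimately have "x ^ card ?U = 1"
    using mult_right_cancel by blast
  then have "x ^ Suc (card ?U) = x"
    unfolding power_Suc by simp
  then show ?thesis
    by (metis UNIV_I card.remove finite)
qed (simp add: zero_power)

lemma power_CARD_minus_1:
  fixes x :: "'a::{field,finite}"
  assumes "x \<noteq> 0"
  shows "x ^ (CARD('a) - 1) = 1"
proof -
  have "CARD('a) = Suc (CARD('a) - 1)"
    by simp
  with power_CARD_eq_same[of x] have "x * x ^ (CARD('a) - 1) = x * 1"
    by (metis mult.right_neutral power_Suc)
  with assms show ?thesis
    by (metis mult_left_cancel)
qed

text \<open>The linear coefficient covers two uses: \<open>a = -1\<close>, \<open>c = 0\<close>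
  bounds the fixed points of a Frobenius power, and \<open>a = 1\<close> bounds the fibres of the
  relative trace \<open>x + x ^ r\<close>. With \<open>n > 1\<close> the linear term cannot cancel
  the leading one.\<close>

lemma card_power_roots_le:
  fixes a c :: "'a::idom"
  assumes "n > 1"
  shows "card {x. x ^ n + a * x = c} \<le> n"
proof -
  let ?f = "monom 1 n + [:- c, a:]"
  have deg: "degree [:- c, a:] < n"
    using assms by simp
  then have "coeff ?f n = 1"
    by (simp only: coeff_add coeff_monom coeff_eq_0) simp
  then have "?f \<noteq> 0"
    by (metis coeff_0 zero_neq_one)
  then have "card {x. poly ?f x = 0} \<le> degree ?f"
    by (rule card_poly_roots_bound)
  also have "\<dots> \<le> n"
    using deg by (intro degree_add_le) (auto simp: degree_monom_eq)
  also have "{x. poly ?f x = 0} = {x. x ^ n + a * x = c}"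
    by (auto simp: poly_monom algebra_simps)
  finally show ?thesis .
qed

text \<open>The shift by \<open>d - b\<close> injects the fibre over \<open>b\<close> into the fibre
  over \<open>d\<close>, so by symmetry all fibres have the same size. The shifts are abstract so
  that the argument serves both the whole field and its subfield.\<close>

lemma card_fiber_translate:
  fixes f :: "'a \<Rightarrow> 'c::{ab_group_add,finite}"
  assumes "finite A"
    and sh: "\<And>c x. x \<in> A \<Longrightarrow> sh c x \<in> A" "\<And>c x. x \<in> A \<Longrightarrow> f (sh c x) = f x + c"
    and inj: "\<And>c. inj_on (sh c) A"
  shows "card {x \<in> A. f x = c} * CARD('c) = card A"
proof -
  have le: "card {x \<in> A. f x = b} \<le> card {x \<in> A. f x = d}" for b d
  proof (rule card_inj_on_le)
    show "inj_on (sh (d - b)) {x \<in> A. f x = b}"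
      by (rule inj_on_subset[OF inj]) auto
  qed (use assms in auto)
  have "card A = card (\<Union>d. {x \<in> A. f x = d})"
    by (rule arg_cong[of _ _ card]) auto
  also have "\<dots> = (\<Sum>d\<in>UNIV. card {x \<in> A. f x = d})"
    by (rule card_UN_disjoint) (use \<open>finite A\<close> in auto)
  also have "\<dots> = (\<Sum>d\<in>(UNIV :: 'c set). card {x \<in> A. f x = c})"
    by (rule sum.cong) (use le in \<open>auto intro: antisym\<close>)
  finally show ?thesis
    by simp
qed

lemma to_int_mod_ring_add:
  "to_int_mod_ring (a + b :: 'p::finite mod_ring) = (to_int_mod_ring a + to_int_mod_ring b) mod int CARD('p)"
  by transfer simp

lemma to_int_mod_ring_mult:
  "to_int_mod_ring (a * b :: 'p::finite mod_ring) = (to_int_mod_ring a * to_int_mod_ring b) mod int CARD('p)"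
  by transfer simp

locale prime_power_field =
  fixes tr :: "'q::{field,finite} \<Rightarrow> 'p::prime_card mod_ring" and e :: nat
  assumes tr_def: "tr = field_trace e"
    and card_q: "CARD('q) = CARD('p) ^ e"
begin

abbreviation emb :: "'p mod_ring \<Rightarrow> 'q" where
  "emb \<equiv> embed_Fp"

lemma p_gt_1: "CARD('p) > 1"
  by (rule prime_gt_1_nat[OF prime_card])

lemma e_pos: "e > 0"
proof (rule ccontr)
  assume "\<not> e > 0"
  then have "CARD('q) = 1"
    using card_q by simp
  moreover have "card {0, 1 :: 'q} \<le> CARD('q)"
    by (rule card_mono) auto
  ultimately show False
    by simp
qed

lemma CHAR_q: "CHAR('q) = CARD('p)"
proof -
  have "CHAR('q) > 0"
    by (rule finite_imp_CHAR_pos) simp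
  then have "prime CHAR('q)"
    by (rule prime_CHAR_semidom)
  moreover have "CHAR('q) dvd CARD('p) ^ e"
    using CHAR_dvd_CARD[where ?'a = 'q] by (simp add: card_q)
  ultimately show ?thesis
    using prime_card[where ?'a = 'p] by (metis prime_dvd_power primes_dvd_imp_eq)
qed

lemma of_int_eq_iff: "of_int a = (of_int b :: 'q) \<longleftrightarrow> [a = b] (mod int CARD('p))"
  by (simp add: of_int_eq_iff_cong_CHAR CHAR_q)

lemma emb_0 [simp]: "emb 0 = 0"
  and emb_1 [simp]: "emb 1 = 1"
  by (simp_all add: embed_Fp_def)

lemma emb_add: "emb (a + b) = emb a + emb b"
  unfolding embed_Fp_def to_int_mod_ring_add of_int_add[symmetric] of_int_eq_iff by simp

lemma emb_mult: "emb (a * b) = emb a * emb b"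
  unfolding embed_Fp_def to_int_mod_ring_mult of_int_mult[symmetric] of_int_eq_iff by simp

lemma emb_minus: "emb (- a) = - emb a"
  using emb_add[of "- a" a] by (simp add: eq_neg_iff_add_eq_0)

lemma emb_inj: "emb a = emb b \<longleftrightarrow> a = b"
proof
  assume "emb a = emb b"
  then have "[to_int_mod_ring a = to_int_mod_ring b] (mod int CARD('p))"
    by (simp add: embed_Fp_def of_int_eq_iff)
  moreover have "to_int_mod_ring a \<in> {0..<int CARD('p)}" "to_int_mod_ring b \<in> {0..<int CARD('p)}"
    using range_to_int_mod_ring[where ?'a = 'p] by auto
  ultimately have "to_int_mod_ring a = to_int_mod_ring b"
    by (simp add: cong_def)
  then show "a = b"
    by (metis of_int_mod_ring_to_int_mod_ring)
qed simp

lemma emb_eq_0 [simp]: "emb a = 0 \<longleftrightarrow> a = 0"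
  using emb_inj[of a 0] by simp

lemma emb_of_nat: "emb (of_nat n) = of_nat n"
  by (induction n) (auto simp: emb_add)

lemma emb_power: "emb (a ^ n) = emb a ^ n"
  by (induction n) (auto simp: emb_mult)

lemma emb_power_p: "emb a ^ CARD('p) = emb a"
  using arg_cong[OF power_CARD_eq_same[of a], of emb] by (simp add: emb_power)

lemma emb_power_p_power: "emb a ^ (CARD('p) ^ i) = emb a"
  by (induction i) (auto simp: power_mult emb_power_p)

lemma add_power_p_power: "(x + y :: 'q) ^ (CARD('p) ^ i) = x ^ (CARD('p) ^ i) + y ^ (CARD('p) ^ i)"
  by (rule freshmans_dream') (auto simp: CHAR_q prime_card)

text \<open>The embedded elements are \<open>p\<close> distinct roots of \<open>X ^ p - X\<close>,
  which has no room for more.\<close>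

lemma range_emb: "range emb = {x. x ^ CARD('p) = x}"
proof (rule card_seteq)
  have "card {x :: 'q. x ^ CARD('p) = x} \<le> CARD('p)"
    using card_power_roots_le[OF p_gt_1, of "-1 :: 'q" 0] by simp
  also have "\<dots> = card (range emb)"
    by (subst card_image) (auto simp: inj_on_def emb_inj)
  finally show "card {x :: 'q. x ^ CARD('p) = x} \<le> card (range emb)" .
qed (auto simp: emb_power_p)

text \<open>Frobenius permutes the summands cyclically because \<open>x ^ (p ^ e) = x\<close>, so
  the sum is a Frobenius fixed point and lies in the range of \<open>emb\<close>. With injectivity
  of \<open>emb\<close> this makes the definite description in \<open>field_trace\<close>
  meaningful.\<close>

lemma emb_tr: "emb (tr x) = (\<Sum>i<e. x ^ (CARD('p) ^ i))"
proof -
  let ?s = "\<Sum>i<e. x ^ (CARD('p) ^ i)"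
  \<comment> \<open>Adding \<open>x\<close>, the term of exponent \<open>p ^ 0\<close>, completes
    the shifted sum to \<open>e + 1\<close> terms, the last of which is \<open>x\<close>
    again.\<close>
  have "?s ^ CARD('p) + x = (\<Sum>i<e. x ^ (CARD('p) ^ Suc i)) + x ^ (CARD('p) ^ 0)"
    by (simp add: freshmans_dream_sum CHAR_q prime_card power_mult[symmetric] mult.commute del: power_Suc)
      (simp add: mult.commute)
  also have "\<dots> = (\<Sum>i<Suc e. x ^ (CARD('p) ^ i))"
    by (simp only: sum.lessThan_Suc_shift add.commute)
  also have "\<dots> = ?s + x"
    using power_CARD_eq_same[of x] by (simp add: card_q)
  finally have "?s \<in> range emb"
    by (simp add: range_emb)
  then have "\<exists>!c. emb c = ?s"
    by (metis emb_inj rangeE)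
  then have "emb (THE c. emb c = ?s) = ?s"
    by (rule theI')
  then show ?thesis
    by (simp add: tr_def field_trace_def)
qed

lemma tr_add: "tr (x + y) = tr x + tr y"
  using emb_inj[of "tr (x + y)" "tr x + tr y"]
  by (simp add: emb_tr emb_add add_power_p_power sum.distrib)

lemma tr_scale: "tr (emb c * x) = c * tr x"
  using emb_inj[of "tr (emb c * x)" "c * tr x"]
  by (simp add: emb_tr emb_mult power_mult_distrib emb_power_p_power sum_distrib_left)

lemma tr_0 [simp]: "tr 0 = 0"
  using tr_scale[of 0 0] by simp

lemma tr_minus: "tr (- x) = - tr x"
  using tr_add[of "- x" x] by (simp add: eq_neg_iff_add_eq_0)

text \<open>As a polynomial the trace has degree at most \<open>p ^ (e - 1)\<close>, less than the
  size of the field, so it cannot vanish everywhere; a nonzero value is then scaled to 1.\<close>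

lemma ex_tr_eq_1: "\<exists>x. tr x = 1"
proof -
  note p = p_gt_1
  let ?f = "\<Sum>i<e. monom 1 (CARD('p) ^ i) :: 'q poly"
  \<comment> \<open>The polynomial is seen to be nonzero at its linear coefficient, to which only
    \<open>i = 0\<close> contributes.\<close>
  have "coeff ?f 1 = (\<Sum>i<e. if i = 0 then 1 else 0)"
  proof (unfold coeff_sum, rule sum.cong)
    fix i
    have "CARD('p) ^ i = 1 \<longleftrightarrow> i = 0"
      using one_less_power[OF p, of i] by (cases "i = 0") auto
    then show "coeff (monom 1 (CARD('p) ^ i) :: 'q poly) 1 = (if i = 0 then 1 else 0)"
      by (simp only: coeff_monom)
  qed simp
  also have "\<dots> = 1"
    using e_pos by simp
  finally have "?f \<noteq> 0"
    by (metis coeff_0 zero_neq_one)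
  then have "card {x. poly ?f x = 0} \<le> degree ?f"
    by (rule card_poly_roots_bound)
  also have "\<dots> \<le> CARD('p) ^ (e - 1)"
    using p by (intro degree_sum_le) (auto simp: degree_monom_eq intro!: power_increasing)
  also have "\<dots> < CARD('p) ^ e"
    using p e_pos by (intro power_strict_increasing) auto
  finally have "card {x. poly ?f x = 0} < CARD('q)"
    by (simp add: card_q)
  then obtain x where "poly ?f x \<noteq> 0"
    by (metis (mono_tags, lifting) UNIV_eq_I less_irrefl mem_Collect_eq)
  then have "tr x \<noteq> 0"
    using emb_tr[of x] by (auto simp: poly_sum poly_monom)
  then have "tr (emb (inverse (tr x)) * x) = 1"
    by (simp add: tr_scale)
  then show ?thesis ..
qed

lemma ex_tr_mult_eq_1:
  assumes "y \<noteq> 0"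
  shows "\<exists>x. tr (y * x) = 1"
proof -
  from ex_tr_eq_1 obtain z where "tr z = 1" ..
  with assms have "tr (y * (z / y)) = 1"
    by simp
  then show ?thesis ..
qed

lemma card_tr_fiber:
  assumes "y \<noteq> 0"
  shows "card {x. tr (y * x) = c} * CARD('p) = CARD('q)"
proof -
  obtain z where z: "tr (y * z) = 1"
    using ex_tr_mult_eq_1[OF assms] ..
  have "tr (y * (x + emb c * z)) = tr (y * x) + c" for x c
    using tr_scale[of c "y * z"] z by (simp add: tr_add distrib_left mult.left_commute)
  then have "card {x \<in> UNIV. tr (y * x) = c} * CARD('p mod_ring) = CARD('q)"
    by (intro card_fiber_translate[where sh = "\<lambda>c x. x + emb c * z"]) (auto simp: inj_on_def)
  then show ?thesis
    by simp
qed

end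

section \<open>Counting along a quadratic extension\<close>

text \<open>\<open>T\<close> is kept abstract: the counting sees only that it ignores nonzero
  factors from the subfield of order \<open>r\<close>. This separates the counting from the
  arithmetic of roots of unity.\<close>

locale quadratic_tower = prime_power_field tr e
  for tr :: "'q::{field,finite} \<Rightarrow> 'p::prime_card mod_ring" and e :: nat +
  fixes h r :: nat and T :: "'q \<Rightarrow> 'p mod_ring" and w :: 'q and \<alpha> :: "'p mod_ring"
  assumes e_eq: "e = 2 * h" and r_eq: "r = CARD('p) ^ h"
    and w: "w \<noteq> 0" "w ^ r = - w"
    and T_mult: "t ^ r = t \<Longrightarrow> t \<noteq> 0 \<Longrightarrow> T (x * t) = T x"
begin

lemma card_q_eq: "CARD('q) = r\<^sup>2"
  by (simp add: card_q e_eq r_eq power_even_eq)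

lemma h_pos: "h > 0"
  using e_pos e_eq by simp

lemma p_le_r: "CARD('p) \<le> r"
  using power_increasing[of 1 h "CARD('p)"] h_pos p_gt_1 by (simp add: r_eq)

lemma r_gt_1: "r > 1"
  using p_le_r p_gt_1 by linarith

lemma add_power_r: "(x + y :: 'q) ^ r = x ^ r + y ^ r"
  unfolding r_eq by (rule add_power_p_power)

lemma power_r_r: "((x :: 'q) ^ r) ^ r = x"
  using power_CARD_eq_same[of x] by (simp add: card_q_eq power2_eq_square power_mult)

section \<open>The subfield of order \<open>r\<close> and the relative trace\<close>

definition R :: "'q set" where
  "R = {t. t ^ r = t}"

lemma zero_in_R [simp]: "0 \<in> R"
  using r_gt_1 by (simp add: R_def)

lemma R_add: "s \<in> R \<Longrightarrow> t \<in> R \<Longrightarrow> s + t \<in> R"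
  by (simp add: R_def add_power_r)

lemma R_mult: "s \<in> R \<Longrightarrow> t \<in> R \<Longrightarrow> s * t \<in> R"
  by (simp add: R_def power_mult_distrib)

lemma R_divide: "s \<in> R \<Longrightarrow> t \<in> R \<Longrightarrow> s / t \<in> R"
  by (simp add: R_def power_divide)

lemma emb_in_R: "emb c \<in> R"
  using emb_power_p_power[of c h] by (simp add: R_def flip: r_eq)

lemma rel_trace_in_R: "x + x ^ r \<in> R"
  by (simp add: R_def add_power_r power_r_r add.commute)

text \<open>The upper bound counts roots of \<open>X ^ r - X\<close>. For the lower bound,
  \<open>x + x ^ r\<close> sends all \<open>r ^ 2\<close> elements of the field into
  \<open>R\<close>, with at most \<open>r\<close> elements in each fibre.\<close>

lemma card_R: "card R = r"
proof (rule antisym)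
  show "card R \<le> r"
    using card_power_roots_le[OF r_gt_1, of "-1 :: 'q" 0] by (simp add: R_def)
  have "CARD('q) \<le> card (\<Union>c\<in>R. {x. x ^ r + 1 * x = c})"
    by (rule card_mono) (use rel_trace_in_R in \<open>auto simp: add.commute\<close>)
  also have "\<dots> \<le> (\<Sum>c\<in>R. card {x. x ^ r + 1 * x = c})"
    by (rule card_UN_le) simp
  also have "\<dots> \<le> (\<Sum>c\<in>R. r)"
    by (rule sum_mono) (rule card_power_roots_le[OF r_gt_1])
  finally have "r * r \<le> card R * r"
    by (simp add: card_q_eq power2_eq_square)
  then show "r \<le> card R"
    using r_gt_1 by simp
qed

text \<open>Transitivity of the trace: since \<open>t ^ r = t\<close>, the exponents
  \<open>i + h\<close> contribute the conjugates of \<open>x ^ r * t\<close>, so the absolute trace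
  is the trace from \<open>R\<close> to the prime field of \<open>(x + x ^ r) * t\<close>.\<close>

lemma emb_tr_R:
  assumes "t \<in> R"
  shows "emb (tr (x * t)) = (\<Sum>i<h. ((x + x ^ r) * t) ^ (CARD('p) ^ i))"
proof -
  have "(x * t) ^ (CARD('p) ^ (i + h)) = (x ^ r * t) ^ (CARD('p) ^ i)" for i
  proof -
    have "(x * t) ^ (CARD('p) ^ (i + h)) = ((x * t) ^ r) ^ (CARD('p) ^ i)"
      by (simp add: r_eq power_add mult.commute flip: power_mult)
    with assms show ?thesis
      by (simp add: power_mult_distrib R_def)
  qed
  then have "(\<Sum>i = h..<h + h. (x * t) ^ (CARD('p) ^ i)) = (\<Sum>i<h. (x ^ r * t) ^ (CARD('p) ^ i))"
    using sum.shift_bounds_nat_ivl[of "\<lambda>i. (x * t) ^ (CARD('p) ^ i)" 0 h h]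
    by (simp add: atLeast0LessThan)
  moreover have "(\<Sum>i<e. (x * t) ^ (CARD('p) ^ i)) =
      (\<Sum>i<h. (x * t) ^ (CARD('p) ^ i)) + (\<Sum>i = h..<h + h. (x * t) ^ (CARD('p) ^ i))"
    using sum.atLeastLessThan_concat[of 0 h "h + h" "\<lambda>i. (x * t) ^ (CARD('p) ^ i)"]
    by (simp add: e_eq atLeast0LessThan mult_2)
  ultimately show ?thesis
    by (simp add: emb_tr distrib_right add_power_p_power sum.distrib)
qed

lemma tr_R_eq_0:
  assumes "t \<in> R" "x + x ^ r = 0"
  shows "tr (x * t) = 0"
proof -
  have "emb (tr (x * t)) = 0"
    using assms p_gt_1 by (simp add: emb_tr_R zero_power)
  then show ?thesis
    by simp
qed

lemma ex_tr_R_eq_1: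
  assumes "x + x ^ r \<noteq> 0"
  shows "\<exists>t\<in>R. tr (x * t) = 1"
proof -
  from ex_tr_eq_1 obtain z where z: "tr z = 1" ..
  have one: "1 \<in> R"
    by (simp add: R_def)
  \<comment> \<open>\<open>t\<close> is solved for so that the relative trace
    \<open>(x + x ^ r) * t\<close> agrees with that of \<open>z\<close>, whose absolute trace is
    1.\<close>
  define t where "t = (z + z ^ r) / (x + x ^ r)"
  have t: "t \<in> R"
    unfolding t_def by (intro R_divide rel_trace_in_R)
  have "emb (tr (x * t)) = emb (tr (z * 1))"
    unfolding emb_tr_R[OF t] emb_tr_R[OF one] using assms by (simp add: t_def)
  then have "tr (x * t) = tr z"
    by (simp add: emb_inj)
  with t z show ?thesis
    by auto
qed

lemma card_tr_R_fiber:
  assumes "x + x ^ r \<noteq> 0"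
  shows "card {t \<in> R. tr (x * t) = c} * CARD('p) = r"
proof -
  obtain s where s: "s \<in> R" "tr (x * s) = 1"
    using ex_tr_R_eq_1[OF assms] by blast
  have "tr (x * (t + emb c * s)) = tr (x * t) + c" for t c
    using tr_scale[of c "x * s"] s by (simp add: tr_add distrib_left mult.left_commute)
  then have "card {t \<in> R. tr (x * t) = c} * CARD('p mod_ring) = card R"
    using s by (intro card_fiber_translate[where sh = "\<lambda>c t. t + emb c * s"])
      (auto simp: inj_on_def intro: R_add R_mult emb_in_R)
  then show ?thesis
    by (simp add: card_R)
qed

lemma rel_trace_eq_0_iff: "x + x ^ r = 0 \<longleftrightarrow> x / w \<in> R"
proof -
  have "x / w \<in> R \<longleftrightarrow> x ^ r / (- w) = x / w"
    by (simp add: R_def power_divide w)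
  also have "\<dots> \<longleftrightarrow> - (x ^ r) = x"
    using w by (simp add: field_simps)
  also have "\<dots> \<longleftrightarrow> x + x ^ r = 0"
    by (metis add.commute add_eq_0_iff)
  finally show ?thesis ..
qed

section \<open>Counting the defining set over the subfield\<close>

definition D :: "'q \<Rightarrow> 'q set" where
  "D \<beta> = {x. x \<noteq> 0 \<and> T x + tr (\<beta> * x) = \<alpha>}"

definition delta :: "'q \<Rightarrow> real" where
  "delta \<beta> = of_bool (T (w / \<beta>) = \<alpha>)"

definition kappa :: real where
  "kappa = real (card (D 0)) / real (r - 1)"

text \<open>Along the line only \<open>tr (\<beta> * x * t)\<close> varies with \<open>t\<close>.
  Removing \<open>t = 0\<close> costs one solution exactly when \<open>T x = \<alpha>\<close>. The
  right-hand side is the generic value plus a correction supported on the exceptional line, so that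
  summation over \<open>x\<close> isolates \<open>delta\<close>.\<close>

lemma card_R_orbit:
  assumes "x \<noteq> 0"
  shows "real (card {t \<in> R - {0}. x * t \<in> D \<beta>}) =
    (real r / real CARD('p) - of_bool (T x = \<alpha>)) +
    of_bool (\<beta> * x / w \<in> R) * (real r * of_bool (T x = \<alpha>) - real r / real CARD('p))"
proof -
  have eq: "{t \<in> R - {0}. x * t \<in> D \<beta>} = {t \<in> R. tr (\<beta> * x * t) = \<alpha> - T x} - {0}"
    using assms T_mult by (auto simp: D_def R_def eq_diff_eq add.commute mult.assoc)
  show ?thesis
  proof (cases "\<beta> * x / w \<in> R")
    case True
    then have "{t \<in> R. tr (\<beta> * x * t) = \<alpha> - T x} = (if T x = \<alpha> then R else {})"
      by (auto simp: tr_R_eq_0 simp flip: rel_trace_eq_0_iff)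
    then have "card {t \<in> R - {0}. x * t \<in> D \<beta>} = (if T x = \<alpha> then r - 1 else 0)"
      unfolding eq by (simp add: card_R)
    then show ?thesis
      using True r_gt_1 by (simp add: of_nat_diff)
  next
    case False
    then have fib: "card {t \<in> R. tr (\<beta> * x * t) = \<alpha> - T x} * CARD('p) = r"
      by (intro card_tr_R_fiber) (simp add: rel_trace_eq_0_iff)
    then have fib': "real (card {t \<in> R. tr (\<beta> * x * t) = \<alpha> - T x}) = real r / real CARD('p)"
      using arg_cong[OF fib, of real] by (simp add: nonzero_eq_divide_eq)
    define A where "A = {t \<in> R. tr (\<beta> * x * t) = \<alpha> - T x}"
    have "0 \<in> A \<longleftrightarrow> T x = \<alpha>"
      by (auto simp: A_def)
    then have "real (card (A - {0})) = real (card A) - of_bool (T x = \<alpha>)"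
      using card.remove[of A 0] by (cases "T x = \<alpha>") auto
    then show ?thesis
      using False fib' unfolding eq A_def[symmetric] by simp
  qed
qed

lemma card_eq_sum: "finite A \<Longrightarrow> real (card {x \<in> A. P x}) = (\<Sum>x\<in>A. of_bool (P x))"
  by (simp add: sum.If_cases of_bool_def Int_def)

text \<open>Double counting of the pairs of nonzero \<open>x\<close> and \<open>t\<close> in
  \<open>R - {0}\<close> with \<open>x * t\<close> in \<open>D \<beta>\<close>: every
  \<open>t\<close> yields \<open>card (D \<beta>)\<close> pairs, every \<open>x\<close> the number
  from \<open>card_R_orbit\<close>. Each line is counted \<open>r - 1\<close> times, which spares a
  choice of representatives.\<close>

lemma card_D:
  assumes "\<beta> \<noteq> 0"
  shows "real (card (D \<beta>)) = (real r)\<^sup>2 / real CARD('p) - kappa + real r * delta \<beta>"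
proof -
  let ?U = "UNIV - {0 :: 'q}" and ?p = "real CARD('p)"
  have r1: "real (r - 1) = real r - 1" "real r - 1 \<noteq> 0"
    using r_gt_1 by (simp_all add: of_nat_diff)
  have cU: "real (card ?U) = (real r - 1) * (real r + 1)"
    using r_gt_1 by (simp add: card_Diff_singleton card_q_eq of_nat_diff power2_eq_square algebra_simps)
  have orbit: "card {x \<in> ?U. x * t \<in> D \<beta>} = card (D \<beta>)" if "t \<noteq> 0" for t
  proof (rule bij_betw_same_card)
    show "bij_betw (\<lambda>x. x * t) {x \<in> ?U. x * t \<in> D \<beta>} (D \<beta>)"
      by (rule bij_betwI[of _ _ _ "\<lambda>x. x / t"]) (use that in \<open>auto simp: D_def\<close>)
  qed
  have "(real r - 1) * card (D \<beta>) = (\<Sum>t\<in>R - {0}. real (card (D \<beta>)))"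
    using r1 by (simp add: card_R card_Diff_singleton)
  also have "\<dots> = (\<Sum>t\<in>R - {0}. real (card {x \<in> ?U. x * t \<in> D \<beta>}))"
    by (rule sum.cong) (use orbit in auto)
  also have "\<dots> = (\<Sum>t\<in>R - {0}. \<Sum>x\<in>?U. of_bool (x * t \<in> D \<beta>))"
    by (simp only: card_eq_sum[OF finite])
  also have "\<dots> = (\<Sum>x\<in>?U. \<Sum>t\<in>R - {0}. of_bool (x * t \<in> D \<beta>))"
    by (rule sum.swap)
  also have "\<dots> = (\<Sum>x\<in>?U. real (card {t \<in> R - {0}. x * t \<in> D \<beta>}))"
    by (simp only: card_eq_sum[OF finite])
  also have "\<dots> = (\<Sum>x\<in>?U. (real r / ?p - of_bool (T x = \<alpha>)) +
      of_bool (\<beta> * x / w \<in> R) * (real r * of_bool (T x = \<alpha>) - real r / ?p))"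
    by (intro sum.cong refl card_R_orbit) simp
  also have "\<dots> = real (card ?U) * (real r / ?p) - (\<Sum>x\<in>?U. of_bool (T x = \<alpha>)) +
      (\<Sum>x\<in>?U. of_bool (\<beta> * x / w \<in> R) * (real r * of_bool (T x = \<alpha>) - real r / ?p))"
    by (simp only: sum.distrib sum_subtractf sum_constant)
  also have "(\<Sum>x\<in>?U. of_bool (T x = \<alpha>)) = real (card (D 0))"
    by (subst card_eq_sum[symmetric]) (auto simp: D_def intro!: arg_cong[of _ _ card])
  also have "(\<Sum>x\<in>?U. of_bool (\<beta> * x / w \<in> R) * (real r * of_bool (T x = \<alpha>) - real r / ?p)) =
      (\<Sum>x\<in>?U. of_bool (\<beta> * x / w \<in> R) * (real r * delta \<beta> - real r / ?p))"
  proof (rule sum.cong)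
    fix x assume "x \<in> ?U"
    show "of_bool (\<beta> * x / w \<in> R) * (real r * of_bool (T x = \<alpha>) - real r / ?p) =
        of_bool (\<beta> * x / w \<in> R) * (real r * delta \<beta> - real r / ?p)"
    proof (cases "\<beta> * x / w \<in> R")
      case True
      \<comment> \<open>Every \<open>x\<close> satisfying the condition lies on the line through
        \<open>w / \<beta>\<close>, so \<open>T x\<close> may be replaced by the value
        there.\<close>
      then have "T (w / \<beta> * (\<beta> * x / w)) = T (w / \<beta>)"
        using assms w \<open>x \<in> ?U\<close> by (intro T_mult) (auto simp: R_def)
      then show ?thesis
        using assms w by (simp add: delta_def)
    qed simp
  qed simp
  also have "\<dots> = real (card {x \<in> ?U. \<beta> * x / w \<in> R}) * (real r * delta \<beta> - real r / ?p)"
    by (simp only: card_eq_sum[OF finite] sum_distrib_right)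
  also have "card {x \<in> ?U. \<beta> * x / w \<in> R} = card (R - {0})"
  proof (rule bij_betw_same_card)
    show "bij_betw (\<lambda>x. \<beta> * x / w) {x \<in> ?U. \<beta> * x / w \<in> R} (R - {0})"
      by (rule bij_betwI[of _ _ _ "\<lambda>t. w / \<beta> * t"]) (use assms w in auto)
  qed
  also have "real (card (R - {0})) = real r - 1"
    using r1 by (simp add: card_R card_Diff_singleton)
  also have "real (card (D 0)) = kappa * (real r - 1)"
    using r1 by (simp add: kappa_def)
  finally have "(real r - 1) * card (D \<beta>) =
      (real r - 1) * ((real r)\<^sup>2 / ?p - kappa + real r * delta \<beta>)"
    unfolding cU by (simp add: algebra_simps power2_eq_square add_divide_distrib diff_divide_distrib)
  then show ?thesis
    using r1 by simp
qed

lemma card_D_0: "real (card (D 0)) = kappa * (real r - 1)"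
  using r_gt_1 by (simp add: kappa_def of_nat_diff)

section \<open>Weights from the pencil identity\<close>

definition zeros :: "'q \<Rightarrow> 'q \<Rightarrow> 'q set" where
  "zeros \<beta> y = {x \<in> D \<beta>. tr (y * x) = 0}"

definition wt :: "'q \<Rightarrow> 'q \<Rightarrow> nat" where
  "wt \<beta> y = card {x \<in> D \<beta>. tr (y * x) \<noteq> 0}"

lemma wt_eq: "real (wt \<beta> y) = real (card (D \<beta>)) - real (card (zeros \<beta> y))"
proof -
  have "{x \<in> D \<beta>. tr (y * x) \<noteq> 0} = D \<beta> - zeros \<beta> y" "zeros \<beta> y \<subseteq> D \<beta>"
    by (auto simp: zeros_def)
  then show ?thesis
    by (simp add: wt_def card_Diff_subset of_nat_diff card_mono)
qed

text \<open>Each \<open>x\<close> with \<open>tr (y * x) \<noteq> 0\<close> lies in exactly one of the sets \<open>D (\<beta> + c y)\<close>, and every other \<open>x\<close>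
  lies in all of them or in none.\<close>
lemma card_zeros:
  assumes "y \<noteq> 0"
  shows "real CARD('p) * real (card (zeros \<beta> y)) =
    (\<Sum>c\<in>UNIV. real (card (D (\<beta> + emb c * y)))) - ((real r)\<^sup>2 - (real r)\<^sup>2 / real CARD('p))"
proof -
  let ?U = "UNIV - {0 :: 'q}" and ?p = "real CARD('p)"
  have p: "?p \<noteq> 0"
    using p_gt_1 by simp
  have D_eq: "D \<gamma> = {x \<in> ?U. T x + tr (\<gamma> * x) = \<alpha>}" for \<gamma>
    by (auto simp: D_def)
  have tr_eq: "tr ((\<beta> + emb c * y) * x) = tr (\<beta> * x) + c * tr (y * x)" for c x
    using tr_scale[of c "y * x"] by (simp add: distrib_right tr_add mult.assoc)
  have cnt: "real (card {c. T x + tr ((\<beta> + emb c * y) * x) = \<alpha>}) =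
      of_bool (tr (y * x) \<noteq> 0) + ?p * of_bool (x \<in> zeros \<beta> y)" if "x \<in> ?U" for x
  proof (cases "tr (y * x) = 0")
    case True
    then have "{c. T x + tr ((\<beta> + emb c * y) * x) = \<alpha>} = (if x \<in> D \<beta> then UNIV else {})"
      using that by (auto simp: tr_eq D_def)
    then show ?thesis
      using True by (simp add: zeros_def)
  next
    case False
    then have "{c. T x + tr ((\<beta> + emb c * y) * x) = \<alpha>} = {(\<alpha> - T x - tr (\<beta> * x)) / tr (y * x)}"
      unfolding tr_eq by (auto simp: field_simps)
    then show ?thesis
      using False by (simp add: zeros_def)
  qed
  have "(\<Sum>c\<in>UNIV. real (card (D (\<beta> + emb c * y)))) =
      (\<Sum>c\<in>UNIV. \<Sum>x\<in>?U. of_bool (T x + tr ((\<beta> + emb c * y) * x) = \<alpha>))"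
    by (simp only: D_eq card_eq_sum[OF finite])
  also have "\<dots> = (\<Sum>x\<in>?U. \<Sum>c\<in>UNIV. of_bool (T x + tr ((\<beta> + emb c * y) * x) = \<alpha>))"
    by (rule sum.swap)
  also have "\<dots> = (\<Sum>x\<in>?U. of_bool (tr (y * x) \<noteq> 0) + ?p * of_bool (x \<in> zeros \<beta> y))"
  proof (rule sum.cong)
    fix x assume "x \<in> ?U"
    then show "(\<Sum>c\<in>UNIV. of_bool (T x + tr ((\<beta> + emb c * y) * x) = \<alpha>)) =
        of_bool (tr (y * x) \<noteq> 0) + ?p * of_bool (x \<in> zeros \<beta> y)"
      using cnt card_eq_sum[of "UNIV :: 'p mod_ring set"] by simp
  qed simp
  also have "\<dots> = real (card {x \<in> ?U. tr (y * x) \<noteq> 0}) + ?p * real (card {x \<in> ?U. x \<in> zeros \<beta> y})"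
    by (simp only: sum.distrib card_eq_sum[OF finite] sum_distrib_left)
  also have "{x \<in> ?U. x \<in> zeros \<beta> y} = zeros \<beta> y"
    by (auto simp: zeros_def D_def)
  also have "{x \<in> ?U. tr (y * x) \<noteq> 0} = UNIV - {x. tr (y * x) = 0}"
    by auto
  also have "real (card \<dots>) = (real r)\<^sup>2 - (real r)\<^sup>2 / ?p"
  proof -
    have fib: "card {x. tr (y * x) = 0} * CARD('p) = r\<^sup>2"
      using card_tr_fiber[OF assms, of 0] by (simp add: card_q_eq)
    then have "real (card {x. tr (y * x) = 0}) * ?p = (real r)\<^sup>2"
      by (metis of_nat_mult of_nat_power)
    then have "real (card {x. tr (y * x) = 0}) = (real r)\<^sup>2 / ?p"
      using p by (simp add: field_simps)
    moreover have "card {x. tr (y * x) = 0} \<le> CARD('q)"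
      by (rule card_mono) auto
    ultimately show ?thesis
      by (simp add: card_Diff_subset of_nat_diff card_q_eq)
  qed
  finally show ?thesis
    by simp
qed

lemma delta_scale:
  assumes "c \<noteq> 0"
  shows "delta (emb c * y) = delta y"
proof -
  have "T (w / y * (1 / emb c)) = T (w / y)"
    using emb_in_R[of c] assms by (intro T_mult) (simp_all add: R_def power_divide)
  then show ?thesis
    by (simp add: delta_def mult.commute)
qed

text \<open>When the parameter is itself a multiple of \<open>y\<close>, the pencil consists of all
  prime-field multiples of \<open>y\<close>: the member 0, counted by \<open>card_D_0\<close>, and
  \<open>p - 1\<close> members sharing one \<open>delta\<close>. Hence the result does not depend on
  \<open>c\<close>.\<close>

lemma card_zeros_line:
  assumes "y \<noteq> 0"
  shows "real (card (zeros (emb c * y) y)) =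
    (kappa * (real r - real CARD('p)) + (real CARD('p) - 1) * (real r * delta y)) / real CARD('p)"
proof -
  let ?p = "real CARD('p)" and ?f = "\<lambda>c. real (card (D (emb c * y)))"
  have p: "?p \<noteq> 0"
    using p_gt_1 by simp
  have "?p * real (card (zeros (emb c * y) y)) + ((real r)\<^sup>2 - (real r)\<^sup>2 / ?p) = (\<Sum>d\<in>UNIV. ?f (c + d))"
    using card_zeros[OF assms, of "emb c * y"] by (simp add: emb_add distrib_right)
  also have "\<dots> = (\<Sum>d\<in>UNIV. ?f d)"
    by (rule sum.reindex_bij_witness[of _ "\<lambda>d. d - c" "\<lambda>d. c + d"]) auto
  also have "\<dots> = ?f 0 + (\<Sum>d\<in>UNIV - {0}. ?f d)"
    by (rule sum.remove) auto
  also have "(\<Sum>d\<in>UNIV - {0}. ?f d) = (\<Sum>d\<in>UNIV - {0 :: 'p mod_ring}. (real r)\<^sup>2 / ?p - kappa + real r * delta y)"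
    by (rule sum.cong) (use assms in \<open>auto simp: card_D delta_scale\<close>)
  also have "\<dots> = (?p - 1) * ((real r)\<^sup>2 / ?p - kappa + real r * delta y)"
    using p_gt_1 by (simp add: card_Diff_singleton of_nat_diff)
  finally have F: "?p * real (card (zeros (emb c * y) y)) + ((real r)\<^sup>2 - (real r)\<^sup>2 / ?p) =
      kappa * (real r - 1) + (?p - 1) * ((real r)\<^sup>2 / ?p - kappa + real r * delta y)"
    by (simp add: card_D_0)
  define X where "X = (real r)\<^sup>2 / ?p"
  have "?p * real (card (zeros (emb c * y) y)) =
      kappa * (real r - 1) + (?p - 1) * (X - kappa + real r * delta y) - ((real r)\<^sup>2 - X)"
    using F unfolding X_def by linarith
  also have "(real r)\<^sup>2 = ?p * X"
    using p by (simp add: X_def)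
  also have "kappa * (real r - 1) + (?p - 1) * (X - kappa + real r * delta y) - (?p * X - X) =
      kappa * (real r - ?p) + (?p - 1) * (real r * delta y)"
    by (simp add: algebra_simps)
  finally show ?thesis
    using p by (simp add: nonzero_eq_divide_eq mult.commute)
qed

lemma wt_zero:
  assumes "y \<noteq> 0"
  shows "real (wt 0 y) = (real CARD('p) - 1) * real r / real CARD('p) * (kappa - delta y)"
  using card_zeros_line[OF assms, of 0] p_gt_1 by (simp add: wt_eq card_D_0 field_simps)

text \<open>\<open>\<beta>\<close> is \<open>inverse c\<close> times \<open>emb c * \<beta>\<close>,
  so the pencil is again the full set of multiples and \<open>card_zeros_line\<close>
  applies.\<close>

lemma wt_multiple:
  assumes "\<beta> \<noteq> 0" "c \<noteq> 0"
  shows "real (wt \<beta> (emb c * \<beta>)) = real r / real CARD('p) * (real r - kappa + delta \<beta>)"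
proof -
  have ne: "emb c * \<beta> \<noteq> 0" and eq: "emb (inverse c) * (emb c * \<beta>) = \<beta>"
    using assms by (simp_all add: mult.assoc[symmetric] flip: emb_mult)
  have "real (card (zeros \<beta> (emb c * \<beta>))) =
    (kappa * (real r - real CARD('p)) + (real CARD('p) - 1) * (real r * delta \<beta>)) / real CARD('p)"
    using card_zeros_line[OF ne, of "inverse c"] by (simp only: eq delta_scale[OF assms(2)])
  then show ?thesis
    using assms p_gt_1 by (simp add: wt_eq card_D field_simps power2_eq_square)
qed

lemma add_multiple_nonzero:
  assumes "\<beta> \<noteq> 0" "\<And>c. y \<noteq> emb c * \<beta>"
  shows "\<beta> + emb c * y \<noteq> 0"
proof
  assume *: "\<beta> + emb c * y = 0"
  with assms(1) have "c \<noteq> 0"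
    by auto
  have "emb (- inverse c) * \<beta> = emb (inverse c) * (emb c * y)"
    using * by (simp add: emb_minus add_eq_0_iff2)
  also have "\<dots> = y"
    using \<open>c \<noteq> 0\<close> by (simp add: mult.assoc[symmetric] flip: emb_mult)
  finally show False
    using assms(2) by metis
qed

text \<open>The members of the pencil through \<open>\<beta>\<close> in direction \<open>y\<close>
  whose \<open>delta\<close> is 1. Their number is the only part of the weight in
  \<open>wt_other\<close> that \<open>\<beta>\<close> alone does not determine.\<close>

definition exceptional_shifts :: "'q \<Rightarrow> 'q \<Rightarrow> 'p mod_ring set" where
  "exceptional_shifts \<beta> y = {c. T (w / (\<beta> + emb c * y)) = \<alpha>}"

text \<open>No member of the pencil is zero, so \<open>card_D\<close> applies to all of them;
  \<open>kappa\<close> enters the length and the number of zeros equally and cancels.\<close>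

lemma wt_other:
  assumes "\<beta> \<noteq> 0" "y \<noteq> 0" "\<And>c. y \<noteq> emb c * \<beta>"
  shows "real (wt \<beta> y) = (real CARD('p) - 1) / (real CARD('p))\<^sup>2 * (real r)\<^sup>2 +
    real r * (delta \<beta> - real (card (exceptional_shifts \<beta> y)) / real CARD('p))"
proof -
  let ?p = "real CARD('p)"
  have p: "?p \<noteq> 0"
    using p_gt_1 by simp
  note ne = add_multiple_nonzero[OF assms(1,3)]
  have "?p * real (card (zeros \<beta> y)) + ((real r)\<^sup>2 - (real r)\<^sup>2 / ?p) =
      (\<Sum>c\<in>UNIV. (real r)\<^sup>2 / ?p - kappa + real r * delta (\<beta> + emb c * y))"
    using card_zeros[OF assms(2), of \<beta>] by (simp add: card_D ne)
  also have "\<dots> = ?p * ((real r)\<^sup>2 / ?p - kappa) + real r * real (card (exceptional_shifts \<beta> y))"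
    using card_eq_sum[of "UNIV :: 'p mod_ring set" "\<lambda>c. T (w / (\<beta> + emb c * y)) = \<alpha>"]
    by (simp add: sum.distrib delta_def exceptional_shifts_def flip: sum_distrib_left)
  finally show ?thesis
    using p ne[of 0] by (simp add: wt_eq card_D field_simps power2_eq_square)
qed

end

section \<open>Codes and their dimension\<close>

text \<open>Induction on the basis: because \<open>a\<close> lies outside \<open>span B\<close>, the
  representation \<open>scale k a + x\<close> is unique, so each new vector multiplies the size by
  the number of scalars.\<close>

lemma (in vector_space) card_span_independent:
  assumes "finite (UNIV :: 'a set)" "finite B" "independent B"
  shows "card (span B) = CARD('a) ^ card B"
  using assms(2,3)
proof (induction B rule: finite_induct)
  case (insert a B)
  then have a: "a \<notin> span B" and B: "independent B"
    by (simp_all add: independent_insert)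
  have "bij_betw (\<lambda>(k, x). scale k a + x) (UNIV \<times> span B) (span (insert a B))"
    unfolding bij_betw_def
  proof
    show "inj_on (\<lambda>(k, x). scale k a + x) (UNIV \<times> span B)"
    proof (rule inj_onI, clarify)
      fix k x k' x'
      assume x: "x \<in> span B" "x' \<in> span B" and eq: "scale k a + x = scale k' a + x'"
      have "scale (k - k') a = x' - x"
        using eq by (simp add: scale_left_diff_distrib algebra_simps)
      then have in_span: "scale (k - k') a \<in> span B"
        using x by (simp add: span_diff)
      have "k = k'"
      proof (rule ccontr)
        assume "k \<noteq> k'"
        with span_scale[OF in_span, of "inverse (k - k')"] a show False
          by simp
      qed
      with eq show "k = k' \<and> x = x'"
        by simp
    qed
    show "(\<lambda>(k, x). scale k a + x) ` (UNIV \<times> span B) = span (insert a B)"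
    proof safe
      fix k x assume "x \<in> span B"
      then have "x \<in> span (insert a B)"
        using span_mono[of B "insert a B"] by blast
      then show "scale k a + x \<in> span (insert a B)"
        by (simp add: span_add span_scale span_base)
    next
      fix z assume "z \<in> span (insert a B)"
      then obtain k where "z - scale k a \<in> span B"
        by (auto simp: span_insert)
      then show "z \<in> (\<lambda>(k, x). scale k a + x) ` (UNIV \<times> span B)"
        by (intro image_eqI[of _ _ "(k, z - scale k a)"]) auto
    qed
  qed
  then have "card ((UNIV :: 'a set) \<times> span B) = card (span (insert a B))"
    by (rule bij_betw_same_card)
  with insert B show ?case
    by (simp add: card_cartesian_product)
qed simp

text \<open>Over a finite field the dimension can be read off from the cardinality. For the codes
  this reduces the dimension claim to injectivity of the encoding, without exhibiting a
  basis.\<close>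

lemma (in vector_space) dim_eq_of_card:
  assumes "finite (UNIV :: 'a set)" "subspace V" "card V = CARD('a) ^ d"
  shows "dim V = d"
proof -
  have two: "card {0, 1 :: 'a} \<le> CARD('a)"
    using assms(1) by (intro card_mono) auto
  obtain B where B: "B \<subseteq> V" "independent B" "V \<subseteq> span B" "card B = dim V"
    using basis_exists by blast
  have "finite V"
    using assms(3) two by (intro card_ge_0_finite) auto
  moreover have "span B = V"
    using B assms(2) span_minimal by blast
  ultimately have "CARD('a) ^ d = CARD('a) ^ card B"
    using card_span_independent[OF assms(1) _ B(2)] B(1) assms(3) finite_subset by metis
  then show ?thesis
    using two B(4) by simp
qed

section \<open>Codes attached to an enumeration of the defining set\<close>

context quadratic_tower
begin

lemma wt_0_right [simp]: "wt \<beta> 0 = 0"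
  by (simp add: wt_def)

context
  fixes ds :: "'q list" and \<beta> :: 'q and C :: "'p word set"
  assumes ds: "distinct ds" "set ds = D \<beta>"
    and C: "C = code e ds"
begin

abbreviation cw :: "'q \<Rightarrow> 'p word" where
  "cw \<equiv> codeword e ds"

lemma codeword_eq: "cw y = (\<lambda>i. if i < length ds then tr (y * ds ! i) else 0)"
  by (auto simp: codeword_def tr_def mult.commute)

lemma length_ds: "length ds = card (D \<beta>)"
  using ds distinct_card by metis

lemma hamming_weight_codeword: "hamming_weight (cw y) = wt \<beta> y"
proof -
  have "bij_betw (\<lambda>i. ds ! i) {i. cw y i \<noteq> 0} {x \<in> D \<beta>. tr (y * x) \<noteq> 0}"
    unfolding bij_betw_def
  proof
    show "inj_on ((!) ds) {i. cw y i \<noteq> 0}"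
      using ds by (auto simp: inj_on_def codeword_eq nth_eq_iff_index_eq split: if_splits)
    have "\<exists>i. tr (y * ds ! i) \<noteq> 0 \<and> i < length ds \<and> x = ds ! i" if "x \<in> D \<beta>" "tr (y * x) \<noteq> 0" for x
      using that ds by (metis in_set_conv_nth)
    then show "(!) ds ` {i. cw y i \<noteq> 0} = {x \<in> D \<beta>. tr (y * x) \<noteq> 0}"
      using ds by (fastforce simp: codeword_eq image_iff split: if_splits)
  qed
  then show ?thesis
    unfolding hamming_weight_def wt_def by (rule bij_betw_same_card)
qed

text \<open>Nonzero weight for every nonzero \<open>y\<close> says that the linear encoding has
  trivial kernel. Words and field elements then correspond one to one, and dimension, weights and
  weight counts become statements about \<open>wt\<close>.\<close>

context
  assumes wt_pos: "\<forall>y. y \<noteq> 0 \<longrightarrow> wt \<beta> y \<noteq> 0"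
begin

lemma inj_codeword: "inj cw"
proof (rule injI, rule ccontr)
  fix x y assume eq: "cw x = cw y" and "x \<noteq> y"
  have "tr (x * d) = tr (y * d)" if "d \<in> D \<beta>" for d
  proof -
    from that ds obtain i where "i < length ds" "d = ds ! i"
      by (metis in_set_conv_nth)
    with fun_cong[OF eq, of i] show ?thesis
      by (simp add: codeword_eq)
  qed
  then have "tr ((x - y) * d) = 0" if "d \<in> D \<beta>" for d
    using that tr_add[of "x * d" "- (y * d)"] by (simp add: left_diff_distrib tr_minus)
  then have "wt \<beta> (x - y) = 0"
    by (simp add: wt_def)
  with wt_pos[rule_format, of "x - y"] \<open>x \<noteq> y\<close> show False
    by simp
qed

lemma code_dim_eq: "code_dim C = e"
proof -
  interpret word: vector_space "word_scale :: 'p mod_ring \<Rightarrow> 'p word \<Rightarrow> 'p word"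
    by (rule vector_space_word_scale)
  have "word.subspace C"
  proof (rule word.subspaceI)
    have "cw 0 = 0"
      by (auto simp: codeword_eq)
    then show "0 \<in> C"
      unfolding C code_def by (metis rangeI)
  next
    fix v v' assume "v \<in> C" "v' \<in> C"
    then obtain x x' where "v = cw x" "v' = cw x'"
      by (auto simp: C code_def)
    then have "v + v' = cw (x + x')"
      by (auto simp: codeword_eq distrib_right tr_add)
    then show "v + v' \<in> C"
      by (simp add: C code_def)
  next
    fix c v assume "v \<in> C"
    then obtain x where "v = cw x"
      by (auto simp: C code_def)
    then have "word_scale c v = cw (emb c * x)"
      by (auto simp: codeword_eq word_scale_def mult.assoc tr_scale)
    then show "word_scale c v \<in> C"
      by (simp add: C code_def)
  qed
  moreover have "card C = CARD('p mod_ring) ^ e"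
    using card_image[OF inj_codeword] by (simp add: C code_def card_q)
  ultimately show ?thesis
    unfolding code_dim_def by (intro word.dim_eq_of_card) auto
qed

lemma nonzero_weights_eq: "nonzero_weights C = wt \<beta> ` (UNIV - {0})"
proof -
  have "hamming_weight ` C = range (wt \<beta>)"
    by (auto simp: C code_def image_image hamming_weight_codeword)
  also have "\<dots> = insert 0 (wt \<beta> ` (UNIV - {0}))"
    by (subst wt_0_right[symmetric], subst image_insert[symmetric]) (simp add: insert_UNIV)
  finally have "hamming_weight ` C = insert 0 (wt \<beta> ` (UNIV - {0}))" .
  moreover have "0 \<notin> wt \<beta> ` (UNIV - {0})"
    using wt_pos by (metis DiffE imageE singletonI)
  ultimately show ?thesis
    by (simp add: nonzero_weights_def)
qed

lemma weight_count_eq: "weight_count C v = card {y. real (wt \<beta> y) = v}"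
proof -
  have "{c \<in> C. real (hamming_weight c) = v} = cw ` {y. real (wt \<beta> y) = v}"
    by (auto simp: C code_def hamming_weight_codeword)
  then show ?thesis
    unfolding weight_count_def
    using card_image[OF inj_on_subset[OF inj_codeword subset_UNIV]] by simp
qed

end

end

end

section \<open>Weights\<close>

lemma level_set_eq:
  assumes "\<And>y. y = z \<or> y \<in> A \<or> y \<in> B"
    and "\<And>y. y \<in> A \<Longrightarrow> f y = a" "\<And>y. y \<in> B \<Longrightarrow> f y = b" "f z \<noteq> a" "a \<noteq> b"
  shows "{y. f y = a} = A"
proof (intro Set.set_eqI iffI)
  fix y assume "y \<in> {y. f y = a}"
  then show "y \<in> A"
    using assms(1)[of y] assms(3)[of y] assms(4,5) by auto
qed (use assms(2) in simp)

context quadratic_tower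
begin

text \<open>The involution sending \<open>y\<close> to \<open>w / y\<close> exchanges the two sets.
  This is why the weight belonging to \<open>delta y = 1\<close> occurs exactly as often as the code
  is long.\<close>

lemma card_delta: "card {y. y \<noteq> 0 \<and> T (w / y) = \<alpha>} = card (D 0)"
proof (rule bij_betw_same_card)
  show "bij_betw (\<lambda>y. w / y) {y. y \<noteq> 0 \<and> T (w / y) = \<alpha>} (D 0)"
    by (rule bij_betwI[of _ _ _ "\<lambda>y. w / y"]) (use w in \<open>auto simp: D_def\<close>)
qed

text \<open>Each condition on \<open>kappa\<close> removes one degeneracy: \<open>kappa = 0\<close>
  means an empty defining set, \<open>kappa = 1\<close> a zero weight at some nonzero
  \<open>y\<close>, and \<open>kappa = r + 1\<close>, the number of all lines, would leave no
  \<open>y\<close> with \<open>delta y = 0\<close>.\<close>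

lemma weights_zero:
  fixes C :: "'p word set"
  assumes ds: "distinct ds" "set ds = D 0" and C: "C = code e ds"
    and kappa: "0 < kappa" "kappa \<noteq> 1" "kappa < real r + 1"
  defines "W \<equiv> (real CARD('p) - 1) * real r / real CARD('p)"
  shows "code_dim C = e"
    and "real (length ds) = kappa * (real r - 1)"
    and "W * kappa \<noteq> W * (kappa - 1)"
    and "real ` nonzero_weights C = {W * kappa, W * (kappa - 1)}"
    and "real (weight_count C (W * kappa)) = (real r)\<^sup>2 - 1 - kappa * (real r - 1)"
    and "real (weight_count C (W * (kappa - 1))) = kappa * (real r - 1)"
proof -
  have W: "W > 0"
    using p_gt_1 r_gt_1 by (simp add: W_def)
  have wt: "real (wt 0 y) = W * (kappa - of_bool (T (w / y) = \<alpha>))" if "y \<noteq> 0" for y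
    using wt_zero[OF that] by (simp only: W_def delta_def)
  have pos: "\<forall>y. y \<noteq> 0 \<longrightarrow> wt 0 y \<noteq> 0"
  proof (intro allI impI)
    fix y :: 'q assume "y \<noteq> 0"
    have "W * (kappa - of_bool (T (w / y) = \<alpha>)) \<noteq> 0"
      using W kappa by (simp add: of_bool_def)
    with wt[OF \<open>y \<noteq> 0\<close>] show "wt 0 y \<noteq> 0"
      by (metis of_nat_0)
  qed
  note code = ds C pos
  show "code_dim C = e"
    using code_dim_eq[OF code] .
  show "real (length ds) = kappa * (real r - 1)"
    using length_ds[OF ds] card_D_0 by simp
  show "W * kappa \<noteq> W * (kappa - 1)"
    using W by simp
  let ?A = "{y. y \<noteq> 0 \<and> T (w / y) = \<alpha>}" and ?B = "{y. y \<noteq> 0 \<and> T (w / y) \<noteq> \<alpha>}"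
  have cA: "real (card ?A) = kappa * (real r - 1)"
    by (simp add: card_delta card_D_0)
  have "card ?A + card ?B = card (?A \<union> ?B)"
    by (rule card_Un_disjoint[symmetric]) auto
  also have "?A \<union> ?B = UNIV - {0}"
    by auto
  finally have "card ?A + card ?B + 1 = r\<^sup>2"
    using r_gt_1 by (simp add: card_Diff_singleton card_q_eq)
  then have "real (card ?A) + real (card ?B) + 1 = (real r)\<^sup>2"
    by (simp only: of_nat_add of_nat_1 of_nat_power flip: of_nat_eq_iff[where ?'a = real])
  then have cB: "real (card ?B) = (real r)\<^sup>2 - 1 - kappa * (real r - 1)"
    using cA by linarith
  have "real (card ?A) > 0"
    using kappa r_gt_1 by (simp only: cA) simp
  then have neA: "?A \<noteq> {}"
    by (metis card.empty less_irrefl of_nat_0)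
  have "(real r - 1) * (real r + 1 - kappa) > 0"
    using kappa r_gt_1 by simp
  then have "real (card ?B) > 0"
    by (simp only: cB) (simp add: algebra_simps power2_eq_square)
  then have neB: "?B \<noteq> {}"
    by (metis card.empty less_irrefl of_nat_0)
  have "real ` nonzero_weights C = (\<lambda>y. real (wt 0 y)) ` (UNIV - {0})"
    by (simp add: nonzero_weights_eq[OF code] image_image)
  also have "UNIV - {0} = ?A \<union> ?B"
    by auto
  also have "(\<lambda>y. real (wt 0 y)) ` (?A \<union> ?B) = {W * kappa, W * (kappa - 1)}"
    using neA neB by (auto simp: image_Un wt)
  finally show "real ` nonzero_weights C = {W * kappa, W * (kappa - 1)}" .
  have all: "y = 0 \<or> y \<in> ?A \<or> y \<in> ?B" for y
    by blast
  have all': "y = 0 \<or> y \<in> ?B \<or> y \<in> ?A" for y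
    by blast
  have wtA: "real (wt 0 y) = W * (kappa - 1)" if "y \<in> ?A" for y
    using that wt[of y] by simp
  have wtB: "real (wt 0 y) = W * kappa" if "y \<in> ?B" for y
    using that wt[of y] by simp
  have "{y. real (wt 0 y) = W * kappa} = ?B"
    by (rule level_set_eq[where z = 0, OF all' wtB wtA]) (use W kappa in auto)
  then show "real (weight_count C (W * kappa)) = (real r)\<^sup>2 - 1 - kappa * (real r - 1)"
    by (simp add: weight_count_eq[OF code] cB)
  have "{y. real (wt 0 y) = W * (kappa - 1)} = ?A"
    by (rule level_set_eq[where z = 0, OF all wtA wtB]) (use W kappa in auto)
  then show "real (weight_count C (W * (kappa - 1))) = kappa * (real r - 1)"
    by (simp add: weight_count_eq[OF code] cA)
qed

section \<open>Nonvanishing of the weights for nonzero \<open>\<beta>\<close>\<close>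

lemma tr_eq_0_iff:
  assumes "r = CARD('p)"
  shows "tr x = 0 \<longleftrightarrow> (\<exists>c. x = emb c * w)"
proof -
  \<comment> \<open>With \<open>h = 1\<close> the subfield \<open>R\<close> is the prime field and
    the absolute trace is the relative one, whose kernel is the line through
    \<open>w\<close>.\<close>
  have "CARD('p) ^ h = CARD('p) ^ 1"
    using assms by (simp add: r_eq)
  then have "h = 1"
    using p_gt_1 power_inject_exp by blast
  moreover have one: "1 \<in> R"
    by (simp add: R_def)
  ultimately have "emb (tr x) = x + x ^ r"
    using emb_tr_R[OF one, of x] by simp
  then have "tr x = 0 \<longleftrightarrow> x / w \<in> R"
    by (metis emb_eq_0 rel_trace_eq_0_iff)
  also have "\<dots> \<longleftrightarrow> x / w \<in> range emb"
    unfolding R_def range_emb by (simp add: assms)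
  also have "\<dots> \<longleftrightarrow> (\<exists>c. x = emb c * w)"
    using w by (auto simp: image_iff field_simps)
  finally show ?thesis .
qed

lemma T_emb:
  assumes "c \<noteq> 0"
  shows "T (emb c * z) = T z"
  using T_mult[of "emb c" z] emb_in_R[of c] assms by (simp add: R_def mult.commute)

text \<open>The shift 0 gives \<open>\<beta>\<close> itself, so \<open>delta \<beta>\<close> decides
  whether it is counted.\<close>

lemma card_exceptional_shifts_le:
  shows "delta \<beta> = 1 \<Longrightarrow> 1 \<le> card (exceptional_shifts \<beta> y) \<and> card (exceptional_shifts \<beta> y) \<le> CARD('p)"
    and "delta \<beta> = 0 \<Longrightarrow> card (exceptional_shifts \<beta> y) \<le> CARD('p) - 1"
proof -
  have le: "card (exceptional_shifts \<beta> y) \<le> CARD('p mod_ring)"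
    by (rule card_mono) auto
  show "1 \<le> card (exceptional_shifts \<beta> y) \<and> card (exceptional_shifts \<beta> y) \<le> CARD('p)" if "delta \<beta> = 1"
  proof -
    have "0 \<in> exceptional_shifts \<beta> y"
      using that by (simp add: exceptional_shifts_def delta_def)
    then have "card (exceptional_shifts \<beta> y) > 0"
      by (auto simp: card_gt_0_iff)
    with le show ?thesis
      by simp
  qed
  show "card (exceptional_shifts \<beta> y) \<le> CARD('p) - 1" if "delta \<beta> = 0"
  proof -
    have "exceptional_shifts \<beta> y \<subseteq> UNIV - {0}"
      using that by (auto simp: exceptional_shifts_def delta_def)
    then have "card (exceptional_shifts \<beta> y) \<le> card (UNIV - {0 :: 'p mod_ring})"
      by (intro card_mono) auto
    then show ?thesis
      by (simp add: card_Diff_singleton)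
  qed
qed

lemma delta_cases: "delta \<beta> = 0 \<or> delta \<beta> = 1"
  by (simp add: delta_def)

text \<open>For \<open>r = p\<close> the hyperplane orthogonal to \<open>y\<close> is a single line over the prime field, which
  meets \<open>D \<beta>\<close> in at most one point unless \<open>y\<close> is a multiple of \<open>\<beta>\<close>.\<close>
lemma wt_nonzero_r_eq_p:
  assumes "r = CARD('p)" "\<beta> \<noteq> 0" "y \<noteq> 0" "\<And>c. y \<noteq> emb c * \<beta>" "card (D \<beta>) > 1"
  shows "wt \<beta> y \<noteq> 0"
proof
  assume "wt \<beta> y = 0"
  then have orth: "tr (y * x) = 0" if "x \<in> D \<beta>" for x
    using that by (auto simp: wt_def)
  define z where "z = w / y"
  have line: "\<exists>c. c \<noteq> 0 \<and> x = emb c * z" if x: "x \<in> D \<beta>" for x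
  proof -
    obtain c where "y * x = emb c * w"
      using orth[OF x] tr_eq_0_iff[OF assms(1)] by blast
    then have "x = emb c * z"
      using assms(3) by (simp add: z_def field_simps)
    moreover from this have "c \<noteq> 0"
      using x by (auto simp: D_def)
    ultimately show ?thesis
      by blast
  qed
  obtain x1 x2 where x: "x1 \<in> D \<beta>" "x2 \<in> D \<beta>" "x1 \<noteq> x2"
    using assms(5) by (metis card_le_Suc0_iff_eq finite leD One_nat_def)
  obtain a b where a: "a \<noteq> 0" "x1 = emb a * z" and b: "b \<noteq> 0" "x2 = emb b * z"
    using line x by meson
  have tr_mult: "tr (\<beta> * (emb c * z)) = c * tr (\<beta> * z)" for c
    using tr_scale[of c "\<beta> * z"] by (simp add: mult.left_commute)
  \<comment> \<open>Both points are nonzero prime-field multiples of \<open>z\<close> and share the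
    value \<open>T z\<close>; two different solutions \<open>a\<close>, \<open>b\<close> of one
    linear equation force its coefficient to vanish.\<close>
  have "a * tr (\<beta> * z) = \<alpha> - T z" "b * tr (\<beta> * z) = \<alpha> - T z"
    using x a b by (auto simp: D_def T_emb tr_mult eq_diff_eq add.commute)
  moreover have "a \<noteq> b"
    using x a b by auto
  ultimately have "tr (\<beta> * z) = 0"
    by (metis mult_right_cancel)
  then obtain c where "\<beta> * z = emb c * w"
    using tr_eq_0_iff[OF assms(1)] by blast
  then have \<beta>: "\<beta> = emb c * y"
    using assms(3) w by (simp add: z_def field_simps)
  with assms(2) have "c \<noteq> 0"
    by auto
  then have "y = emb (inverse c) * \<beta>"
    unfolding \<beta> by (simp add: mult.assoc[symmetric] flip: emb_mult)
  with assms(4) show False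
    by blast
qed

text \<open>On multiples of \<open>\<beta>\<close> the weight is positive since
  \<open>kappa < r\<close>. Elsewhere \<open>delta \<beta> = 1\<close> leaves a nonnegative
  correction, while for \<open>delta \<beta> = 0\<close> the loss is at most
  \<open>r * (p - 1) / p\<close>, which the main term exceeds if \<open>r > p\<close>. For
  \<open>r = p\<close> the two may balance; there \<open>card (D \<beta>) = r - kappa > 1\<close>
  allows the argument with two points on one line.\<close>

lemma wt_nonzero:
  assumes "\<beta> \<noteq> 0" "kappa < real r - 1" "y \<noteq> 0"
  shows "wt \<beta> y \<noteq> 0"
proof (cases "\<exists>c. y = emb c * \<beta>")
  case True
  then obtain c where c: "y = emb c * \<beta>" ..
  with assms(3) have "c \<noteq> 0"
    by auto
  then have "real (wt \<beta> y) = real r / real CARD('p) * (real r - kappa + delta \<beta>)"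
    unfolding c using assms(1) by (intro wt_multiple)
  moreover have "real r / real CARD('p) * (real r - kappa + delta \<beta>) > 0"
    using r_gt_1 p_gt_1 assms(2) by (auto simp: delta_def)
  ultimately show ?thesis
    by auto
next
  case False
  then have not: "y \<noteq> emb c * \<beta>" for c
    by blast
  define P where "P = real CARD('p)"
  define t where "t = real (card (exceptional_shifts \<beta> y))"
  have P: "P > 1"
    using p_gt_1 by (simp add: P_def)
  have wt: "real (wt \<beta> y) = (P - 1) / P\<^sup>2 * (real r)\<^sup>2 + real r * (delta \<beta> - t / P)"
    unfolding P_def t_def by (rule wt_other[OF assms(1,3) not])
  show ?thesis
  proof (cases "delta \<beta> = 1")
    case True
    then have "t \<le> P"
      using card_exceptional_shifts_le(1)[of \<beta> y] by (simp add: t_def P_def)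
    then have "t / P \<le> 1"
      using P by simp
    then have "real r * (delta \<beta> - t / P) \<ge> 0"
      using True by simp
    moreover have "(P - 1) / P\<^sup>2 * (real r)\<^sup>2 > 0"
      using P r_gt_1 by simp
    ultimately show ?thesis
      using wt by linarith
  next
    case False
    then have d: "delta \<beta> = 0"
      using delta_cases by blast
    show ?thesis
    proof (cases "r = CARD('p)")
      case True
      have "real (card (D \<beta>)) = real r - kappa"
        using card_D[OF assms(1)] d r_gt_1 by (simp add: power2_eq_square flip: True)
      then have "card (D \<beta>) > 1"
        using assms(2) by linarith
      then show ?thesis
        using wt_nonzero_r_eq_p[OF True assms(1,3) not] by blast
    next
      case False
      then have r: "real r > P"
        using p_le_r by (simp add: P_def)
      have "t \<le> P - 1"
        using card_exceptional_shifts_le(2)[OF d, of y] p_gt_1 by (simp add: t_def P_def)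
      then have "t * P \<le> (P - 1) * P"
        using P by simp
      also have "\<dots> < (P - 1) * real r"
        using r P by simp
      finally have "t * P < (P - 1) * real r" .
      then have "0 < real r / P\<^sup>2 * ((P - 1) * real r - t * P)"
        using r P by simp
      also have "\<dots> = real (wt \<beta> y)"
        using P by (simp add: wt d field_simps power2_eq_square)
      finally show ?thesis
        by simp
    qed
  qed
qed

lemma weights_nonzero:
  fixes C :: "'p word set"
  assumes ds: "distinct ds" "set ds = D \<beta>" and C: "C = code e ds"
    and "\<beta> \<noteq> 0" "kappa < real r - 1"
  defines "P \<equiv> real CARD('p)" and "s \<equiv> real r"
  shows "code_dim C = e"
    and "real (length ds) = s\<^sup>2 / P - kappa + s * delta \<beta>"
    and "card (nonzero_weights C) \<le> CARD('p) + 1"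
    and "delta \<beta> = 0 \<Longrightarrow> real ` nonzero_weights C \<subseteq>
      insert (s / P * (s - kappa)) {(P - 1) / P\<^sup>2 * s\<^sup>2 - (P - 1 - real k) / P * s |k. k \<le> CARD('p) - 1}"
    and "delta \<beta> = 1 \<Longrightarrow> real ` nonzero_weights C \<subseteq>
      insert (s / P * (s - kappa + 1)) {(P - 1) / P\<^sup>2 * s\<^sup>2 + (P - 1 - real k) / P * s |k. k \<le> CARD('p) - 1}"
proof -
  have pos: "\<forall>y. y \<noteq> 0 \<longrightarrow> wt \<beta> y \<noteq> 0"
    using wt_nonzero[OF assms(4,5)] by blast
  note code = ds C pos
  have P: "P > 1"
    using p_gt_1 by (simp add: P_def)
  show "code_dim C = e"
    using code_dim_eq[OF code] .
  show "real (length ds) = s\<^sup>2 / P - kappa + s * delta \<beta>"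
    using length_ds[OF ds] card_D[OF assms(4)] by (simp add: s_def P_def)
  have weights: "real ` nonzero_weights C = (\<lambda>y. real (wt \<beta> y)) ` (UNIV - {0})"
    by (simp add: nonzero_weights_eq[OF code] image_image)
  have wt: "real (wt \<beta> y) = s / P * (s - kappa + delta \<beta>) \<or>
      real (wt \<beta> y) = (P - 1) / P\<^sup>2 * s\<^sup>2 + s * (delta \<beta> - real (card (exceptional_shifts \<beta> y)) / P)" if "y \<noteq> 0" for y
  proof (cases "\<exists>c. y = emb c * \<beta>")
    case True
    then obtain c where c: "y = emb c * \<beta>" ..
    with that have "c \<noteq> 0"
      by auto
    with c show ?thesis
      using wt_multiple[OF assms(4)] by (simp add: s_def P_def)
  next
    case False
    then show ?thesis
      using wt_other[OF assms(4) that] by (simp add: s_def P_def)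
  qed
  let ?S = "\<lambda>f. {f k |k. k \<le> CARD('p) - 1} :: real set"
  have card_le: "card (nonzero_weights C) \<le> CARD('p) + 1" if "real ` nonzero_weights C \<subseteq> insert a (?S f)" for a f
  proof -
    have S: "?S f = f ` {..CARD('p) - 1}"
      by auto
    have "card (nonzero_weights C) = card (real ` nonzero_weights C)"
      by (simp add: card_image inj_on_def)
    also have "\<dots> \<le> card (insert a (?S f))"
      using that by (rule card_mono[rotated]) (simp add: S)
    also have "\<dots> \<le> Suc (card (?S f))"
      by (rule card_insert_le_m1) (auto simp: S)
    also have "card (?S f) \<le> card {..CARD('p) - 1}"
      unfolding S by (rule card_image_le) simp
    finally show ?thesis
      using p_gt_1 by simp
  qed
  show minus: "real ` nonzero_weights C \<subseteq>
      insert (s / P * (s - kappa)) {(P - 1) / P\<^sup>2 * s\<^sup>2 - (P - 1 - real k) / P * s |k. k \<le> CARD('p) - 1}"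
    if d: "delta \<beta> = 0"
  proof -
    have "\<exists>k \<le> CARD('p) - 1. (P - 1) / P\<^sup>2 * s\<^sup>2 + s * (delta \<beta> - real (card (exceptional_shifts \<beta> y)) / P) =
        (P - 1) / P\<^sup>2 * s\<^sup>2 - (P - 1 - real k) / P * s" for y
    proof (intro exI conjI)
      \<comment> \<open>At most \<open>p - 1\<close> shifts are exceptional here, so the subtraction
        is exact.\<close>
      let ?k = "CARD('p) - 1 - card (exceptional_shifts \<beta> y)"
      show "?k \<le> CARD('p) - 1"
        by simp
      have "real ?k = P - 1 - real (card (exceptional_shifts \<beta> y))"
        using card_exceptional_shifts_le(2)[OF d, of y] p_gt_1 by (simp add: P_def of_nat_diff)
      then show "(P - 1) / P\<^sup>2 * s\<^sup>2 + s * (delta \<beta> - real (card (exceptional_shifts \<beta> y)) / P) =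
          (P - 1) / P\<^sup>2 * s\<^sup>2 - (P - 1 - real ?k) / P * s"
        by (simp only: d) simp
    qed
    with wt d show ?thesis
      unfolding weights by fastforce
  qed
  show plus: "real ` nonzero_weights C \<subseteq>
      insert (s / P * (s - kappa + 1)) {(P - 1) / P\<^sup>2 * s\<^sup>2 + (P - 1 - real k) / P * s |k. k \<le> CARD('p) - 1}"
    if d: "delta \<beta> = 1"
  proof -
    have "\<exists>k \<le> CARD('p) - 1. (P - 1) / P\<^sup>2 * s\<^sup>2 + s * (delta \<beta> - real (card (exceptional_shifts \<beta> y)) / P) =
        (P - 1) / P\<^sup>2 * s\<^sup>2 + (P - 1 - real k) / P * s" for y
    proof (intro exI conjI)
      \<comment> \<open>The shift 0 is exceptional here; leaving it out brings the count into the
        range from 0 to \<open>p - 1\<close>.\<close>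
      let ?k = "card (exceptional_shifts \<beta> y) - 1"
      show "?k \<le> CARD('p) - 1"
        using card_exceptional_shifts_le(1)[OF d, of y] by (intro diff_le_mono) simp
      have "real ?k = real (card (exceptional_shifts \<beta> y)) - 1"
        using card_exceptional_shifts_le(1)[OF d, of y] by (simp add: of_nat_diff)
      then show "(P - 1) / P\<^sup>2 * s\<^sup>2 + s * (delta \<beta> - real (card (exceptional_shifts \<beta> y)) / P) =
          (P - 1) / P\<^sup>2 * s\<^sup>2 + (P - 1 - real ?k) / P * s"
        using P by (simp only: d) (simp add: field_simps)
    qed
    with wt d show ?thesis
      unfolding weights by fastforce
  qed
  show "card (nonzero_weights C) \<le> CARD('p) + 1"
    using delta_cases[of \<beta>] card_le[OF minus] card_le[OF plus] by blast
qed

section \<open>The case where \<open>D 0\<close> is empty\<close>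

lemma D_0_empty:
  assumes "kappa = 0"
  shows "D 0 = {}"
  using assms card_D_0 by simp

text \<open>\<open>T\<close> never takes the value \<open>\<alpha>\<close> at a nonzero element, so
  \<open>delta \<beta>\<close> is zero and no shift is exceptional for \<open>y\<close> off the
  line: the weight records only whether a nonzero \<open>y\<close> is a multiple of
  \<open>\<beta>\<close>. The counts are the sizes of the punctured prime-field line through
  \<open>\<beta>\<close> and of the complement of that line.\<close>

lemma weights_kappa_0:
  fixes C :: "'p word set"
  assumes ds: "distinct ds" "set ds = D \<beta>" and C: "C = code e ds"
    and "\<beta> \<noteq> 0" "kappa = 0"
  defines "P \<equiv> real CARD('p)" and "Q \<equiv> (real r)\<^sup>2"
  shows "code_dim C = e"
    and "real (length ds) = Q / P"
    and "Q / P \<noteq> (P - 1) * Q / P\<^sup>2"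
    and "real ` nonzero_weights C = {Q / P, (P - 1) * Q / P\<^sup>2}"
    and "real (weight_count C (Q / P)) = P - 1"
    and "real (weight_count C ((P - 1) * Q / P\<^sup>2)) = Q - P"
proof -
  have P: "P > 1" and r: "real r > 1"
    using p_gt_1 r_gt_1 by (simp_all add: P_def)
  then have Q: "Q > 0"
    by (simp add: Q_def)
  have T: "T (w / y) \<noteq> \<alpha>" if "y \<noteq> 0" for y
  proof -
    have "w / y \<notin> D 0"
      using D_0_empty[OF assms(5)] by simp
    then show ?thesis
      using that w by (simp add: D_def)
  qed
  have d: "delta \<beta> = 0"
    using T[OF assms(4)] by (simp add: delta_def)
  let ?L = "(\<lambda>c. emb c * \<beta>) ` (UNIV - {0})" and ?M = "UNIV - (\<lambda>c. emb c * \<beta>) ` UNIV"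
  have wtL: "real (wt \<beta> y) = Q / P" if "y \<in> ?L" for y
    using that wt_multiple[OF assms(4)] by (auto simp: d assms(5) P_def Q_def power2_eq_square)
  have wtM: "real (wt \<beta> y) = (P - 1) * Q / P\<^sup>2" if "y \<in> ?M" for y
  proof -
    have y: "y \<noteq> emb c * \<beta>" for c
      using that by blast
    with y[of 0] have "y \<noteq> 0"
      by simp
    have "exceptional_shifts \<beta> y = {}"
    proof -
      have "\<beta> + emb c * y \<noteq> 0" for c
        by (rule add_multiple_nonzero[OF assms(4) y])
      with T show ?thesis
        by (simp add: exceptional_shifts_def)
    qed
    then show ?thesis
      using wt_other[OF assms(4) \<open>y \<noteq> 0\<close> y] by (simp add: d P_def Q_def)
  qed
  have inj: "inj (\<lambda>c. emb c * \<beta>)"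
    using assms(4) by (auto simp: inj_on_def emb_inj)
  have cL: "real (card ?L) = P - 1"
    using p_gt_1 by (subst card_image[OF inj_on_subset[OF inj]])
      (auto simp: card_Diff_singleton P_def of_nat_diff)
  have cL': "card (range (\<lambda>c. emb c * \<beta>)) = CARD('p)"
    using card_image[OF inj] by simp
  have "r * 1 < r * r"
    using r_gt_1 by simp
  then have "CARD('p) < r * r"
    using p_le_r by linarith
  then have PQ: "P < Q"
    by (simp add: P_def Q_def power2_eq_square flip: of_nat_mult)
  have cM: "real (card ?M) = Q - P"
    using PQ by (simp add: card_Diff_subset cL' card_q_eq P_def Q_def of_nat_diff)
  have neL: "?L \<noteq> {}"
    using P cL by (metis card.empty less_irrefl of_nat_0 diff_gt_0_iff_gt)
  have neM: "?M \<noteq> {}"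
    using PQ cM by (metis card.empty less_irrefl of_nat_0 diff_gt_0_iff_gt)
  have UN: "UNIV - {0} = ?L \<union> ?M"
    using assms(4) by (auto simp: image_iff)
  have pos: "\<forall>y. y \<noteq> 0 \<longrightarrow> wt \<beta> y \<noteq> 0"
  proof (intro allI impI)
    fix y :: 'q assume "y \<noteq> 0"
    with UN have "y \<in> ?L \<or> y \<in> ?M"
      by blast
    with wtL wtM have "real (wt \<beta> y) = Q / P \<or> real (wt \<beta> y) = (P - 1) * Q / P\<^sup>2"
      by blast
    moreover have "Q / P \<noteq> 0" "(P - 1) * Q / P\<^sup>2 \<noteq> 0"
      using P Q by simp_all
    ultimately show "wt \<beta> y \<noteq> 0"
      by (metis of_nat_0)
  qed
  note code = ds C pos
  show "code_dim C = e"
    using code_dim_eq[OF code] .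
  show "real (length ds) = Q / P"
    using length_ds[OF ds] card_D[OF assms(4)] d assms(5) by (simp add: P_def Q_def)
  show ne: "Q / P \<noteq> (P - 1) * Q / P\<^sup>2"
    using P Q by (simp add: field_simps power2_eq_square)
  have "real ` nonzero_weights C = (\<lambda>y. real (wt \<beta> y)) ` (UNIV - {0})"
    by (simp add: nonzero_weights_eq[OF code] image_image)
  also have "\<dots> = (\<lambda>y. real (wt \<beta> y)) ` ?L \<union> (\<lambda>y. real (wt \<beta> y)) ` ?M"
    unfolding UN by (rule image_Un)
  also have "(\<lambda>y. real (wt \<beta> y)) ` ?L = (\<lambda>y. Q / P) ` ?L"
    by (rule image_cong[OF refl wtL])
  also have "\<dots> = {Q / P}"
    using neL by (simp only: image_constant_conv if_False)
  also have "(\<lambda>y. real (wt \<beta> y)) ` ?M = (\<lambda>y. (P - 1) * Q / P\<^sup>2) ` ?M"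
    by (rule image_cong[OF refl wtM])
  also have "\<dots> = {(P - 1) * Q / P\<^sup>2}"
    using neM by (simp only: image_constant_conv if_False)
  finally show "real ` nonzero_weights C = {Q / P, (P - 1) * Q / P\<^sup>2}"
    by (simp add: insert_commute)
  have all: "y = 0 \<or> y \<in> ?L \<or> y \<in> ?M" for y
    using UN by blast
  have "{y. real (wt \<beta> y) = Q / P} = ?L"
    by (rule level_set_eq[where z = 0, OF all wtL wtM]) (use ne P Q in auto)
  then show "real (weight_count C (Q / P)) = P - 1"
    by (simp only: weight_count_eq[OF code] cL)
  have all': "y = 0 \<or> y \<in> ?M \<or> y \<in> ?L" for y
    using all[of y] by blast
  have "{y. real (wt \<beta> y) = (P - 1) * Q / P\<^sup>2} = ?M"
    by (rule level_set_eq[where z = 0, OF all' wtM wtL]) (use ne P Q in auto)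
  then show "real (weight_count C ((P - 1) * Q / P\<^sup>2)) = Q - P"
    by (simp only: weight_count_eq[OF code] cM)
qed

end

section \<open>Traces of roots of unity\<close>

lemma totient_double_odd_prime_power:
  assumes "prime l" "odd l" "m \<ge> 1"
  shows "totient (2 * l ^ m) = (l - 1) * l ^ (m - 1)"
  using assms by (simp add: totient_mult_coprime totient_prime_power mult.commute)

text \<open>\<open>p ^ h\<close> is a square root of 1 modulo \<open>2 * l ^ m\<close>. The odd
  prime \<open>l\<close> cannot divide both \<open>p ^ h - 1\<close> and \<open>p ^ h + 1\<close>,
  so all of \<open>l ^ m\<close> goes into one of them; the first is excluded because the order
  \<open>e\<close> of \<open>p\<close> exceeds \<open>h\<close>.\<close>

lemma primroot_half_power:
  fixes l m p e :: nat
  assumes l: "prime l" "odd l" and m: "m \<ge> 1"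
    and pr: "residue_primroot (2 * l ^ m) p" and e: "e = totient (2 * l ^ m)"
  obtains h where "e = 2 * h" "2 * l ^ m dvd p ^ h + 1"
proof -
  let ?N = "2 * l ^ m"
  define h where "h = e div 2"
  have l3: "l \<ge> 3"
    using l prime_ge_2_nat[of l] by (cases "l = 2") auto
  have "even e"
    using assms totient_double_odd_prime_power[OF l m] by simp
  then have eh: "e = 2 * h"
    by (simp add: h_def)
  have "e > 0"
    using l3 totient_double_odd_prime_power[OF l m] by (simp add: e)
  with eh have h: "0 < h" "h < e"
    by auto
  have cop: "coprime ?N p" and ord: "ord ?N p = e"
    using pr e by (auto simp: residue_primroot_def)
  have "odd p"
    using cop by (metis coprime_common_divisor dvd_triv_left odd_one)
  then have p1: "p ^ h \<ge> 1"
    by (simp add: odd_pos Suc_le_eq)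
  have "[p ^ e = 1] (mod ?N)"
    using ord ord_divides[of p e ?N] by simp
  then have "?N dvd p ^ e - 1"
    using p1 eh by (metis cong_altdef_nat cong_sym le_less_linear less_one nat_power_eq_Suc_0_iff one_le_power
        odd_pos \<open>odd p\<close> Suc_leI One_nat_def)
  also have "p ^ e - 1 = (p ^ h - 1) * (p ^ h + 1)"
    using p1 by (simp add: eh power_mult mult.commute power_even_eq power2_eq_square algebra_simps)
  \<comment> \<open>Both factors are even, so the 2 carries no information here; it is dropped and
    restored by coprimality with \<open>l ^ m\<close>.\<close>
  finally have dvd: "l ^ m dvd (p ^ h - 1) * (p ^ h + 1)"
    by (rule dvd_mult_right)
  have "l ^ m dvd p ^ h - 1 \<or> l ^ m dvd p ^ h + 1"
  proof (cases "l dvd p ^ h - 1")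
    case True
    have "\<not> l dvd p ^ h + 1"
    proof
      assume "l dvd p ^ h + 1"
      with True have "l dvd (p ^ h + 1) - (p ^ h - 1)"
        by (rule dvd_diff_nat[rotated])
      with p1 have "l dvd 2"
        by simp
      with l3 show False
        by (auto dest: dvd_imp_le)
    qed
    with l have "coprime (l ^ m) (p ^ h + 1)"
      by (simp add: prime_imp_coprime)
    with dvd show ?thesis
      using coprime_dvd_mult_left_iff by blast
  next
    case False
    with l have "coprime (l ^ m) (p ^ h - 1)"
      by (simp add: prime_imp_coprime)
    with dvd show ?thesis
      using coprime_dvd_mult_right_iff by blast
  qed
  moreover have "\<not> l ^ m dvd p ^ h - 1"
  proof
    assume "l ^ m dvd p ^ h - 1"
    moreover have "2 dvd p ^ h - 1"
      using \<open>odd p\<close> by simp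
    moreover have "coprime 2 (l ^ m)"
      using l by simp
    ultimately have "?N dvd p ^ h - 1"
      by (simp add: divides_mult)
    then have "[p ^ h = 1] (mod ?N)"
      using p1 by (simp add: cong_altdef_nat)
    then have "ord ?N p dvd h"
      by (simp only: ord_divides)
    with ord h show False
      by (auto dest: dvd_imp_le)
  qed
  ultimately have "l ^ m dvd p ^ h + 1"
    by blast
  moreover have "2 dvd p ^ h + 1"
    using \<open>odd p\<close> by simp
  moreover have "coprime 2 (l ^ m)"
    using l by simp
  ultimately have "?N dvd p ^ h + 1"
    by (simp add: divides_mult)
  with eh show ?thesis
    using that by blast
qed

lemma sum_powers_root_of_unity:
  fixes x :: "'a::field"
  assumes "x ^ n = 1"
  shows "(\<Sum>b<n. x ^ b) = (if x = 1 then of_nat n else 0)"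
  using assms by (simp add: geometric_sum)

text \<open>The totatives are the odd residues without the odd multiples of \<open>l\<close>.
  Written as progressions of step 2 and \<open>2 * l\<close>, they turn a sum of powers of a root of
  unity into two geometric sums.\<close>

lemma sum_totatives_double_odd_prime_power:
  fixes f :: "nat \<Rightarrow> 'a::ab_group_add"
  assumes l: "prime l" "odd l" and m: "m \<ge> 1"
  shows "(\<Sum>a\<in>totatives (2 * l ^ m). f a) =
    (\<Sum>b<l ^ m. f (2 * b + 1)) - (\<Sum>b<l ^ (m - 1). f (l * (2 * b + 1)))"
proof -
  let ?O = "(\<lambda>b. 2 * b + 1) ` {..<l ^ m}" and ?M = "(\<lambda>b. l * (2 * b + 1)) ` {..<l ^ (m - 1)}"
  have lm: "l ^ m = l * l ^ (m - 1)"
    using m by (metis power_eq_if not_one_le_zero)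
  have l0: "l > 0"
    using l(1) by (rule prime_gt_0_nat)
  have O: "?O = {a. a < 2 * l ^ m \<and> odd a}"
    by (auto elim!: oddE)
  have M: "?M = {a \<in> ?O. l dvd a}"
  proof (intro Set.set_eqI iffI)
    fix a assume "a \<in> ?M"
    then obtain b where b: "b < l ^ (m - 1)" "a = l * (2 * b + 1)"
      by blast
    then have "2 * b + 1 < 2 * l ^ (m - 1)"
      by simp
    then have "a < 2 * l ^ m"
      using b l0 unfolding lm by (metis mult.left_commute mult_less_cancel1)
    then show "a \<in> {a \<in> ?O. l dvd a}"
      unfolding O using b l by simp
  next
    fix a assume "a \<in> {a \<in> ?O. l dvd a}"
    then have *: "l dvd a" "a < 2 * l ^ m" "odd a"
      unfolding O by auto
    from *(1) obtain c where a: "a = l * c" ..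
    with *(3) have "odd c"
      by simp
    then obtain b where b: "c = 2 * b + 1" ..
    have "l * c < l * (2 * l ^ (m - 1))"
      using a *(2) unfolding lm by (simp add: mult.left_commute)
    then have "c < 2 * l ^ (m - 1)"
      by (simp only: mult_less_cancel1)
    then have "b < l ^ (m - 1)"
      using b by simp
    with a b show "a \<in> ?M"
      by blast
  qed
  have tot: "totatives (2 * l ^ m) = ?O - ?M"
  proof -
    have "a \<in> totatives (2 * l ^ m) \<longleftrightarrow> a < 2 * l ^ m \<and> odd a \<and> \<not> l dvd a" for a
    proof -
      have "coprime a l \<longleftrightarrow> \<not> l dvd a"
        using l(1) by (metis coprime_absorb_left coprime_commute not_prime_unit prime_imp_coprime)
      have "coprime a (2 * l ^ m) \<longleftrightarrow> odd a \<and> \<not> l dvd a"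
        using \<open>coprime a l \<longleftrightarrow> \<not> l dvd a\<close> m by simp
      moreover have "a \<noteq> 2 * l ^ m" if "odd a"
        using that by auto
      moreover have "0 < a" if "odd a"
        using that by (rule odd_pos)
      ultimately show ?thesis
        unfolding totatives_def by auto
    qed
    then show ?thesis
      unfolding M O by blast
  qed
  have "(\<Sum>a\<in>totatives (2 * l ^ m). f a) = sum f ?O - sum f ?M"
    unfolding tot by (rule sum_diff) (use M in auto)
  also have "sum f ?O = (\<Sum>b<l ^ m. f (2 * b + 1))"
    by (subst sum.reindex) (auto simp: inj_on_def)
  also have "sum f ?M = (\<Sum>b<l ^ (m - 1). f (l * (2 * b + 1)))"
    using l0 by (subst sum.reindex) (auto simp: inj_on_def)
  finally show ?thesis .
qed

text \<open>The factor \<open>(-1) ^ i\<close> is the Ramanujan sum of modulus 2, the rest the one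
  of modulus \<open>l ^ m\<close>. The ring is left open because the value is needed both in the
  prime field and in the large field.\<close>

definition ramanujan_sum :: "nat \<Rightarrow> nat \<Rightarrow> nat \<Rightarrow> 'a::comm_ring_1" where
  "ramanujan_sum l m i = (if l ^ m dvd i then (-1) ^ i * of_nat (l ^ (m - 1) * (l - 1))
    else if l ^ (m - 1) dvd i then - ((-1) ^ i * of_nat (l ^ (m - 1))) else 0)"

lemma (in prime_power_field) emb_ramanujan_sum: "emb (ramanujan_sum l m i) = ramanujan_sum l m i"
  by (simp add: ramanujan_sum_def emb_mult emb_minus emb_power emb_of_nat)

lemma (in prime_power_field) tr_root_of_unity:
  fixes \<theta> :: 'q
  assumes l: "prime l" "odd l" and m: "m \<ge> 1"
    and pr: "residue_primroot (2 * l ^ m) CARD('p)" and e: "e = totient (2 * l ^ m)"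
    and \<theta>: "\<And>i. \<theta> ^ i = 1 \<longleftrightarrow> 2 * l ^ m dvd i"
  shows "tr (\<theta> ^ i) = ramanujan_sum l m i"
proof -
  let ?N = "2 * l ^ m"
  define \<omega> where "\<omega> = \<theta> ^ i"
  have lm: "l ^ m = l * l ^ (m - 1)"
    using m by (metis power_eq_if not_one_le_zero)
  have l2: "l \<ge> 2"
    using l(1) by (rule prime_ge_2_nat)
  have \<omega>N: "\<omega> ^ ?N = 1"
    by (simp only: \<omega>_def flip: power_mult) (simp add: \<theta>)
  have \<omega>_mod: "\<omega> ^ (k mod ?N) = \<omega> ^ k" for k
  proof -
    have "\<omega> ^ k = \<omega> ^ (?N * (k div ?N) + k mod ?N)"
      by simp
    also have "\<dots> = \<omega> ^ (k mod ?N)"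
      by (simp only: power_add power_mult[of \<omega> ?N "k div ?N"] \<omega>N power_one mult_1)
    finally show ?thesis ..
  qed
  have "?N > 1"
    using l2 by (simp add: Suc_lessI)
  then have bij: "bij_betw (\<lambda>k. CARD('p) ^ k mod ?N) {..<totient ?N} (totatives ?N)"
    using pr by (rule residue_primroot_is_generator)
  have "emb (tr \<omega>) = (\<Sum>k<e. \<omega> ^ (CARD('p) ^ k mod ?N))"
    by (simp only: emb_tr \<omega>_mod)
  also have "\<dots> = (\<Sum>a\<in>totatives ?N. \<omega> ^ a)"
    using sum.reindex_bij_betw[OF bij, of "\<lambda>a. \<omega> ^ a"] by (simp only: e)
  also have "\<dots> = (\<Sum>b<l ^ m. \<omega> ^ (2 * b + 1)) - (\<Sum>b<l ^ (m - 1). \<omega> ^ (l * (2 * b + 1)))"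
    by (rule sum_totatives_double_odd_prime_power[OF l m])
  also have "(\<Sum>b<l ^ m. \<omega> ^ (2 * b + 1)) = \<omega> * (\<Sum>b<l ^ m. (\<omega>\<^sup>2) ^ b)"
    by (simp add: sum_distrib_left power_mult)
  also have "(\<Sum>b<l ^ m. (\<omega>\<^sup>2) ^ b) = (if \<omega>\<^sup>2 = 1 then of_nat (l ^ m) else 0)"
    by (rule sum_powers_root_of_unity) (simp only: \<omega>N flip: power_mult)
  also have "(\<Sum>b<l ^ (m - 1). \<omega> ^ (l * (2 * b + 1))) = \<omega> ^ l * (\<Sum>b<l ^ (m - 1). (\<omega> ^ (2 * l)) ^ b)"
    by (simp add: sum_distrib_left power_add power_mult mult.commute distrib_left mult.left_commute
        flip: power_mult)
  also have "(\<Sum>b<l ^ (m - 1). (\<omega> ^ (2 * l)) ^ b) = (if \<omega> ^ (2 * l) = 1 then of_nat (l ^ (m - 1)) else 0)"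
  proof (rule sum_powers_root_of_unity)
    have "2 * l * l ^ (m - 1) = ?N"
      unfolding lm by simp
    then show "(\<omega> ^ (2 * l)) ^ l ^ (m - 1) = 1"
      by (simp only: \<omega>N flip: power_mult)
  qed
  finally have tr: "emb (tr \<omega>) = \<omega> * (if \<omega>\<^sup>2 = 1 then of_nat (l ^ m) else 0) -
    \<omega> ^ l * (if \<omega> ^ (2 * l) = 1 then of_nat (l ^ (m - 1)) else 0)" .
  have sq: "\<omega>\<^sup>2 = 1 \<longleftrightarrow> l ^ m dvd i"
    by (simp only: \<omega>_def \<theta> mult.commute[of i] flip: power_mult) simp
  have "\<omega> ^ (2 * l) = 1 \<longleftrightarrow> 2 * l * l ^ (m - 1) dvd 2 * l * i"
    by (simp only: \<omega>_def \<theta> mult.commute[of i] lm mult.assoc flip: power_mult)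
  also have "\<dots> \<longleftrightarrow> l ^ (m - 1) dvd i"
    using l2 by simp
  finally have sql: "\<omega> ^ (2 * l) = 1 \<longleftrightarrow> l ^ (m - 1) dvd i" .
  \<comment> \<open>Whenever a geometric sum survives, its prefactor \<open>\<omega>\<close> or
    \<open>\<omega> ^ l\<close> is a power of \<open>\<theta> ^ l ^ m = -1\<close>, and since
    \<open>l\<close> is odd the exponent has the parity of \<open>i\<close>.\<close>
  have "(\<theta> ^ l ^ m)\<^sup>2 = 1" "\<theta> ^ l ^ m \<noteq> 1"
    using l2 by (simp_all only: \<theta> flip: power_mult) (auto dest: dvd_imp_le)
  then have minus: "\<theta> ^ l ^ m = -1"
    by (simp add: power2_eq_1_iff)
  have par: "even (k * u) \<longleftrightarrow> even u" if "odd k" for k u :: nat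
    using that by simp
  have odd_l: "odd (l ^ k)" for k
    using l by simp
  \<comment> \<open>If \<open>l ^ m\<close> divides \<open>i\<close>, both geometric sums survive
    and give \<open>l ^ m - l ^ (m - 1)\<close>; if only \<open>l ^ (m - 1)\<close> does, just the
    subtracted one; otherwise neither.\<close>
  have emb_eq: "emb (tr \<omega>) = ramanujan_sum l m i"
  proof (cases "l ^ m dvd i")
    case True
    then obtain u where u: "i = l ^ m * u" ..
    have "\<omega> = (-1) ^ u"
      by (simp only: \<omega>_def u power_mult minus)
    also have "\<dots> = (-1) ^ i"
      using l by (simp add: u minus_one_power_iff)
    finally have \<omega>: "\<omega> = (-1) ^ i" .
    have \<omega>l: "\<omega> ^ l = (-1) ^ i"
      using l by (simp add: \<omega> minus_one_power_iff)
    have "l ^ (m - 1) dvd i"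
      using True unfolding lm by (rule dvd_mult_right)
    moreover have "of_nat (l ^ m) - of_nat (l ^ (m - 1)) = (of_nat (l ^ (m - 1) * (l - 1)) :: 'q)"
      using l2 by (simp add: lm algebra_simps of_nat_diff)
    ultimately show ?thesis
      using True unfolding tr sq sql \<omega>l by (simp add: \<omega> ramanujan_sum_def flip: right_diff_distrib)
  next
    case False
    show ?thesis
    proof (cases "l ^ (m - 1) dvd i")
      case True
      then obtain u where u: "i = l ^ (m - 1) * u" ..
      have "\<omega> ^ l = \<theta> ^ (l ^ m * u)"
        unfolding \<omega>_def u lm by (simp add: mult_ac flip: power_mult)
      also have "\<dots> = (-1) ^ u"
        by (simp only: power_mult minus)
      also have "\<dots> = (-1) ^ i"
        using l by (simp add: u minus_one_power_iff)
      finally show ?thesis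
        using True False unfolding tr sq sql by (simp add: ramanujan_sum_def)
    next
      case F: False
      then show ?thesis
        using False unfolding tr sq sql by (simp add: ramanujan_sum_def)
    qed
  qed
  then have "emb (tr \<omega>) = emb (ramanujan_sum l m i)"
    by (simp only: emb_ramanujan_sum)
  then show ?thesis
    unfolding emb_inj \<omega>_def .
qed

section \<open>Indices modulo twice a prime power\<close>

lemma card_mod_periodic:
  fixes M c :: nat
  shows "card {k. k < M * c \<and> P (k mod M)} = c * card {i. i < M \<and> P i}"
proof (induction c)
  case (Suc c)
  have "{k. k < M * Suc c \<and> P (k mod M)} =
      {k. k < M * c \<and> P (k mod M)} \<union> (\<lambda>i. M * c + i) ` {i. i < M \<and> P i}"
  proof (intro Set.set_eqI iffI)
    fix k assume k: "k \<in> {k. k < M * Suc c \<and> P (k mod M)}"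
    show "k \<in> {k. k < M * c \<and> P (k mod M)} \<union> (\<lambda>i. M * c + i) ` {i. i < M \<and> P i}"
    proof (cases "k < M * c")
      case False
      then obtain i where i: "k = M * c + i"
        by (metis le_Suc_ex not_less)
      with k have "i < M" "P i"
        by auto
      with i show ?thesis
        by blast
    qed (use k in simp)
  qed auto
  moreover have "card ((\<lambda>i. M * c + i) ` {i. i < M \<and> P i}) = card {i. i < M \<and> P i}"
    by (rule card_image) simp
  moreover have "{k. k < M * c \<and> P (k mod M)} \<inter> (\<lambda>i. M * c + i) ` {i. i < M \<and> P i} = {}"
    by auto
  ultimately show ?case
    by (simp add: card_Un_disjoint Suc)
qed simp

text \<open>\<open>primitive_element\<close> asks only that the powers of \<open>g\<close> cover the
  nonzero elements. The first \<open>q - 1\<close> exponents already do, and equal cardinalities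
  then give injectivity.\<close>

lemma primitive_bij:
  fixes g :: "'q::{field,finite}"
  assumes "primitive_element g"
  shows "bij_betw (\<lambda>k. g ^ k) {..<CARD('q) - 1} (UNIV - {0})"
proof -
  let ?n = "CARD('q) - 1"
  have g: "g \<noteq> 0" and gen: "\<And>x. x \<noteq> 0 \<Longrightarrow> \<exists>k. x = g ^ k"
    using assms by (auto simp: primitive_element_def)
  have n: "card (UNIV - {0 :: 'q}) = ?n"
    by (simp add: card_Diff_singleton)
  have "UNIV - {0 :: 'q} \<noteq> {}"
    using g by blast
  then have "card (UNIV - {0 :: 'q}) > 0"
    by (meson card_gt_0_iff finite)
  then have "?n > 0"
    by (simp only: n)
  have g_mod: "g ^ k = g ^ (k mod ?n)" for k
  proof -
    have "g ^ k = g ^ (?n * (k div ?n) + k mod ?n)"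
      by simp
    also have "\<dots> = g ^ (k mod ?n)"
      by (simp only: power_add power_mult[of g ?n "k div ?n"] power_CARD_minus_1[OF g] power_one mult_1)
    finally show ?thesis .
  qed
  have img: "(\<lambda>k. g ^ k) ` {..<?n} = UNIV - {0}"
  proof (intro Set.set_eqI iffI)
    fix x :: 'q assume "x \<in> UNIV - {0}"
    then obtain k where "x = g ^ k"
      using gen by blast
    then have "x = g ^ (k mod ?n)"
      using g_mod by metis
    moreover have "k mod ?n < ?n"
      using \<open>?n > 0\<close> by simp
    ultimately show "x \<in> (\<lambda>k. g ^ k) ` {..<?n}"
      by blast
  qed (use g in auto)
  moreover have "inj_on (\<lambda>k. g ^ k) {..<?n}"
    by (rule eq_card_imp_inj_on) (simp_all only: img n finite_lessThan card_lessThan)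
  ultimately show ?thesis
    by (simp add: bij_betw_def)
qed

lemma primitive_power_eq_1_iff:
  fixes g :: "'q::{field,finite}"
  assumes "primitive_element g"
  shows "g ^ i = 1 \<longleftrightarrow> CARD('q) - 1 dvd i"
proof
  let ?n = "CARD('q) - 1"
  have g: "g \<noteq> 0"
    using assms by (auto simp: primitive_element_def)
  have n: "?n > 0"
  proof (rule ccontr)
    assume "\<not> ?n > 0"
    then have "UNIV - {0 :: 'q} = {}"
      using primitive_bij[OF assms] by (simp add: bij_betw_def)
    with g show False
      by blast
  qed
  assume "g ^ i = 1"
  then have "g ^ (?n * (i div ?n) + i mod ?n) = 1"
    by simp
  then have "g ^ (i mod ?n) = g ^ 0"
    by (simp only: power_add power_mult[of g ?n "i div ?n"] power_CARD_minus_1[OF g] power_one mult_1 power_0)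
  then have "i mod ?n = 0"
    by (rule inj_onD[OF bij_betw_imp_inj_on[OF primitive_bij[OF assms]]]) (use n in auto)
  then show "?n dvd i"
    by (rule mod_0_imp_dvd)
next
  have g: "g \<noteq> 0"
    using assms by (auto simp: primitive_element_def)
  assume "CARD('q) - 1 dvd i"
  then obtain k where "i = (CARD('q) - 1) * k" ..
  then show "g ^ i = 1"
    by (simp only: power_mult power_CARD_minus_1[OF g] power_one)
qed

lemma power_ind:
  assumes "primitive_element g" "b \<noteq> 0"
  shows "g ^ ind g b = b"
  using assms LeastI_ex[of "\<lambda>k. b = g ^ k"] by (auto simp: primitive_element_def ind_def)

context
  fixes l m K :: nat
  assumes l: "prime l" "odd l" and m: "m \<ge> 1" and K: "K = l ^ (m - 1)"
begin

lemma l_ge_3: "l \<ge> 3"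
  using l prime_ge_2_nat[of l] by (cases "l = 2") auto

lemma power_l_eq: "l ^ m = l * K"
  unfolding K using m by (metis power_eq_if not_one_le_zero)

lemma K_pos: "K > 0"
  using l_ge_3 by (simp add: K)

lemma odd_K: "odd K"
  using l by (simp add: K)

lemma J_iffs:
  "j \<in> J1_1 l m \<longleftrightarrow> j < 2 * l ^ m \<and> 1 \<le> j \<and> j \<le> (l - 1) * K \<and> \<not> K dvd j"
  "j \<in> J1_2 l m \<longleftrightarrow> j < 2 * l ^ m \<and> 1 \<le> j \<and> j \<le> (l - 1) * K \<and> K dvd j \<and> odd j"
  "j \<in> J1_3 l m \<longleftrightarrow> j < 2 * l ^ m \<and> 1 \<le> j \<and> j \<le> (l - 1) * K \<and> 2 * K dvd j"
  "j \<in> J2 l m \<longleftrightarrow> j < 2 * l ^ m \<and> (l - 1) * K < j \<and> j \<le> l ^ m"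
  "j \<in> J3_1 l m \<longleftrightarrow>
    (\<exists>k u. j = l ^ m + k * K - u \<and> 1 \<le> k \<and> k \<le> l - 1 \<and> 0 < u \<and> u \<le> K - 1)"
  "j \<in> J3_2 l m \<longleftrightarrow> (\<exists>k. j = l ^ m + k * K \<and> 1 \<le> k \<and> k \<le> l - 1 \<and> even k)"
  "j \<in> J3_3 l m \<longleftrightarrow> (\<exists>k. j = l ^ m + k * K \<and> 1 \<le> k \<and> k \<le> l - 1 \<and> odd k)"
  unfolding J1_1_def J1_2_def J1_3_def J2_def J3_1_def J3_2_def J3_3_def J1_def J_def K[symmetric]
  by auto

text \<open>Besides the single indices 0 and \<open>l ^ m\<close>, the trace of
  \<open>\<theta> ^ i\<close> is constant on the odd multiples of \<open>K\<close>, the even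
  multiples and the non-multiples. The multiplier \<open>l\<close> belongs to \<open>l ^ m\<close>;
  being odd, it has to be removed from this class.\<close>

definition odd_class :: "nat set" where
  "odd_class = {K * u |u. odd u \<and> u < 2 * l \<and> u \<noteq> l}"

definition even_class :: "nat set" where
  "even_class = {K * u |u. even u \<and> 0 < u \<and> u < 2 * l}"

definition rest_class :: "nat set" where
  "rest_class = {i. i < 2 * l ^ m \<and> \<not> K dvd i}"

text \<open>In \<open>J3_2\<close> the index is \<open>(l + k) * K\<close>, and an odd
  \<open>l\<close> turns the even \<open>k\<close> into an odd multiplier: \<open>J1_2\<close>
  supplies the odd multipliers below \<open>l\<close>, \<open>J3_2\<close> those above.\<close>

lemma J_odd: "J1_2 l m \<union> J3_2 l m = odd_class"
proof (intro Set.set_eqI iffI)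
  fix j assume "j \<in> J1_2 l m \<union> J3_2 l m"
  then consider "j \<in> J1_2 l m" | "j \<in> J3_2 l m"
    by blast
  then show "j \<in> odd_class"
  proof cases
    case 1
    then have *: "1 \<le> j" "j \<le> (l - 1) * K" "K dvd j" "odd j"
      by (auto simp: J_iffs)
    then obtain u where u: "j = K * u"
      by blast
    with * have "odd u" "u \<le> l - 1"
      using K_pos by (auto simp: mult.commute[of K])
    then have "odd u" "u < 2 * l" "u \<noteq> l"
      using l_ge_3 by auto
    with u show ?thesis
      unfolding odd_class_def by blast
  next
    case 2
    then obtain k where k: "j = l ^ m + k * K" "1 \<le> k" "k \<le> l - 1" "even k"
      by (auto simp: J_iffs)
    then have "j = K * (l + k)" "odd (l + k)" "l + k < 2 * l" "l + k \<noteq> l"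
      using l l_ge_3 by (auto simp: power_l_eq algebra_simps)
    then show ?thesis
      unfolding odd_class_def by blast
  qed
next
  fix j assume "j \<in> odd_class"
  then obtain u where u: "j = K * u" "odd u" "u < 2 * l" "u \<noteq> l"
    unfolding odd_class_def by blast
  show "j \<in> J1_2 l m \<union> J3_2 l m"
  proof (cases "u < l")
    case True
    have "K * u \<le> K * (l - 1)"
      using True by (intro mult_le_mono2) simp
    moreover have "K * u < K * (2 * l)"
      using u K_pos by simp
    moreover have "1 \<le> K * u"
      using u K_pos by (simp add: Suc_le_eq odd_pos)
    ultimately have "j \<in> J1_2 l m"
      using u odd_K by (auto simp: J_iffs power_l_eq mult_ac)
    then show ?thesis ..
  next
    case False
    with u have "j = l ^ m + (u - l) * K" "1 \<le> u - l" "u - l \<le> l - 1" "even (u - l)"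
      using l by (auto simp: power_l_eq algebra_simps diff_mult_distrib2)
    then have "j \<in> J3_2 l m"
      unfolding J_iffs by blast
    then show ?thesis ..
  qed
qed

lemma J_even: "J1_3 l m \<union> J3_3 l m = even_class"
proof (intro Set.set_eqI iffI)
  fix j assume "j \<in> J1_3 l m \<union> J3_3 l m"
  then consider "j \<in> J1_3 l m" | "j \<in> J3_3 l m"
    by blast
  then show "j \<in> even_class"
  proof cases
    case 1
    then have *: "1 \<le> j" "j \<le> (l - 1) * K" "2 * K dvd j"
      by (auto simp: J_iffs)
    then obtain v where v: "j = 2 * K * v"
      by blast
    with * have "K * (2 * v) \<le> K * (l - 1)" "0 < v"
      by (auto simp: mult_ac intro: Nat.gr0I)
    then have "2 * v \<le> l - 1" "0 < 2 * v"
      using K_pos by simp_all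
    then have "j = K * (2 * v)" "even (2 * v)" "0 < 2 * v" "2 * v < 2 * l"
      using l_ge_3 v by auto
    then show ?thesis
      unfolding even_class_def by blast
  next
    case 2
    then obtain k where k: "j = l ^ m + k * K" "1 \<le> k" "k \<le> l - 1" "odd k"
      by (auto simp: J_iffs)
    then have "j = K * (l + k)" "even (l + k)" "0 < l + k" "l + k < 2 * l"
      using l l_ge_3 by (auto simp: power_l_eq algebra_simps)
    then show ?thesis
      unfolding even_class_def by blast
  qed
next
  fix j assume "j \<in> even_class"
  then obtain u where u: "j = K * u" "even u" "0 < u" "u < 2 * l"
    unfolding even_class_def by blast
  with l have "u \<noteq> l"
    by auto
  show "j \<in> J1_3 l m \<union> J3_3 l m"
  proof (cases "u < l")
    case True
    have "K * u \<le> K * (l - 1)"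
      using True by (intro mult_le_mono2) simp
    moreover have "K * u < K * (2 * l)"
      using u K_pos by simp
    moreover have "1 \<le> K * u"
      using u K_pos by (simp add: Suc_le_eq)
    moreover have "2 * K dvd K * u"
      using u by (auto elim!: evenE simp: mult_ac)
    ultimately have "j \<in> J1_3 l m"
      using u by (auto simp: J_iffs power_l_eq mult_ac)
    then show ?thesis ..
  next
    case False
    with u \<open>u \<noteq> l\<close> have "j = l ^ m + (u - l) * K" "1 \<le> u - l" "u - l \<le> l - 1" "odd (u - l)"
      using l by (auto simp: power_l_eq algebra_simps diff_mult_distrib2)
    then have "j \<in> J3_3 l m"
      unfolding J_iffs by blast
    then show ?thesis ..
  qed
qed

text \<open>\<open>J2\<close> without \<open>l ^ m\<close> lies strictly between two consecutive
  multiples of \<open>K\<close>, and so does each element of \<open>J3_1\<close>;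
  \<open>J1_1\<close> excludes multiples by definition.\<close>

lemma J_rest:
  assumes "j \<in> (J2 l m - {l ^ m}) \<union> J1_1 l m \<union> J3_1 l m" "j < 2 * l ^ m"
  shows "j \<in> rest_class"
proof -
  consider "j \<in> J2 l m" "j \<noteq> l ^ m" | "j \<in> J1_1 l m" | "j \<in> J3_1 l m"
    using assms(1) by blast
  then show ?thesis
  proof cases
    case 1
    then have *: "(l - 1) * K < j" "j \<le> l * K"
      by (auto simp: J_iffs power_l_eq)
    have "j = l ^ m" if "K dvd j"
    proof -
      from that obtain u where u: "j = K * u" ..
      with * have "K * (l - 1) < K * u" "K * u \<le> K * l"
        by (simp_all add: mult.commute)
      then have "l - 1 < u" "u \<le> l"
        using K_pos by simp_all
      then have "u = l"
        by linarith
      with u show ?thesis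
        by (simp add: power_l_eq mult.commute)
    qed
    with 1 assms(2) show ?thesis
      by (auto simp: rest_class_def)
  next
    case 2
    with assms(2) show ?thesis
      by (auto simp: J_iffs rest_class_def)
  next
    case 3
    then obtain k u where j: "j = l ^ m + k * K - u" "1 \<le> k" "0 < u" "u \<le> K - 1"
      by (auto simp: J_iffs)
    have "u < K"
      using j K_pos by simp
    moreover have "K \<le> k * K"
      using j by simp
    \<comment> \<open>This makes the natural subtraction in \<open>J3_1\<close> exact.\<close>
    ultimately have "u \<le> k * K"
      by linarith
    then have "j + u = l ^ m + k * K"
      using j(1) by linarith
    then have eq: "j + u = (l + k) * K"
      by (simp add: power_l_eq distrib_right)
    have "\<not> K dvd j"
    proof
      assume "K dvd j"
      moreover have "K dvd j + u"
        unfolding eq by simp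
      ultimately have "K dvd u"
        by (simp add: dvd_add_right_iff)
      with j \<open>u < K\<close> show False
        by (auto dest: dvd_imp_le)
    qed
    with assms(2) show ?thesis
      by (simp add: rest_class_def)
  qed
qed

lemma dvd_mult_K: "l ^ m dvd K * u \<longleftrightarrow> l dvd u"
  using K_pos by (simp add: power_l_eq mult.commute[of l])

lemma multiple_of_l: "l dvd u \<Longrightarrow> u < 2 * l \<Longrightarrow> u = 0 \<or> u = l"
proof -
  assume "l dvd u" "u < 2 * l"
  from \<open>l dvd u\<close> obtain k where "u = l * k" ..
  with \<open>u < 2 * l\<close> have "k < 2"
    by simp
  with \<open>u = l * k\<close> show ?thesis
    by (cases k) auto
qed

lemma ramanujan_sum_alt: "ramanujan_sum l m i = (if l ^ m dvd i then (-1) ^ i * of_nat (K * (l - 1))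
    else if K dvd i then - ((-1) ^ i * of_nat K) else 0)"
  unfolding ramanujan_sum_def K ..

lemma ramanujan_sum_0: "ramanujan_sum l m 0 = of_nat (K * (l - 1))"
  by (simp add: ramanujan_sum_alt)

lemma ramanujan_sum_half: "ramanujan_sum l m (l ^ m) = - of_nat (K * (l - 1))"
  using l by (simp add: ramanujan_sum_alt)

lemma ramanujan_sum_odd:
  assumes "i \<in> odd_class"
  shows "ramanujan_sum l m i = of_nat K"
proof -
  obtain u where u: "i = K * u" "odd u" "u < 2 * l" "u \<noteq> l"
    using assms unfolding odd_class_def by blast
  then have "\<not> l dvd u"
    using multiple_of_l[of u] by auto
  with u odd_K show ?thesis
    by (simp add: ramanujan_sum_alt dvd_mult_K)
qed

lemma ramanujan_sum_even:
  assumes "i \<in> even_class"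
  shows "ramanujan_sum l m i = - of_nat K"
proof -
  obtain u where u: "i = K * u" "even u" "0 < u" "u < 2 * l"
    using assms unfolding even_class_def by blast
  then have "\<not> l dvd u"
    using l multiple_of_l[of u] by auto
  with u show ?thesis
    by (simp add: ramanujan_sum_alt dvd_mult_K)
qed

lemma ramanujan_sum_rest: "i \<in> rest_class \<Longrightarrow> ramanujan_sum l m i = 0"
  by (auto simp: ramanujan_sum_alt rest_class_def power_l_eq dest: dvd_mult_right)

lemma index_cases:
  assumes "i < 2 * l ^ m"
  shows "i = 0 \<or> i = l ^ m \<or> i \<in> odd_class \<or> i \<in> even_class \<or> i \<in> rest_class"
proof (cases "K dvd i")
  case True
  then obtain u where u: "i = K * u" ..
  with assms have "K * u < K * (2 * l)"
    by (simp add: power_l_eq mult_ac)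
  then have "u < 2 * l"
    by simp
  then show ?thesis
    using u unfolding odd_class_def even_class_def power_l_eq
    by (cases "u = 0"; cases "u = l"; cases "even u") (auto simp: mult.commute)
qed (use assms in \<open>simp add: rest_class_def\<close>)

lemma class_bound: "i \<in> odd_class \<union> even_class \<union> rest_class \<Longrightarrow> i < 2 * l ^ m"
  using K_pos by (auto simp: odd_class_def even_class_def rest_class_def power_l_eq)

lemma class_disjoint:
  "0 \<notin> odd_class" "0 \<notin> even_class" "0 \<notin> rest_class"
  "l ^ m \<notin> odd_class" "l ^ m \<notin> even_class" "l ^ m \<notin> rest_class" "l ^ m \<noteq> 0"
  "odd_class \<inter> even_class = {}" "odd_class \<inter> rest_class = {}" "even_class \<inter> rest_class = {}"
  using K_pos l l_ge_3 by (auto simp: odd_class_def even_class_def rest_class_def power_l_eq)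

lemma card_odd_class: "card odd_class = l - 1"
proof -
  \<comment> \<open>\<open>b = l div 2\<close> is the one value with
    \<open>2 * b + 1 = l\<close>.\<close>
  have "odd_class = (\<lambda>b. K * (2 * b + 1)) ` ({..<l} - {l div 2})"
  proof (intro Set.set_eqI iffI)
    fix i assume "i \<in> odd_class"
    then obtain u where u: "i = K * u" "odd u" "u < 2 * l" "u \<noteq> l"
      unfolding odd_class_def by blast
    then obtain b where "u = 2 * b + 1"
      by (auto elim: oddE)
    with u l show "i \<in> (\<lambda>b. K * (2 * b + 1)) ` ({..<l} - {l div 2})"
      by (intro image_eqI[of _ _ b]) auto
  next
    fix i assume "i \<in> (\<lambda>b. K * (2 * b + 1)) ` ({..<l} - {l div 2})"
    then obtain b where "i = K * (2 * b + 1)" "b < l" "b \<noteq> l div 2"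
      by blast
    moreover from this have "2 * b + 1 \<noteq> l"
      by auto
    ultimately show "i \<in> odd_class"
      unfolding odd_class_def by (intro CollectI exI[of _ "2 * b + 1"]) auto
  qed
  moreover have "inj_on (\<lambda>b. K * (2 * b + 1)) ({..<l} - {l div 2})"
    using K_pos by (auto simp: inj_on_def)
  ultimately show ?thesis
    using l_ge_3 by (simp add: card_image card_Diff_singleton)
qed

lemma card_even_class: "card even_class = l - 1"
proof -
  have "even_class = (\<lambda>b. K * (2 * b)) ` {1..<l}"
  proof (intro Set.set_eqI iffI)
    fix i assume "i \<in> even_class"
    then obtain u where u: "i = K * u" "even u" "0 < u" "u < 2 * l"
      unfolding even_class_def by blast
    then obtain b where "u = 2 * b"
      by (auto elim: evenE)
    with u show "i \<in> (\<lambda>b. K * (2 * b)) ` {1..<l}"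
      by (intro image_eqI[of _ _ b]) auto
  qed (auto simp: even_class_def)
  moreover have "inj_on (\<lambda>b. K * (2 * b)) {1..<l}"
    using K_pos by (auto simp: inj_on_def)
  ultimately show ?thesis
    by (simp add: card_image)
qed

lemma finite_classes: "finite odd_class" "finite even_class" "finite rest_class"
  by (rule finite_subset[of _ "{..<2 * l ^ m}"]; use class_bound in auto)+

lemma indices: "i < 2 * l ^ m \<longleftrightarrow>
    i \<in> {0} \<union> ({l ^ m} \<union> (odd_class \<union> (even_class \<union> rest_class)))"
  using index_cases[of i] class_bound[of i] l_ge_3 by auto

lemma card_rest_class: "card rest_class + 2 * l = 2 * l ^ m"
proof -
  have "{..<2 * l ^ m} = {0} \<union> ({l ^ m} \<union> (odd_class \<union> (even_class \<union> rest_class)))"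
    by (rule Set.set_eqI) (simp only: lessThan_iff indices)
  then have "2 * l ^ m = card ({0} \<union> ({l ^ m} \<union> (odd_class \<union> (even_class \<union> rest_class))))"
    by (metis card_lessThan)
  also have "\<dots> = card {0 :: nat} + (card {l ^ m} + (card odd_class + (card even_class + card rest_class)))"
    using class_disjoint finite_classes by (subst card_Un_disjoint; auto)+
  finally show ?thesis
    using l_ge_3 by (simp add: card_odd_class card_even_class)
qed

text \<open>The values on different classes may coincide in the ring, for instance modulo a small
  prime, so every class contributes through a condition of its own.\<close>

lemma card_ramanujan_sum_level:
  fixes \<alpha> :: "'a::comm_ring_1"
  shows "card {i. i < 2 * l ^ m \<and> ramanujan_sum l m i = \<alpha>} =
    (if of_nat (K * (l - 1)) = \<alpha> then 1 else 0) + (if - of_nat (K * (l - 1)) = \<alpha> then 1 else 0) +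
    (if of_nat K = \<alpha> then l - 1 else 0) + (if - of_nat K = \<alpha> then l - 1 else 0) +
    (if \<alpha> = 0 then 2 * l ^ m - 2 * l else 0)"
proof -
  have const: "card {i \<in> X. ramanujan_sum l m i = \<alpha>} = (if c = \<alpha> then card X else 0)"
    if "\<And>i. i \<in> X \<Longrightarrow> ramanujan_sum l m i = c" for X c
  proof (cases "c = \<alpha>")
    case True
    then have "{i \<in> X. ramanujan_sum l m i = \<alpha>} = X"
      using that by blast
    with True show ?thesis
      by simp
  next
    case False
    then have "{i \<in> X. ramanujan_sum l m i = \<alpha>} = {}"
      using that by blast
    with False show ?thesis
      by (simp only: card.empty if_False)
  qed
  have union: "card {i \<in> X \<union> Y. ramanujan_sum l m i = \<alpha>} =
      card {i \<in> X. ramanujan_sum l m i = \<alpha>} + card {i \<in> Y. ramanujan_sum l m i = \<alpha>}"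
    if "finite X" "finite Y" "X \<inter> Y = {}" for X Y
    unfolding Collect_disj_eq Un_iff conj_disj_distribR
    by (rule card_Un_disjoint) (use that in auto)
  have disj: "{0} \<inter> ({l ^ m} \<union> (odd_class \<union> (even_class \<union> rest_class))) = {}"
    "{l ^ m} \<inter> (odd_class \<union> (even_class \<union> rest_class)) = {}"
    "odd_class \<inter> (even_class \<union> rest_class) = {}"
    using class_disjoint by auto
  have indices_eq: "{i. i < 2 * l ^ m \<and> ramanujan_sum l m i = \<alpha>} =
      {i \<in> {0} \<union> ({l ^ m} \<union> (odd_class \<union> (even_class \<union> rest_class))). ramanujan_sum l m i = \<alpha>}"
    unfolding indices by blast
  have sum: "card {i. i < 2 * l ^ m \<and> ramanujan_sum l m i = \<alpha>} = card {i \<in> {0}. ramanujan_sum l m i = \<alpha>} +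
    (card {i \<in> {l ^ m}. ramanujan_sum l m i = \<alpha>} + (card {i \<in> odd_class. ramanujan_sum l m i = \<alpha>} +
      (card {i \<in> even_class. ramanujan_sum l m i = \<alpha>} + card {i \<in> rest_class. ramanujan_sum l m i = \<alpha>})))"
    unfolding indices_eq
    by (simp only: union disj class_disjoint(10) finite_classes finite_Un finite.emptyI finite_insert)
  have c1: "card {i \<in> {0}. ramanujan_sum l m i = \<alpha>} = (if of_nat (K * (l - 1)) = \<alpha> then card {0 :: nat} else 0)"
    by (rule const, erule singletonE, hypsubst, rule ramanujan_sum_0)
  have c2: "card {i \<in> {l ^ m}. ramanujan_sum l m i = \<alpha>} = (if - of_nat (K * (l - 1)) = \<alpha> then card {l ^ m} else 0)"
    by (rule const, erule singletonE, hypsubst, rule ramanujan_sum_half)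
  have c3: "card {i \<in> odd_class. ramanujan_sum l m i = \<alpha>} = (if of_nat K = \<alpha> then card odd_class else 0)"
    by (rule const[OF ramanujan_sum_odd])
  have c4: "card {i \<in> even_class. ramanujan_sum l m i = \<alpha>} = (if - of_nat K = \<alpha> then card even_class else 0)"
    by (rule const[OF ramanujan_sum_even])
  have c5: "card {i \<in> rest_class. ramanujan_sum l m i = \<alpha>} = (if 0 = \<alpha> then card rest_class else 0)"
    by (rule const[OF ramanujan_sum_rest])
  have c6: "card rest_class = 2 * l ^ m - 2 * l"
    using card_rest_class by linarith
  show ?thesis
    unfolding sum c1 c2 c3 c4 c5 c6 card_odd_class card_even_class eq_commute[of 0] add.assoc
    by simp
qed

end

text \<open>Multiplication by \<open>l - 1\<close> trades \<open>l ^ m\<close> for \<open>h\<close>: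
  \<open>(p ^ h + 1) * (l - 1) = 4 * h * l\<close>. The left side is exponential in \<open>h\<close>
  and the right side linear, so only \<open>h = 1\<close> with \<open>l = 3\<close> and
  \<open>h = 2\<close> with \<open>l = 5\<close> remain.\<close>

lemma double_prime_power_eq_power_plus_1:
  fixes p l m h :: nat
  assumes p: "prime p" "odd p" and l: "prime l" "odd l" "l \<noteq> p" and m: "m \<ge> 1"
    and h: "(l - 1) * l ^ (m - 1) = 2 * h" and eq: "p ^ h + 1 = 2 * l ^ m"
  shows "(p, l, m) = (5, 3, 1) \<or> (p, l, m) = (3, 5, 1)"
proof -
  have p3: "p \<ge> 3" and l3: "l \<ge> 3"
    using p l prime_ge_2_nat[of p] prime_ge_2_nat[of l] by (cases "p = 2"; cases "l = 2"; auto)+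
  have lm: "l ^ m = l * l ^ (m - 1)"
    using m by (metis power_eq_if not_one_le_zero)
  have h0: "h > 0"
    using h l3 by (intro Nat.gr0I) auto
  have key: "(p ^ h + 1) * (l - 1) = 4 * h * l"
    using h by (simp only: eq lm) (simp add: mult_ac)
  show ?thesis
  proof (cases "l = 3")
    case True
    have "p \<noteq> 3" "p \<noteq> 4"
      using l True p(2) by auto
    then have "p \<ge> 5"
      using p3 by linarith
    then have "5 ^ h \<le> p ^ h"
      by (simp add: power_mono)
    then have "5 ^ h + 1 \<le> p ^ h + 1"
      by (rule add_right_mono)
    also have "p ^ h + 1 = 6 * h"
      using key True by simp
    finally have le: "5 ^ h + 1 \<le> 6 * h" .
    have "6 * k < 5 ^ k + 1" if "k \<ge> 2" for k :: nat
      using that by (induction k rule: nat_induct_at_least) auto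
    with le have "h = 1"
      using h0 by (metis One_nat_def Suc_1 Suc_leI le_antisym linorder_not_less not_less_eq_eq)
    with key True h have "p = 5" "3 ^ (m - 1) = (1 :: nat)"
      by simp_all
    with True m show ?thesis
      by simp
  next
    case False
    moreover have "l \<noteq> 4"
      using l by auto
    ultimately have l5: "l \<ge> 5"
      using l3 by linarith
    \<comment> \<open>Valid from \<open>l = 5\<close> on, this removes \<open>l\<close> from the
      inequality and leaves one in \<open>p\<close> and \<open>h\<close>.\<close>
    have "4 * l \<le> 5 * (l - 1)"
      using l5 by linarith
    then have "h * (4 * l) \<le> h * (5 * (l - 1))"
      by (rule mult_le_mono2)
    then have "(p ^ h + 1) * (l - 1) \<le> (5 * h) * (l - 1)"
      unfolding key by (simp only: mult_ac)
    then have le: "p ^ h + 1 \<le> 5 * h"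
      by (rule mult_right_le_imp_le) (use l5 in simp)
    have "3 ^ h + 1 \<le> p ^ h + 1"
      by (rule add_right_mono, rule power_mono) (use p3 in auto)
    with le have le3: "3 ^ h + 1 \<le> 5 * h"
      by (rule order_trans[rotated])
    have "5 * k < 3 ^ k + 1" if "k \<ge> 3" for k :: nat
      using that by (induction k rule: nat_induct_at_least) auto
    with le3 have h2: "h \<le> 2"
      by (metis not_less_eq_eq linorder_not_less eval_nat_numeral(2) numeral_3_eq_3 numeral_2_eq_2)
    have "4 * l ^ (m - 1) \<le> (l - 1) * l ^ (m - 1)"
      using l5 by (intro mult_le_mono1) simp
    moreover have "(1 :: nat) \<le> l ^ (m - 1)"
      using l3 by simp
    ultimately have "h = 2" "l ^ (m - 1) = 1"
      using h h2 by linarith+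
    with h l5 have "l = 5" "m = 1"
      using m by auto
    have "p < 4"
    proof (rule ccontr)
      assume "\<not> p < 4"
      then have "4 ^ 2 \<le> p ^ 2"
        by (intro power_mono) auto
      with le \<open>h = 2\<close> show False
        by simp
    qed
    with p3 have "p = 3"
      by simp
    with \<open>l = 5\<close> \<open>m = 1\<close> show ?thesis
      by simp
  qed
qed

section \<open>The index of the exceptional class\<close>

locale index_code = prime_power_field tr e
  for tr :: "'q::{field,finite} \<Rightarrow> 'p::prime_card mod_ring" and e :: nat +
  fixes l m h r :: nat and g :: 'q and \<alpha> :: "'p mod_ring"
  assumes l: "prime l" "odd l" and m: "m \<ge> 1"
    and pr: "residue_primroot (2 * l ^ m) CARD('p)" and e_tot: "e = totient (2 * l ^ m)"
    and g: "primitive_element g"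
    and e_h: "e = 2 * h" and r_def: "r = CARD('p) ^ h" and dvd: "2 * l ^ m dvd r + 1"
begin

abbreviation N :: nat where
  "N \<equiv> 2 * l ^ m"

definition expo :: nat where
  "expo = (CARD('q) - 1) div N"

text \<open>Its parity is the one tested by \<open>j_adj\<close>.\<close>

definition cofactor :: nat where
  "cofactor = (r + 1) div N"

definition \<theta> :: 'q where
  "\<theta> = g ^ expo"

definition T :: "'q \<Rightarrow> 'p mod_ring" where
  "T x = tr (x ^ expo)"

text \<open>Half of \<open>r + 1\<close> is taken so that \<open>w ^ (r - 1)\<close> is
  \<open>g ^ ((q - 1) div 2)\<close>, that is -1.\<close>

definition w :: 'q where
  "w = g ^ ((r + 1) div 2)"

lemma r_eq_cofactor: "r + 1 = N * cofactor"
  using dvd by (simp add: cofactor_def)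

lemma r_pos: "r \<ge> 1"
  using p_gt_1 by (simp add: r_def)

lemma N_pos: "N > 0"
  using l by (simp add: prime_gt_0_nat)

lemma card_q_minus_1: "CARD('q) - 1 = (r - 1) * (r + 1)"
proof -
  have "CARD('q) = r * r"
    by (simp only: card_q e_h r_def mult_2 power_add)
  then show ?thesis
    by (simp add: algebra_simps)
qed

lemma expo_eq: "expo = (r - 1) * cofactor"
  unfolding expo_def card_q_minus_1 r_eq_cofactor using N_pos by (simp add: mult.left_commute)

lemma card_q_expo: "CARD('q) - 1 = N * expo"
  unfolding expo_eq card_q_minus_1 r_eq_cofactor by (simp add: mult_ac)

lemma q_gt_1: "CARD('q) - 1 > 0"
proof -
  have "CARD('p) ^ 1 \<le> CARD('q)"
    unfolding card_q using e_pos p_gt_1 by (intro power_increasing) auto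
  with p_gt_1 show ?thesis
    by simp
qed

lemma expo_pos: "expo > 0"
  using q_gt_1 unfolding card_q_expo by simp

lemma g_nonzero: "g \<noteq> 0"
  using g by (simp add: primitive_element_def)

lemma \<theta>_power_eq_1: "\<theta> ^ i = 1 \<longleftrightarrow> N dvd i"
proof -
  have "\<theta> ^ i = 1 \<longleftrightarrow> N * expo dvd i * expo"
    by (simp only: \<theta>_def primitive_power_eq_1_iff[OF g] card_q_expo mult.commute[of i] flip: power_mult)
  also have "\<dots> \<longleftrightarrow> N dvd i"
    using expo_pos by simp
  finally show ?thesis .
qed

lemma \<theta>_power_mod: "\<theta> ^ (k mod N) = \<theta> ^ k"
proof -
  have "\<theta> ^ k = \<theta> ^ (N * (k div N) + k mod N)"
    by (simp only: mult_div_mod_eq)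
  also have "\<dots> = \<theta> ^ (k mod N)"
  proof -
    have "\<theta> ^ N = 1"
      by (simp only: \<theta>_power_eq_1 dvd_refl)
    then show ?thesis
      by (simp only: power_add power_mult[of \<theta> N "k div N"] power_one mult_1)
  qed
  finally show ?thesis ..
qed

lemma tr_\<theta>: "tr (\<theta> ^ i) = ramanujan_sum l m i"
  by (rule tr_root_of_unity[OF l m pr e_tot \<theta>_power_eq_1])

lemma \<theta>_half: "\<theta> ^ (l ^ m) = -1"
proof -
  have "(\<theta> ^ (l ^ m))\<^sup>2 = 1"
    by (simp only: \<theta>_power_eq_1 mult.commute[of _ 2] dvd_refl flip: power_mult)
  moreover have "\<theta> ^ (l ^ m) \<noteq> 1"
    using N_pos unfolding \<theta>_power_eq_1 by (auto dest: dvd_imp_le)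
  ultimately show ?thesis
    by (simp add: power2_eq_1_iff)
qed

text \<open>\<open>T\<close> ignores a nonzero \<open>t\<close> with \<open>t ^ r = t\<close>
  because \<open>r - 1\<close> divides \<open>expo\<close>, which is the divisibility of
  \<open>r + 1\<close> by \<open>N\<close> in another form.\<close>

sublocale quadratic_tower tr e h r T w \<alpha>
proof
  have r2: "2 * ((r + 1) div 2) = r + 1"
    unfolding r_eq_cofactor by simp
  show "w \<noteq> 0"
    using g_nonzero by (simp add: w_def)
  have "w ^ (r - 1) = -1"
  proof -
    have pos: "0 < (r + 1) div 2 * (r - 1)" "2 * ((r + 1) div 2 * (r - 1)) = CARD('q) - 1"
    proof -
      show eq: "2 * ((r + 1) div 2 * (r - 1)) = CARD('q) - 1"
        unfolding card_q_minus_1 by (metis mult.assoc mult.commute r2)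
      show "0 < (r + 1) div 2 * (r - 1)"
        using q_gt_1 eq by (metis mult_0_right not_gr_zero)
    qed
    have "(w ^ (r - 1))\<^sup>2 = 1"
      by (simp only: w_def primitive_power_eq_1_iff[OF g] pos(2) mult.commute[of _ 2] dvd_refl flip: power_mult)
    moreover have "w ^ (r - 1) \<noteq> 1"
    proof
      assume "w ^ (r - 1) = 1"
      then have "CARD('q) - 1 dvd (r + 1) div 2 * (r - 1)"
        by (simp only: w_def primitive_power_eq_1_iff[OF g] flip: power_mult)
      with pos show False
        by (auto dest: dvd_imp_le)
    qed
    ultimately show ?thesis
      by (simp add: power2_eq_1_iff)
  qed
  then have "w * w ^ (r - 1) = - w"
    by simp
  then show "w ^ r = - w"
    using r_pos by (metis Suc_diff_1 less_eq_Suc_le One_nat_def power_Suc)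
  show "T (x * t) = T x" if "t ^ r = t" "t \<noteq> 0" for x t
  proof -
    have "t * t ^ (r - 1) = t * 1"
      using that(1) r_pos by (metis Suc_diff_1 less_eq_Suc_le One_nat_def power_Suc mult_1_right)
    then have "t ^ (r - 1) = 1"
      using that(2) by (metis mult_left_cancel)
    then have "t ^ expo = 1"
      unfolding expo_eq power_mult by simp
    then show ?thesis
      by (simp add: T_def power_mult_distrib)
  qed
qed (use e_h r_def in auto)

lemma D_eq: "D \<beta> = defining_set l m e \<alpha> \<beta>"
  unfolding D_def defining_set_def T_def expo_def tr_def[symmetric] tr_add ..

lemma T_power: "T (g ^ k) = ramanujan_sum l m (k mod N)"
proof -
  have "T (g ^ k) = tr (\<theta> ^ k)"
    by (simp add: T_def \<theta>_def mult.commute flip: power_mult)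
  also have "\<dots> = tr (\<theta> ^ (k mod N))"
    by (simp only: \<theta>_power_mod)
  finally show ?thesis
    by (simp only: tr_\<theta>)
qed

definition sigma :: nat where
  "sigma = card {i. i < N \<and> ramanujan_sum l m i = \<alpha>}"

text \<open>In exponents of \<open>g\<close> the condition \<open>T x = \<alpha>\<close> has period
  \<open>N\<close>, and \<open>q - 1\<close> consists of \<open>expo\<close> periods.\<close>

lemma card_D_0_eq: "card (D 0) = expo * sigma"
proof -
  have "bij_betw (\<lambda>k. g ^ k) {k. k < N * expo \<and> ramanujan_sum l m (k mod N) = \<alpha>} (D 0)"
  proof (rule bij_betw_subset[OF primitive_bij[OF g]])
    show "{k. k < N * expo \<and> ramanujan_sum l m (k mod N) = \<alpha>} \<subseteq> {..<CARD('q) - 1}"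
      unfolding card_q_expo by auto
    have ex: "\<exists>k. k < N * expo \<and> x = g ^ k" if "x \<noteq> 0" for x
    proof -
      have "x \<in> (\<lambda>k. g ^ k) ` {..<CARD('q) - 1}"
        using that primitive_bij[OF g] by (simp add: bij_betw_def)
      then show ?thesis
        unfolding card_q_expo by blast
    qed
    show "(\<lambda>k. g ^ k) ` {k. k < N * expo \<and> ramanujan_sum l m (k mod N) = \<alpha>} = D 0"
    proof (intro Set.set_eqI iffI)
      fix x assume "x \<in> D 0"
      then have x: "x \<noteq> 0" "T x = \<alpha>"
        by (simp_all add: D_def)
      with ex obtain k where "k < N * expo" "x = g ^ k"
        by blast
      with x(2) T_power show "x \<in> (\<lambda>k. g ^ k) ` {k. k < N * expo \<and> ramanujan_sum l m (k mod N) = \<alpha>}"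
        by auto
    qed (use g_nonzero in \<open>auto simp: D_def T_power\<close>)
  qed
  then show ?thesis
    unfolding sigma_def card_mod_periodic[symmetric] by (rule bij_betw_same_card[symmetric])
qed

lemma kappa_eq: "kappa = real sigma * (real r + 1) / real N"
proof -
  have r1: "real r - 1 > 0"
    using r_gt_1 by simp
  have "kappa * (real r - 1) = real (r - 1) * real cofactor * real sigma"
    using card_D_0 by (simp add: card_D_0_eq expo_eq)
  also have "real (r - 1) = real r - 1"
    using r_pos by (simp add: of_nat_diff)
  finally have "kappa = real cofactor * real sigma"
    using r1 by (simp add: mult.commute mult.left_commute)
  moreover have "real cofactor = (real r + 1) / real N"
  proof -
    have "real r + 1 = real N * real cofactor"
      using r_eq_cofactor by (metis of_nat_1 of_nat_add of_nat_mult)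
    then show ?thesis
      using N_pos by (metis nonzero_mult_div_cancel_left of_nat_0_less_iff less_irrefl)
  qed
  ultimately show ?thesis
    by simp
qed

definition adjusted_index :: "'q \<Rightarrow> nat" where
  "adjusted_index \<beta> = j_adj CARD('p) e l m (j_index l m g \<beta>)"

lemma j_index_less: "j_index l m g \<beta> < N"
  unfolding j_index_def using N_pos by (simp add: nat_less_iff)

lemma adjusted_index_less: "adjusted_index \<beta> < N"
  using j_index_less[of \<beta>] N_pos by (simp add: adjusted_index_def j_adj_def)

text \<open>The negation in \<open>j_index\<close> is there for this purpose:
  \<open>\<theta> ^ j_index l m g \<beta>\<close> is the \<open>expo\<close>-th power of the inverse
  of a nonzero \<open>\<beta>\<close>, which is what \<open>T (w / \<beta>)\<close>
  involves.\<close>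

lemma \<theta>_j_index: "\<theta> ^ j_index l m g \<beta> * \<theta> ^ ind g \<beta> = 1"
proof -
  let ?i = "ind g \<beta>" and ?j = "j_index l m g \<beta>"
  have "int ?j = (- int ?i) mod int N"
    using N_pos by (simp add: j_index_def)
  then have "int N dvd - int ?i - int ?j"
    by (metis minus_mod_eq_mult_div dvd_triv_left)
  then have "int N dvd int (?j + ?i)"
    by (metis diff_minus_eq_add dvd_minus_iff minus_add_distrib add.commute of_nat_add uminus_add_conv_diff)
  then have "N dvd ?j + ?i"
    by (simp only: of_nat_dvd_iff)
  then show ?thesis
    by (simp only: \<theta>_power_eq_1 flip: power_add)
qed

text \<open>The factor \<open>\<theta> ^ ((r + 1) div 2)\<close> is the \<open>expo\<close>-th power
  of \<open>w\<close>. It equals \<open>(-1) ^ cofactor\<close>, and since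
  \<open>\<theta> ^ (l ^ m) = -1\<close>, an odd \<open>cofactor\<close> amounts to adding
  \<open>l ^ m\<close> to the index.\<close>

lemma \<theta>_adjusted_index: "\<theta> ^ adjusted_index \<beta> = \<theta> ^ j_index l m g \<beta> * \<theta> ^ ((r + 1) div 2)"
proof -
  have half: "(r + 1) div 2 = l ^ m * cofactor"
    unfolding r_eq_cofactor by simp
  have half_exponent: "(CARD('p) ^ (e div 2) + 1) div N = cofactor"
  proof -
    have "e div 2 = h"
      by (simp add: e_h)
    then show ?thesis
      by (simp only: cofactor_def r_def[symmetric])
  qed
  show ?thesis
  proof (cases "even cofactor")
    case True
    then have "\<theta> ^ ((r + 1) div 2) = 1"
      unfolding half \<theta>_power_eq_1 by (auto elim!: evenE)
    with True show ?thesis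
      unfolding adjusted_index_def j_adj_def half_exponent by simp
  next
    case False
    then have "\<theta> ^ ((r + 1) div 2) = -1"
      unfolding half power_mult \<theta>_half by simp
    with False show ?thesis
      unfolding adjusted_index_def j_adj_def half_exponent by (simp only: if_False \<theta>_power_mod power_add \<theta>_half)
  qed
qed

lemma delta_eq:
  assumes "\<beta> \<noteq> 0"
  shows "delta \<beta> = of_bool (ramanujan_sum l m (adjusted_index \<beta>) = \<alpha>)"
proof -
  have "\<theta> ^ adjusted_index \<beta> * \<beta> ^ expo = w ^ expo"
  proof -
    have "\<beta> ^ expo = \<theta> ^ ind g \<beta>"
      using power_ind[OF g assms] by (metis \<theta>_def mult.commute power_mult)
    moreover have "w ^ expo = \<theta> ^ ((r + 1) div 2)"
      unfolding w_def \<theta>_def by (simp only: mult.commute flip: power_mult)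
    ultimately show ?thesis
      unfolding \<theta>_adjusted_index using \<theta>_j_index[of \<beta>] by (simp add: mult_ac)
  qed
  then have "(w / \<beta>) ^ expo = \<theta> ^ adjusted_index \<beta>"
    using assms by (simp add: power_divide field_simps)
  then have "T (w / \<beta>) = ramanujan_sum l m (adjusted_index \<beta>)"
    by (simp add: T_def tr_\<theta>)
  then show ?thesis
    by (simp add: delta_def)
qed

text \<open>The adjustment changes the root of unity, and hence the trace, at most by a sign.
  Vanishing is unaffected, which is why \<open>\<alpha> = 0\<close> is decided by the unadjusted
  index.\<close>

lemma ramanujan_sum_adjusted_index: "ramanujan_sum l m (adjusted_index \<beta>) = (0 :: 'p mod_ring) \<longleftrightarrow> ramanujan_sum l m (j_index l m g \<beta>) = (0 :: 'p mod_ring)"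
proof -
  have "\<theta> ^ adjusted_index \<beta> = \<theta> ^ j_index l m g \<beta> \<or> \<theta> ^ adjusted_index \<beta> = - (\<theta> ^ j_index l m g \<beta>)"
    by (simp add: adjusted_index_def j_adj_def \<theta>_power_mod power_add \<theta>_half)
  then have "tr (\<theta> ^ adjusted_index \<beta>) = 0 \<longleftrightarrow> tr (\<theta> ^ j_index l m g \<beta>) = 0"
    by (auto simp: tr_minus)
  then show ?thesis
    by (simp only: tr_\<theta>)
qed

end

section \<open>The case distinction\<close>

lemma card_of_real_image_eq_pair:
  assumes "real ` X = {a, b}" "a \<noteq> b"
  shows "card X = 2"
proof -
  have "card X = card (real ` X)"
    by (simp add: card_image inj_on_def)
  with assms show ?thesis
    by simp
qed

lemma of_nat_mod_ring_eq_0_iff: "of_nat n = (0 :: 'p::prime_card mod_ring) \<longleftrightarrow> CARD('p) dvd n"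
  by (simp only: of_nat_eq_0_iff_char_dvd semiring_char_mod_ring)

lemma neg_eq_self_mod_ring:
  fixes x :: "'p::prime_card mod_ring"
  assumes "odd CARD('p)" "- x = x"
  shows "x = 0"
proof -
  have "\<not> CARD('p) dvd 2"
  proof
    assume "CARD('p) dvd 2"
    then have "CARD('p) \<le> 2"
      by (rule dvd_imp_le) simp
    moreover have "CARD('p) > 1"
      by (rule prime_gt_1_nat[OF prime_card])
    ultimately have "CARD('p) = 2"
      by linarith
    with assms(1) show False
      by simp
  qed
  then have "of_nat 2 \<noteq> (0 :: 'p mod_ring)"
    by (simp only: of_nat_mod_ring_eq_0_iff not_False_eq_True)
  moreover have "of_nat 2 * x = 0"
    using assms(2) by (metis add.right_inverse mult_2 of_nat_numeral)
  ultimately show ?thesis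
    by (metis mult_eq_0_iff)
qed

section \<open>Coincidences of trace values modulo \<open>p\<close> and the number of
  classes\<close>

context index_code
begin

context
  fixes K :: nat and A B :: "'p mod_ring"
  assumes p: "odd CARD('p)" "l \<noteq> CARD('p)"
    and K: "K = l ^ (m - 1)" and A: "A = of_nat (K * (l - 1))" and B: "B = of_nat K"
begin

lemmas ramanujan_sum_classes = ramanujan_sum_0[OF l m K, where ?'a = "'p mod_ring", folded A]
  ramanujan_sum_half[OF l m K, where ?'a = "'p mod_ring", folded A]
  ramanujan_sum_odd[OF l m K, where ?'a = "'p mod_ring", folded B]
  ramanujan_sum_even[OF l m K, where ?'a = "'p mod_ring", folded B]
  ramanujan_sum_rest[OF l m K, where ?'a = "'p mod_ring"]

lemma p_not_dvd: "\<not> CARD('p) dvd l" "\<not> CARD('p) dvd K"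
proof -
  show "\<not> CARD('p) dvd l"
    using p(2) l(1) prime_card[where ?'a = 'p] by (metis primes_dvd_imp_eq)
  then show "\<not> CARD('p) dvd K"
    unfolding K using prime_dvd_power[OF prime_card[where ?'a = 'p]] by blast
qed

lemma B_nonzero: "B \<noteq> 0"
  unfolding B of_nat_mod_ring_eq_0_iff by (rule p_not_dvd)

text \<open>\<open>A + B\<close> is the image of \<open>l ^ m\<close>, a unit modulo
  \<open>p\<close> because \<open>l \<noteq> p\<close>.\<close>

lemma A_plus_B: "A + B \<noteq> 0"
proof -
  have "K * (l - 1) + K = K * l"
    using l(1) prime_gt_0_nat[of l] by (cases l) auto
  then have "A + B = of_nat (K * l)"
    unfolding A B by (metis of_nat_add)
  moreover have "\<not> CARD('p) dvd K * l"
    using p_not_dvd prime_card[where ?'a = 'p] prime_dvd_multD by blast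
  ultimately show ?thesis
    by (simp only: of_nat_mod_ring_eq_0_iff not_False_eq_True)
qed

lemma A_eq_0: "A = 0 \<longleftrightarrow> [l = 1] (mod CARD('p))"
proof -
  have "A = 0 \<longleftrightarrow> CARD('p) dvd l - 1"
    unfolding A of_nat_mod_ring_eq_0_iff
    using p_not_dvd prime_card[where ?'a = 'p] prime_dvd_mult_iff by blast
  also have "\<dots> \<longleftrightarrow> [l = 1] (mod CARD('p))"
    using l(1) prime_ge_1_nat[of l] by (simp add: cong_altdef_nat)
  finally show ?thesis .
qed

text \<open>For nonzero \<open>\<alpha>\<close> the only coincidence left is \<open>A = B\<close>.
  Hence the theorem has only three patterns of vanishing among \<open>a1\<close>, \<open>a2\<close>,
  \<open>a3\<close>, \<open>a4\<close> to distinguish, besides the one where none vanishes.\<close>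

lemma exclusive:
  assumes "\<alpha> \<noteq> 0"
  shows "\<not> (A = \<alpha> \<and> - A = \<alpha>)" "\<not> (B = \<alpha> \<and> - B = \<alpha>)" "\<not> (A = \<alpha> \<and> - B = \<alpha>)" "\<not> (- A = \<alpha> \<and> B = \<alpha>)"
proof -
  show "\<not> (A = \<alpha> \<and> - A = \<alpha>)" "\<not> (B = \<alpha> \<and> - B = \<alpha>)"
    using assms neg_eq_self_mod_ring[OF p(1), of \<alpha>] by auto
  show "\<not> (A = \<alpha> \<and> - B = \<alpha>)" "\<not> (- A = \<alpha> \<and> B = \<alpha>)"
    using A_plus_B by auto
qed

lemma l_ge_3': "l \<ge> 3"
  by (rule l_ge_3[OF l m K])

lemma l_le_power: "l \<le> l ^ m"
  using m l_ge_3' by (simp add: self_le_power)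

lemma sigma_eq: "sigma =
    (if A = \<alpha> then 1 else 0) + (if - A = \<alpha> then 1 else 0) +
    (if B = \<alpha> then l - 1 else 0) + (if - B = \<alpha> then l - 1 else 0) +
    (if \<alpha> = 0 then 2 * l ^ m - 2 * l else 0)"
  unfolding sigma_def A B by (rule card_ramanujan_sum_level[OF l m K])

lemma sigma_le: "sigma + 3 \<le> N"
proof (cases "\<alpha> = 0")
  case True
  have "sigma \<le> 2 + (2 * l ^ m - 2 * l)"
    unfolding sigma_eq using True B_nonzero by auto
  then show ?thesis
    using l_ge_3' l_le_power by linarith
next
  case False
  have "sigma \<le> 1 + (l - 1)"
    unfolding sigma_eq using False exclusive by auto
  then show ?thesis
    using l_ge_3' l_le_power by linarith
qed

lemma r_ge: "r + 1 \<ge> N"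
  using dvd by (rule dvd_imp_le) simp

text \<open>\<open>kappa\<close> is the share \<open>sigma / N\<close> of the \<open>r + 1\<close>
  lines. By \<open>sigma_le\<close> at least 3 of the \<open>N\<close> classes are missed, and each
  holds \<open>(r + 1) / N \<ge> 1\<close> lines, so at least 3 lines are missed.\<close>

lemma kappa_less: "kappa < real r - 1"
proof -
  define Y where "Y = real N"
  have S: "real sigma + 3 \<le> Y"
    using of_nat_mono[OF sigma_le, where ?'a = real] by (simp only: Y_def of_nat_add of_nat_numeral)
  have R: "Y \<le> real r + 1"
    using of_nat_mono[OF r_ge, where ?'a = real] by (simp only: Y_def of_nat_add of_nat_1)
  have Y: "Y > 0"
    unfolding Y_def using N_pos by simp
  have "real sigma * (real r + 1) \<le> (Y - 3) * (real r + 1)"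
    using S by (intro mult_right_mono) auto
  also have "\<dots> = Y * (real r + 1) - 3 * (real r + 1)"
    by (simp add: algebra_simps)
  also have "\<dots> < Y * (real r + 1) - 2 * Y"
  proof (rule diff_strict_left_mono)
    show "2 * Y < 3 * (real r + 1)"
    proof (rule le_less_trans)
      show "2 * Y \<le> 2 * (real r + 1)"
        using R by simp
    qed simp
  qed
  also have "\<dots> = (real r - 1) * Y"
    by (simp add: algebra_simps)
  finally show ?thesis
    unfolding kappa_eq Y_def[symmetric] using Y by (simp only: pos_divide_less_eq)
qed

lemma ramanujan_sum_eq_iff:
  assumes "\<alpha> \<noteq> 0" "i < N"
  shows "ramanujan_sum l m i = \<alpha> \<longleftrightarrow> A = \<alpha> \<and> i = 0 \<or> - A = \<alpha> \<and> i = l ^ m \<or>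
    B = \<alpha> \<and> i \<in> odd_class l K \<or> - B = \<alpha> \<and> i \<in> even_class l K"
  using index_cases[OF l m K assms(2)]
proof (elim disjE)
  assume "i \<in> rest_class l m K"
  then show ?thesis
    using ramanujan_sum_classes assms(1) class_disjoint[OF l m K] by auto
next
  assume "i \<in> odd_class l K"
  then show ?thesis
    using ramanujan_sum_classes(3)[of i] class_disjoint[OF l m K] by auto
next
  assume "i \<in> even_class l K"
  then show ?thesis
    using ramanujan_sum_classes(4)[of i] class_disjoint[OF l m K] by auto
next
  assume "i = 0"
  then show ?thesis
    using ramanujan_sum_classes(1) class_disjoint[OF l m K] by auto
next
  assume "i = l ^ m"
  then show ?thesis
    using ramanujan_sum_classes(2) class_disjoint[OF l m K] by auto
qed

text \<open>The excluded equation says \<open>kappa = 1\<close>. As \<open>r + 1 \<ge> N\<close>, it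
  forces \<open>sigma = 1\<close> and \<open>r + 1 = N\<close>, which leaves the two solutions of
  \<open>double_prime_power_eq_power_plus_1\<close>; of these, (3, 5, 1) is incompatible with
  \<open>sigma = 1\<close>.\<close>

lemma sigma_nonexceptional:
  assumes "sigma > 0" "\<not> ((CARD('p), l, m) = (5, 3, 1) \<and> (A = \<alpha> \<or> - A = \<alpha>))"
  shows "sigma * (r + 1) \<noteq> N"
proof
  assume eq: "sigma * (r + 1) = N"
  have one: "sigma = 1"
  proof (rule ccontr)
    assume "sigma \<noteq> 1"
    with assms(1) have "2 * (r + 1) \<le> sigma * (r + 1)"
      by (intro mult_le_mono1) simp
    also have "\<dots> \<le> r + 1"
      unfolding eq by (rule r_ge)
    finally show False
      by simp
  qed
  have "\<alpha> \<noteq> 0"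
  proof
    assume "\<alpha> = 0"
    then have "even sigma"
      using B_nonzero unfolding sigma_eq by auto
    with one show False
      by simp
  qed
  then have AB: "A = \<alpha> \<or> - A = \<alpha>" "B \<noteq> \<alpha>" "- B \<noteq> \<alpha>"
    using one exclusive l_ge_3' unfolding sigma_eq by (auto split: if_splits)
  have "(l - 1) * l ^ (m - 1) = 2 * h"
    using totient_double_odd_prime_power[OF l m] e_tot e_h by simp
  moreover have "CARD('p) ^ h + 1 = 2 * l ^ m"
    using eq one by (simp add: r_def)
  ultimately have "(CARD('p), l, m) = (5, 3, 1) \<or> (CARD('p), l, m) = (3, 5, 1)"
    by (intro double_prime_power_eq_power_plus_1[OF prime_card p(1) l p(2) m])
  then have *: "CARD('p) = 3" "l = 5" "m = 1"
    using assms(2) AB by auto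
  \<comment> \<open>Modulo 3 the number \<open>l - 1 = 4\<close> equals 1, so \<open>A = B\<close>,
    and the value at a single index would be shared by a class of \<open>l - 1\<close> further
    indices.\<close>
  have "of_nat 3 = (0 :: 'p mod_ring)"
    unfolding of_nat_mod_ring_eq_0_iff by (simp add: *)
  then have "of_nat (3 + 1) = (1 :: 'p mod_ring)"
    by (simp only: of_nat_add of_nat_1 add_0_left)
  then have "A = B"
    unfolding A B K by (simp add: *)
  with AB show False
    by auto
qed

section \<open>Transfer to closed formulas over the reals\<close>

context
  fixes P Q s M :: real
  assumes reals: "P = real CARD('p)" "s = real r" "Q = s\<^sup>2" "M = real l ^ m"
begin

lemma P_gt_1: "P > 1"
  using p_gt_1 by (simp add: reals)

lemma s_gt_1: "s > 1"
  using r_gt_1 by (simp add: reals)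

lemma M_pos: "M > 0"
  using l_ge_3' by (simp add: reals)

lemma kappa_real: "kappa = real sigma * (s + 1) / (2 * M)"
  by (simp add: kappa_eq reals)

context
  fixes ds :: "'q list" and C :: "'p word set"
  assumes ds: "distinct ds" and C: "C = code e ds"
begin

text \<open>The target expressions enter as equations, so that each case of the theorem becomes real
  arithmetic once \<open>sigma\<close> is known. The second and third conclusions differ only in the
  order of the two weights, since the cases list them in both orders.\<close>

lemma zero_rule:
  assumes "set ds = D 0" "sigma > 0" "sigma * (r + 1) \<noteq> N"
    and S: "real sigma = S"
    and n': "n' = S * (Q - 1) / (2 * M)"
    and w1: "w1 = (P - 1) / (2 * P * M) * (S * (Q + s))"
    and w2: "w2 = (P - 1) / (2 * P * M) * (S * (Q + s) - 2 * M * s)"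
    and n1: "n1 = (Q - 1) * (2 * M - S) / (2 * M)"
    and n2: "n2 = S * (Q - 1) / (2 * M)"
  shows "code_dim C = e"
    and "real (length ds) = n' \<and> (let w1 = w1; w2 = w2 in w1 \<noteq> w2 \<and>
      real ` nonzero_weights C = {w1, w2} \<and>
      real (weight_count C w1) = n1 \<and> real (weight_count C w2) = n2)"
    and "real (length ds) = n' \<and> (let w2 = w2; w1 = w1 in w2 \<noteq> w1 \<and>
      real ` nonzero_weights C = {w2, w1} \<and>
      real (weight_count C w2) = n2 \<and> real (weight_count C w1) = n1)"
    and "two_weight_code C"
proof -
  note pos = P_gt_1 s_gt_1 M_pos
  have kappa: "0 < kappa" "kappa \<noteq> 1" "kappa < real r + 1"
  proof -
    show "0 < kappa"
      using pos assms(2) by (simp add: kappa_real)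
    show "kappa < real r + 1"
      using kappa_less by linarith
    show "kappa \<noteq> 1"
    proof
      assume "kappa = 1"
      then have "real sigma * (real r + 1) = 2 * real l ^ m"
        using pos by (simp add: kappa_real reals)
      then have "real (sigma * (r + 1)) = real N"
        by (simp only: of_nat_mult of_nat_add of_nat_1 of_nat_power of_nat_numeral)
      with assms(3) show False
        by (simp only: of_nat_eq_iff)
    qed
  qed
  note Z = weights_zero[OF ds assms(1) C kappa]
  show "code_dim C = e"
    by (rule Z(1))
  have e1: "(real CARD('p) - 1) * real r / real CARD('p) * kappa = w1"
    unfolding w1 kappa_real S using pos
    by (simp add: reals(3) field_simps power2_eq_square flip: reals(1,2))
  have e2: "(real CARD('p) - 1) * real r / real CARD('p) * (kappa - 1) = w2"
    unfolding w2 kappa_real S using pos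
    by (simp add: reals(3) field_simps power2_eq_square flip: reals(1,2))
  have e3: "kappa * (real r - 1) = S * (Q - 1) / (2 * M)"
    unfolding kappa_real S using pos
    by (simp add: reals(3) field_simps power2_eq_square flip: reals(1,2))
  have e4: "(real r)\<^sup>2 - 1 - S * (Q - 1) / (2 * M) = (Q - 1) * (2 * M - S) / (2 * M)"
    using pos by (simp add: reals(3) field_simps power2_eq_square flip: reals(1,2))
  have len: "real (length ds) = n'"
    using Z(2) unfolding e3 n' .
  have cnt1: "real (weight_count C w1) = n1"
    using Z(5) unfolding e1 e3 e4 n1 .
  have cnt2: "real (weight_count C w2) = n2"
    using Z(6) unfolding e2 e3 n2 .
  have ne: "w1 \<noteq> w2"
    using Z(3) unfolding e1 e2 .
  have set: "real ` nonzero_weights C = {w1, w2}"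
    using Z(4) unfolding e1 e2 .
  show "real (length ds) = n' \<and> (let w1 = w1; w2 = w2 in w1 \<noteq> w2 \<and>
      real ` nonzero_weights C = {w1, w2} \<and>
      real (weight_count C w1) = n1 \<and> real (weight_count C w2) = n2)"
    unfolding Let_def using len ne set cnt1 cnt2 by blast
  show "real (length ds) = n' \<and> (let w2 = w2; w1 = w1 in w2 \<noteq> w1 \<and>
      real ` nonzero_weights C = {w2, w1} \<and>
      real (weight_count C w2) = n2 \<and> real (weight_count C w1) = n1)"
    unfolding Let_def using len ne set cnt1 cnt2 by blast
  show "two_weight_code C"
    unfolding two_weight_code_def using set ne by (rule card_of_real_image_eq_pair)
qed

lemma nonzero_rule:
  assumes "set ds = D \<beta>" "\<beta> \<noteq> 0" and S: "real sigma = S"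
  shows "code_dim C = e"
    and "card (nonzero_weights C) \<le> CARD('p) + 1"
    and "ramanujan_sum l m (adjusted_index \<beta>) \<noteq> \<alpha> \<Longrightarrow> n' = Q / P - S * (s + 1) / (2 * M) \<Longrightarrow>
      v = s / P * (s - S * (s + 1) / (2 * M)) \<Longrightarrow>
      W = {(P - 1) / P\<^sup>2 * Q - (P - 1 - real k) / P * s |k. k \<le> CARD('p) - 1} \<Longrightarrow>
      real (length ds) = n' \<and> real ` nonzero_weights C \<subseteq> insert v W"
    and "ramanujan_sum l m (adjusted_index \<beta>) = \<alpha> \<Longrightarrow> n' = Q / P - S * (s + 1) / (2 * M) + s \<Longrightarrow>
      v = s / P * (s - S * (s + 1) / (2 * M) + 1) \<Longrightarrow>
      W = {(P - 1) / P\<^sup>2 * Q + (P - 1 - real k) / P * s |k. k \<le> CARD('p) - 1} \<Longrightarrow>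
      real (length ds) = n' \<and> real ` nonzero_weights C \<subseteq> insert v W"
proof -
  note N = weights_nonzero[OF ds assms(1) C assms(2) kappa_less, folded reals(1,2), folded reals(3),
      unfolded kappa_real S]
  show "code_dim C = e"
    by (rule N(1))
  show "card (nonzero_weights C) \<le> CARD('p) + 1"
    by (rule N(3))
  show "real (length ds) = n' \<and> real ` nonzero_weights C \<subseteq> insert v W"
    if "ramanujan_sum l m (adjusted_index \<beta>) \<noteq> \<alpha>" "n' = Q / P - S * (s + 1) / (2 * M)"
      "v = s / P * (s - S * (s + 1) / (2 * M))"
      "W = {(P - 1) / P\<^sup>2 * Q - (P - 1 - real k) / P * s |k. k \<le> CARD('p) - 1}"
  proof -
    have "delta \<beta> = 0"
      using that(1) delta_eq[OF assms(2)] by simp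
    then show ?thesis
      using N(2) N(4) unfolding that(2-4) by simp
  qed
  show "real (length ds) = n' \<and> real ` nonzero_weights C \<subseteq> insert v W"
    if "ramanujan_sum l m (adjusted_index \<beta>) = \<alpha>" "n' = Q / P - S * (s + 1) / (2 * M) + s"
      "v = s / P * (s - S * (s + 1) / (2 * M) + 1)"
      "W = {(P - 1) / P\<^sup>2 * Q + (P - 1 - real k) / P * s |k. k \<le> CARD('p) - 1}"
  proof -
    have "delta \<beta> = 1"
      using that(1) delta_eq[OF assms(2)] by simp
    then show ?thesis
      using N(2) N(5) unfolding that(2-4) by simp
  qed
qed

lemma sigma_0_rule:
  assumes "set ds = D \<beta>" "\<beta> \<noteq> 0" "sigma = 0"
  shows "two_weight_code C \<and> real (length ds) = Q / P \<and>
    (let w1 = Q / P; w2 = (P - 1) * Q / P\<^sup>2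
     in w1 \<noteq> w2 \<and> real ` nonzero_weights C = {w1, w2} \<and>
        real (weight_count C w1) = P - 1 \<and> real (weight_count C w2) = Q - P)"
proof -
  have "kappa = 0"
    using assms(3) by (simp add: kappa_real)
  note Z = weights_kappa_0[OF ds assms(1) C assms(2) this, folded reals(1,2), folded reals(3)]
  show ?thesis
    unfolding Let_def two_weight_code_def
    using Z(2-6) card_of_real_image_eq_pair[OF Z(4,3)] by blast
qed

end

end

end

end

theorem theorem3p4:
  fixes p l m e q :: nat
    and \<alpha> a1 a2 a3 a4 :: "'p::prime_card mod_ring"
    and \<beta> g :: "'q::{field,finite}"
    and ds :: "'q list"
    and C :: "'p word set"
    and n P L M K Q s :: real
    and Wminus Wplus :: "real set"
    and j j' :: nat
  assumes p: "CARD('p) = p" "prime p" "odd p"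
    and l: "prime l" "odd l" "l \<noteq> p"
    and m: "m \<ge> 1"
    and primroot: "residue_primroot (2 * l ^ m) p"
    and e: "e = totient (2 * l ^ m)"
    and q: "q = p ^ e" "CARD('q) = q"
    and g: "primitive_element g"
    and ds: "distinct ds" "set ds = defining_set l m e \<alpha> \<beta>"
    and C: "C = code e ds"
    and n: "n = real (length ds)"
    and a1: "a1 = of_nat (l ^ (m - 1) * (l - 1)) - \<alpha>"
    and a2: "a2 = - of_nat (l ^ (m - 1) * (l - 1)) - \<alpha>"
    and a3: "a3 = of_nat (l ^ (m - 1)) - \<alpha>"
    and a4: "a4 = - of_nat (l ^ (m - 1)) - \<alpha>"
    and P: "P = real p"
    and L: "L = real l"
    and M: "M = real l ^ m"
    and K: "K = real l ^ (m - 1)"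
    and Q: "Q = real q"
    and s: "s = sqrt (real q)"
    and Wminus: "Wminus = {(P - 1) / P\<^sup>2 * Q - (P - 1 - real k) / P * s |k. k \<le> p - 1}"
    and Wplus: "Wplus = {(P - 1) / P\<^sup>2 * Q + (P - 1 - real k) / P * s |k. k \<le> p - 1}"
    and j: "j = j_index l m g \<beta>"
    and j': "j' = j_adj p e l m j"
  shows
    "(\<not> (\<alpha> \<noteq> 0 \<and> \<beta> = 0 \<and> a1 \<noteq> 0 \<and> a2 \<noteq> 0 \<and> a3 \<noteq> 0 \<and> a4 \<noteq> 0) \<and>
     \<not> (\<alpha> = 0 \<and> \<beta> = 0 \<and> m = 1 \<and> \<not> [l = 1] (mod p)) \<and>
     \<not> (\<beta> = 0 \<and> (p, l, m) = (5, 3, 1) \<and> (a1 = 0 \<or> a2 = 0)) \<longrightarrow>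
       code_dim C = (l - 1) * l ^ (m - 1)) \<and>
     (\<alpha> \<noteq> 0 \<and> \<beta> = 0 \<and> a1 \<noteq> 0 \<and> a2 \<noteq> 0 \<and> a3 \<noteq> 0 \<and> a4 \<noteq> 0 \<longrightarrow>
       defining_set l m e \<alpha> \<beta> = {}) \<and>
     (\<alpha> = 0 \<and> \<beta> = 0 \<longrightarrow>
       ([l = 1] (mod p) \<or> m \<ge> 2 \<longrightarrow> two_weight_code C) \<and>
       ([l = 1] (mod p) \<longrightarrow>
         n = (Q - 1) * (M - L + 1) / M \<and>
         (let w1 = (P - 1) / (P * M) * ((M - L + 1) * Q - (L - 1) * s);
              w2 = (P - 1) * (M - L + 1) / (P * M) * (Q + s)
          in w1 \<noteq> w2 \<and> real ` nonzero_weights C = {w1, w2} \<and>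
             weight_count C w1 = (Q - 1) * (M - L + 1) / M \<and>
             weight_count C w2 = (Q - 1) * (L - 1) / M)) \<and>
       (\<not> [l = 1] (mod p) \<and> m \<ge> 2 \<longrightarrow>
         n = (Q - 1) * (K - 1) / K \<and>
         (let w1 = (P - 1) * (K - 1) / (P * K) * (Q + s);
              w2 = (P - 1) / (P * K) * ((K - 1) * Q - s)
          in w1 \<noteq> w2 \<and> real ` nonzero_weights C = {w1, w2} \<and>
             weight_count C w1 = (Q - 1) / K \<and>
             weight_count C w2 = (Q - 1) * (K - 1) / K))) \<and>
     (\<alpha> \<noteq> 0 \<and> \<beta> = 0 \<longrightarrow>
       ((a1 = 0 \<or> a2 = 0 \<or> a3 = 0 \<or> a4 = 0) \<and>
        \<not> ((p, l, m) = (5, 3, 1) \<and> (a1 = 0 \<or> a2 = 0)) \<longrightarrow> two_weight_code C) \<and>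
       ((a1 = 0 \<or> a2 = 0) \<and> a3 \<noteq> 0 \<and> a4 \<noteq> 0 \<longrightarrow>
         n = (Q - 1) / (2 * M) \<and>
         ((p, l, m) \<noteq> (5, 3, 1) \<longrightarrow>
          (let w1 = (P - 1) / (2 * P * M) * (Q - (2 * M - 1) * s);
               w2 = (P - 1) / (2 * P * M) * (Q + s)
           in w1 \<noteq> w2 \<and> real ` nonzero_weights C = {w1, w2} \<and>
              weight_count C w1 = (Q - 1) / (2 * M) \<and>
              weight_count C w2 = (Q - 1) * (2 * M - 1) / (2 * M)))) \<and>
       ((a3 = 0 \<or> a4 = 0) \<and> a1 \<noteq> 0 \<and> a2 \<noteq> 0 \<longrightarrow>
         n = (Q - 1) * (L - 1) / (2 * M) \<and>
         (let w1 = (P - 1) * (L - 1) / (2 * P * M) * (Q + s);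
              w2 = (P - 1) / (2 * P * M) * ((L - 1) * Q - (2 * M - L + 1) * s)
          in w1 \<noteq> w2 \<and> real ` nonzero_weights C = {w1, w2} \<and>
             weight_count C w1 = (Q - 1) / (2 * M) * (2 * M - L + 1) \<and>
             weight_count C w2 = (Q - 1) * (L - 1) / (2 * M))) \<and>
       ((a1 = 0 \<and> a3 = 0 \<and> a2 \<noteq> 0 \<and> a4 \<noteq> 0) \<or> (a2 = 0 \<and> a4 = 0 \<and> a1 \<noteq> 0 \<and> a3 \<noteq> 0) \<longrightarrow>
         n = (Q - 1) / (2 * K) \<and>
         (let w1 = (P - 1) / (2 * P * K) * (Q - (2 * K - 1) * s);
              w2 = (P - 1) / (2 * P * K) * (Q + s)
          in w1 \<noteq> w2 \<and> real ` nonzero_weights C = {w1, w2} \<and>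
             weight_count C w1 = (Q - 1) / (2 * K) \<and>
             weight_count C w2 = (Q - 1) / (2 * K) * (2 * K - 1)))) \<and>
     (\<alpha> = 0 \<and> \<beta> \<noteq> 0 \<longrightarrow>
       card (nonzero_weights C) \<le> p + 1 \<and>
       ([l = 1] (mod p) \<and> j \<in> J1_2 l m \<union> J3_2 l m \<union> J1_3 l m \<union> J3_3 l m \<longrightarrow>
         n = Q / P - (s + 1) / M * (M - L + 1) \<and>
         real ` nonzero_weights C \<subseteq>
           insert (1 / (P * M) * ((L - 1) * Q - (M - L + 1) * s)) Wminus) \<and>
       ([l = 1] (mod p) \<and> j \<in> {0} \<union> J2 l m \<union> J1_1 l m \<union> J3_1 l m \<longrightarrow>
         n = (Q - P) / P + (s + 1) * (L - 1) / M \<and>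
         real ` nonzero_weights C \<subseteq>
           insert ((L - 1) / (P * M) * (Q + s)) Wplus) \<and>
       (\<not> [l = 1] (mod p) \<and> j \<in> {0, l ^ m} \<union> J1_2 l m \<union> J3_2 l m \<union> J1_3 l m \<union> J3_3 l m \<longrightarrow>
         n = Q / P + (s + 1) * (- K + 1) / K \<and>
         real ` nonzero_weights C \<subseteq>
           insert (1 / (P * K) * Q + (1 - K) / (P * K) * s) Wminus) \<and>
       (\<not> [l = 1] (mod p) \<and> j \<in> (J2 l m - {l ^ m}) \<union> J1_1 l m \<union> J3_1 l m \<longrightarrow>
         n = Q / P + (s + 1) / K - 1 \<and>
         real ` nonzero_weights C \<subseteq>
           insert (1 / (P * K) * (Q + s)) Wplus)) \<and>
     (\<alpha> \<noteq> 0 \<and> \<beta> \<noteq> 0 \<and> a1 \<noteq> 0 \<and> a2 \<noteq> 0 \<and> a3 \<noteq> 0 \<and> a4 \<noteq> 0 \<longrightarrow>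
       two_weight_code C \<and>
       n = Q / P \<and>
       (let w1 = Q / P; w2 = (P - 1) * Q / P\<^sup>2
        in w1 \<noteq> w2 \<and> real ` nonzero_weights C = {w1, w2} \<and>
           weight_count C w1 = P - 1 \<and>
           weight_count C w2 = Q - P)) \<and>
     (\<alpha> \<noteq> 0 \<and> \<beta> \<noteq> 0 \<and> \<not> (a1 \<noteq> 0 \<and> a2 \<noteq> 0 \<and> a3 \<noteq> 0 \<and> a4 \<noteq> 0) \<longrightarrow>
       card (nonzero_weights C) \<le> p + 1 \<and>
       ((a1 = 0 \<or> a2 = 0) \<and> a3 \<noteq> 0 \<and> a4 \<noteq> 0 \<longrightarrow>
         ((a1 = 0 \<and> j' = 0) \<or> (a2 = 0 \<and> j' = l ^ m) \<longrightarrow>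
           n = (Q - P) / P + (s + 1) * (2 * M - 1) / (2 * M) \<and>
           real ` nonzero_weights C \<subseteq>
             insert ((2 * M - 1) / (2 * P * M) * (Q + s)) Wplus) \<and>
         ((a1 = 0 \<and> j' \<noteq> 0) \<or> (a2 = 0 \<and> j' \<noteq> l ^ m) \<longrightarrow>
           n = Q / P - (s + 1) / (2 * M) \<and>
           real ` nonzero_weights C \<subseteq>
             insert ((2 * M - 1) / (2 * P * M) * Q - 1 / (2 * P * M) * s) Wminus)) \<and>
       ((a3 = 0 \<or> a4 = 0) \<and> a1 \<noteq> 0 \<and> a2 \<noteq> 0 \<longrightarrow>
         ((a3 = 0 \<and> j' \<notin> J1_2 l m \<union> J3_2 l m) \<or> (a4 = 0 \<and> j' \<notin> J1_3 l m \<union> J3_3 l m) \<longrightarrow>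
           n = Q / P - (s + 1) * (L - 1) / (2 * M) \<and>
           real ` nonzero_weights C \<subseteq>
             insert ((2 * M - L + 1) / (2 * P * M) * Q - (L - 1) / (2 * P * M) * s) Wminus) \<and>
         ((a3 = 0 \<and> j' \<in> J1_2 l m \<union> J3_2 l m) \<or> (a4 = 0 \<and> j' \<in> J1_3 l m \<union> J3_3 l m) \<longrightarrow>
           n = (Q - P) / P + (s + 1) * (2 * M - L + 1) / (2 * M) \<and>
           real ` nonzero_weights C \<subseteq>
             insert ((2 * M - L + 1) / (2 * P * M) * (Q + s)) Wplus)) \<and>
       ((a1 = 0 \<and> a3 = 0 \<and> a2 \<noteq> 0 \<and> a4 \<noteq> 0) \<or> (a2 = 0 \<and> a4 = 0 \<and> a1 \<noteq> 0 \<and> a3 \<noteq> 0) \<longrightarrow>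
         ((a1 = 0 \<and> a3 = 0 \<and> j' \<in> {0} \<union> J1_2 l m \<union> J3_2 l m) \<or>
          (a2 = 0 \<and> a4 = 0 \<and> j' \<in> {l ^ m} \<union> J1_3 l m \<union> J3_3 l m) \<longrightarrow>
           n = (Q - P) / P + (s + 1) * (2 * K - 1) / (2 * K) \<and>
           real ` nonzero_weights C \<subseteq>
             insert ((2 * K - 1) / (2 * P * K) * (Q + s)) Wplus) \<and>
         ((a1 = 0 \<and> a3 = 0 \<and> j' \<notin> {0} \<union> J1_2 l m \<union> J3_2 l m) \<or>
          (a2 = 0 \<and> a4 = 0 \<and> j' \<notin> {l ^ m} \<union> J1_3 l m \<union> J3_3 l m) \<longrightarrow>
           n = Q / P - (s + 1) / (2 * K) \<and>
           real ` nonzero_weights C \<subseteq>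
             insert ((2 * K - 1) / (2 * P * K) * Q - 1 / (2 * P * K) * s) Wminus)))"
proof -
  have cp: "CARD('p) = p"
    by (rule p(1))
  obtain h where h: "e = 2 * h" "2 * l ^ m dvd p ^ h + 1"
    using primroot_half_power[OF l(1,2) m primroot e] by blast
  define r where "r = p ^ h"
  interpret I: index_code "field_trace e :: 'q \<Rightarrow> 'p mod_ring" e l m h r g \<alpha>
    by unfold_locales (use l m primroot e g q h in \<open>auto simp: cp r_def\<close>)
  define k where "k = l ^ (m - 1)"
  define A where "A = (of_nat (k * (l - 1)) :: 'p mod_ring)"
  define B where "B = (of_nat k :: 'p mod_ring)"
  have op: "odd CARD('p)" "l \<noteq> CARD('p)"
    using p(3) l(3) by (simp_all add: cp)
  note ctx = op k_def A_def B_def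
  have a: "a1 = 0 \<longleftrightarrow> A = \<alpha>" "a2 = 0 \<longleftrightarrow> - A = \<alpha>" "a3 = 0 \<longleftrightarrow> B = \<alpha>" "a4 = 0 \<longleftrightarrow> - B = \<alpha>"
    by (simp_all only: a1 a2 a3 a4 A_def B_def k_def right_minus_eq)
  have adjusted_index: "j' = I.adjusted_index \<beta>"
    by (simp add: I.adjusted_index_def j' j cp)
  have setD: "set ds = I.D \<beta>"
    by (simp only: ds(2) I.D_eq)
  have q2: "q = r\<^sup>2"
    by (simp add: q(1) h(1) r_def power_even_eq)
  have sr: "s = real r"
    by (simp add: s q2)
  have Qs: "Q = s\<^sup>2"
    by (simp add: Q q2 sr)
  have P': "P = real CARD('p)"
    by (simp add: P cp)
  note reals = P' sr Qs M
  have lk: "l ^ m = l * l ^ (m - 1)"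
    by (rule power_l_eq[OF l(1,2) m refl])
  have l3: "l \<ge> 3"
    by (rule l_ge_3[OF l(1,2) m refl])
  have lM: "l \<le> l ^ m"
    by (rule I.l_le_power[OF ctx])
  have LK: "M = L * K" "L \<ge> 3" "K > 0"
    using l3 by (simp_all add: M L K lk flip: of_nat_power of_nat_mult)
  note pos = I.P_gt_1[OF ctx reals] I.s_gt_1[OF ctx reals] I.M_pos[OF ctx reals]
  note zero = I.zero_rule[OF ctx reals ds(1) C]
  note nonzero = I.nonzero_rule[OF ctx reals ds(1) C setD]
  note sigma = I.sigma_eq[OF ctx]
  note excl = I.exclusive[OF ctx]
  have cong: "[l = 1] (mod p) \<longleftrightarrow> A = 0"
    using I.A_eq_0[OF ctx] by (simp add: cp)
  have B0: "B \<noteq> 0"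
    by (rule I.B_nonzero[OF ctx])
  have e': "e = (l - 1) * l ^ (m - 1)"
    using totient_double_odd_prime_power[OF l(1,2) m] by (simp add: e)
  have W: "Wminus = {(P - 1) / P\<^sup>2 * Q - (P - 1 - real k) / P * s |k. k \<le> CARD('p) - 1}"
    "Wplus = {(P - 1) / P\<^sup>2 * Q + (P - 1 - real k) / P * s |k. k \<le> CARD('p) - 1}"
    by (simp_all only: Wminus Wplus cp)

  \<comment> \<open>The number of classes carrying the value \<open>\<alpha>\<close>, case by case;
    divided by \<open>2 * l ^ m\<close>, these numbers are the source of the coefficients in the
    formulas below.\<close>
  have sig_c: "I.sigma = 2 + (2 * l ^ m - 2 * l)" if "\<alpha> = 0" "A = 0"
    unfolding sigma using that B0 by simp
  have sig_nc: "I.sigma = 2 * l ^ m - 2 * l" if "\<alpha> = 0" "A \<noteq> 0"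
    unfolding sigma using that B0 by simp
  have sig_1: "I.sigma = 1" if "\<alpha> \<noteq> 0" "a1 = 0 \<or> a2 = 0" "a3 \<noteq> 0" "a4 \<noteq> 0"
    unfolding sigma using that excl unfolding a by auto
  have sig_2: "I.sigma = l - 1" if "\<alpha> \<noteq> 0" "a3 = 0 \<or> a4 = 0" "a1 \<noteq> 0" "a2 \<noteq> 0"
    unfolding sigma using that excl unfolding a by auto
  have sig_3: "I.sigma = l"
    if "\<alpha> \<noteq> 0" "(a1 = 0 \<and> a3 = 0 \<and> a2 \<noteq> 0 \<and> a4 \<noteq> 0) \<or> (a2 = 0 \<and> a4 = 0 \<and> a1 \<noteq> 0 \<and> a3 \<noteq> 0)"
    unfolding sigma using that l3 unfolding a by auto
  have sig_0: "I.sigma = 0" if "\<alpha> \<noteq> 0" "a1 \<noteq> 0" "a2 \<noteq> 0" "a3 \<noteq> 0" "a4 \<noteq> 0"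
    unfolding sigma using that unfolding a by auto
  have real_lM: "real (2 * l ^ m - 2 * l) = 2 * M - 2 * L"
    using lM by (simp add: of_nat_diff M L)
  have S_c: "real I.sigma = 2 * M - 2 * L + 2" if "\<alpha> = 0" "A = 0"
    using sig_c[OF that] real_lM by simp
  have S_nc: "real I.sigma = 2 * M - 2 * L" if "\<alpha> = 0" "A \<noteq> 0"
    using sig_nc[OF that] real_lM by simp
  have S_2: "real (l - 1) = L - 1"
    using l3 by (simp add: L of_nat_diff)
  \<comment> \<open>For two or more classes the bound \<open>2 * l ^ m \<le> r + 1\<close> already
    excludes \<open>kappa = 1\<close>, without the exponential equation.\<close>
  have ne2: "I.sigma * (r + 1) \<noteq> 2 * l ^ m" if "I.sigma \<ge> 2"
  proof
    assume eq: "I.sigma * (r + 1) = 2 * l ^ m"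
    have "2 * (r + 1) \<le> I.sigma * (r + 1)"
      using that by (rule mult_le_mono1)
    also have "\<dots> \<le> r + 1"
      unfolding eq by (rule I.r_ge[OF ctx])
    finally show False
      by simp
  qed
  \<comment> \<open>For \<open>m = 1\<close> this number is 0, the source of the degenerate case
    with an empty defining set.\<close>
  have m2: "2 * l ^ m - 2 * l \<ge> 2" if "m \<ge> 2"
  proof -
    have "l ^ 2 \<le> l ^ m"
      using that l3 by (intro power_increasing) auto
    moreover have "3 * l \<le> l ^ 2"
      using l3 by (simp add: power2_eq_square)
    ultimately show ?thesis
      using l3 by linarith
  qed
  have sig_pos: "I.sigma > 0"
    if "\<not> (\<alpha> \<noteq> 0 \<and> a1 \<noteq> 0 \<and> a2 \<noteq> 0 \<and> a3 \<noteq> 0 \<and> a4 \<noteq> 0)"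
      "\<not> (\<alpha> = 0 \<and> m = 1 \<and> \<not> [l = 1] (mod p))"
  proof (cases "\<alpha> = 0")
    case True
    then show ?thesis
      using that(2) sig_c sig_nc m2 m unfolding cong by (cases "A = 0"; cases "m = 1") auto
  next
    case False
    then show ?thesis
      using that(1) l3 unfolding sigma a by auto
  qed
  have nonexc: "I.sigma * (r + 1) \<noteq> 2 * l ^ m"
    if "I.sigma > 0" "\<not> ((p, l, m) = (5, 3, 1) \<and> (a1 = 0 \<or> a2 = 0))"
    using I.sigma_nonexceptional[OF ctx that(1)] that(2) unfolding a cp by blast
  have j_less: "j < 2 * l ^ m" "j' < 2 * l ^ m"
    unfolding j adjusted_index by (rule I.j_index_less, rule I.adjusted_index_less)
  have J_odd': "odd_class l k = J1_2 l m \<union> J3_2 l m" and J_even': "even_class l k = J1_3 l m \<union> J3_3 l m"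
    using J_odd[OF l(1,2) m k_def] J_even[OF l(1,2) m k_def] by simp_all
  have ram_j': "ramanujan_sum l m (I.adjusted_index \<beta>) = \<alpha> \<longleftrightarrow>
      a1 = 0 \<and> j' = 0 \<or> a2 = 0 \<and> j' = l ^ m \<or>
      a3 = 0 \<and> j' \<in> J1_2 l m \<union> J3_2 l m \<or> a4 = 0 \<and> j' \<in> J1_3 l m \<union> J3_3 l m" if "\<alpha> \<noteq> 0"
    using I.ramanujan_sum_eq_iff[OF ctx that j_less(2)] unfolding a J_odd' J_even' adjusted_index .
  have ram_j: "ramanujan_sum l m (I.adjusted_index \<beta>) = \<alpha> \<longleftrightarrow> ramanujan_sum l m j = (0 :: 'p mod_ring)" if "\<alpha> = 0"
    using I.ramanujan_sum_adjusted_index[of \<beta>] unfolding that j .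
  note class_values = ramanujan_sum_0[OF l(1,2) m k_def, where ?'a = "'p mod_ring", folded A_def]
    ramanujan_sum_half[OF l(1,2) m k_def, where ?'a = "'p mod_ring", folded A_def]
    ramanujan_sum_odd[OF l(1,2) m k_def, where ?'a = "'p mod_ring", folded B_def, unfolded J_odd']
    ramanujan_sum_even[OF l(1,2) m k_def, where ?'a = "'p mod_ring", folded B_def, unfolded J_even']
    ramanujan_sum_rest[OF l(1,2) m k_def, where ?'a = "'p mod_ring"]
  have ram_OE: "ramanujan_sum l m j \<noteq> (0 :: 'p mod_ring)"
    if "j \<in> J1_2 l m \<union> J3_2 l m \<union> J1_3 l m \<union> J3_3 l m"
  proof -
    from that have "j \<in> J1_2 l m \<union> J3_2 l m \<or> j \<in> J1_3 l m \<union> J3_3 l m"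
      by blast
    then show ?thesis
      using class_values(3,4)[of j] B0 by (metis neg_equal_0_iff_equal)
  qed
  have ram_rest': "ramanujan_sum l m j = (0 :: 'p mod_ring)" if "j \<in> (J2 l m - {l ^ m}) \<union> J1_1 l m \<union> J3_1 l m"
    by (rule class_values(5), rule J_rest[OF l(1,2) m k_def that j_less(1)])
  \<comment> \<open>The length formula holds whether or not the weights vanish, so it also covers
    the empty set and the triple (5, 3, 1).\<close>
  have len0: "n = real I.sigma * (Q - 1) / (2 * M)" if "\<beta> = 0"
  proof -
    have "n = I.kappa * (s - 1)"
      using I.length_ds[OF ds(1) setD C] I.card_D_0 unfolding that n sr by simp
    then show ?thesis
      using pos by (simp add: I.kappa_real[OF ctx reals] Qs field_simps power2_eq_square)
  qed

  \<comment> \<open>Dimension and the individual cases\<close>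
  have dim: "code_dim C = (l - 1) * l ^ (m - 1)"
    if "\<not> (\<alpha> \<noteq> 0 \<and> \<beta> = 0 \<and> a1 \<noteq> 0 \<and> a2 \<noteq> 0 \<and> a3 \<noteq> 0 \<and> a4 \<noteq> 0)"
      "\<not> (\<alpha> = 0 \<and> \<beta> = 0 \<and> m = 1 \<and> \<not> [l = 1] (mod p))"
      "\<not> (\<beta> = 0 \<and> (p, l, m) = (5, 3, 1) \<and> (a1 = 0 \<or> a2 = 0))"
  proof (cases "\<beta> = 0")
    case True
    have *: "I.sigma > 0"
      by (rule sig_pos) (use that True in auto)
    have "I.sigma * (r + 1) \<noteq> 2 * l ^ m"
      by (rule nonexc[OF *]) (use that True in auto)
    from zero(1)[OF setD[unfolded True] * this refl refl refl refl refl refl] show ?thesis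
      by (simp only: e')
  next
    case False
    from nonzero(1)[OF this refl] show ?thesis
      by (simp only: e')
  qed

  have empty: "defining_set l m e \<alpha> \<beta> = {}"
    if "\<alpha> \<noteq> 0" "\<beta> = 0" "a1 \<noteq> 0" "a2 \<noteq> 0" "a3 \<noteq> 0" "a4 \<noteq> 0"
    using len0[OF that(2)] sig_0[OF that(1,3-6)] by (simp add: n flip: ds(2))

  have a_two: "two_weight_code C" if "\<alpha> = 0" "\<beta> = 0" "[l = 1] (mod p) \<or> m \<ge> 2"
  proof -
    have *: "I.sigma \<ge> 2"
      using sig_c[OF that(1)] sig_nc[OF that(1)] that(3) m2 unfolding cong by (cases "A = 0") auto
    then show ?thesis
      by (intro zero(4)[OF setD[unfolded that(2)] _ ne2[OF *] refl refl refl refl refl refl]) simp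
  qed

  have a_i: "n = (Q - 1) * (M - L + 1) / M \<and>
         (let w1 = (P - 1) / (P * M) * ((M - L + 1) * Q - (L - 1) * s);
              w2 = (P - 1) * (M - L + 1) / (P * M) * (Q + s)
          in w1 \<noteq> w2 \<and> real ` nonzero_weights C = {w1, w2} \<and>
             weight_count C w1 = (Q - 1) * (M - L + 1) / M \<and>
             weight_count C w2 = (Q - 1) * (L - 1) / M)"
    if "\<alpha> = 0" "\<beta> = 0" "[l = 1] (mod p)"
  proof -
    have A0: "A = 0"
      using that(3) unfolding cong .
    have *: "I.sigma \<ge> 2"
      using sig_c[OF that(1) A0] by simp
    then have **: "I.sigma > 0"
      by simp
    show ?thesis
      unfolding n
      by (rule zero(3)[OF setD[unfolded that(2)] ** ne2[OF *] S_c[OF that(1) A0]])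
        (use pos in \<open>simp_all add: field_simps\<close>)
  qed

  have a_ii: "n = (Q - 1) * (K - 1) / K \<and>
         (let w1 = (P - 1) * (K - 1) / (P * K) * (Q + s);
              w2 = (P - 1) / (P * K) * ((K - 1) * Q - s)
          in w1 \<noteq> w2 \<and> real ` nonzero_weights C = {w1, w2} \<and>
             weight_count C w1 = (Q - 1) / K \<and>
             weight_count C w2 = (Q - 1) * (K - 1) / K)"
    if "\<alpha> = 0" "\<beta> = 0" "\<not> [l = 1] (mod p)" "m \<ge> 2"
  proof -
    have A0: "A \<noteq> 0"
      using that(3) unfolding cong .
    have *: "I.sigma \<ge> 2"
      using sig_nc[OF that(1) A0] m2[OF that(4)] by simp
    then have **: "I.sigma > 0"
      by simp
    show ?thesis
      unfolding n
      by (rule zero(2)[OF setD[unfolded that(2)] ** ne2[OF *] S_nc[OF that(1) A0]])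
        (use pos LK in \<open>simp_all add: field_simps\<close>)
  qed

  have b_two: "two_weight_code C"
    if "\<alpha> \<noteq> 0" "\<beta> = 0" "a1 = 0 \<or> a2 = 0 \<or> a3 = 0 \<or> a4 = 0"
      "\<not> ((p, l, m) = (5, 3, 1) \<and> (a1 = 0 \<or> a2 = 0))"
  proof -
    have *: "I.sigma > 0"
      by (rule sig_pos) (use that in auto)
    show ?thesis
      by (rule zero(4)[OF setD[unfolded that(2)] * nonexc[OF * that(4)] refl refl refl refl refl refl])
  qed

  have b_i_len: "n = (Q - 1) / (2 * M)"
    if "\<alpha> \<noteq> 0" "\<beta> = 0" "a1 = 0 \<or> a2 = 0" "a3 \<noteq> 0" "a4 \<noteq> 0"
    using len0[OF that(2)] sig_1[OF that(1,3-5)] by simp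

  have b_i: "n = (Q - 1) / (2 * M) \<and>
          (let w1 = (P - 1) / (2 * P * M) * (Q - (2 * M - 1) * s);
               w2 = (P - 1) / (2 * P * M) * (Q + s)
           in w1 \<noteq> w2 \<and> real ` nonzero_weights C = {w1, w2} \<and>
              weight_count C w1 = (Q - 1) / (2 * M) \<and>
              weight_count C w2 = (Q - 1) * (2 * M - 1) / (2 * M))"
    if "\<alpha> \<noteq> 0" "\<beta> = 0" "a1 = 0 \<or> a2 = 0" "a3 \<noteq> 0" "a4 \<noteq> 0" "(p, l, m) \<noteq> (5, 3, 1)"
  proof -
    have S: "I.sigma = 1"
      by (rule sig_1[OF that(1,3-5)])
    then have *: "I.sigma > 0" and S': "real I.sigma = 1"
      by simp_all
    have **: "I.sigma * (r + 1) \<noteq> 2 * l ^ m"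
      by (rule nonexc[OF *]) (use that(6) in blast)
    show ?thesis
      unfolding n
      by (rule zero(3)[OF setD[unfolded that(2)] * ** S'])
        (use pos in \<open>simp_all add: field_simps\<close>)
  qed

  have b_ii: "n = (Q - 1) * (L - 1) / (2 * M) \<and>
         (let w1 = (P - 1) * (L - 1) / (2 * P * M) * (Q + s);
              w2 = (P - 1) / (2 * P * M) * ((L - 1) * Q - (2 * M - L + 1) * s)
          in w1 \<noteq> w2 \<and> real ` nonzero_weights C = {w1, w2} \<and>
             weight_count C w1 = (Q - 1) / (2 * M) * (2 * M - L + 1) \<and>
             weight_count C w2 = (Q - 1) * (L - 1) / (2 * M))"
    if "\<alpha> \<noteq> 0" "\<beta> = 0" "a3 = 0 \<or> a4 = 0" "a1 \<noteq> 0" "a2 \<noteq> 0"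
  proof -
    have S: "I.sigma = l - 1"
      by (rule sig_2[OF that(1,3-5)])
    then have *: "I.sigma \<ge> 2" and S': "real I.sigma = L - 1"
      using l3 S_2 by simp_all
    then have **: "I.sigma > 0"
      by simp
    show ?thesis
      unfolding n
      by (rule zero(2)[OF setD[unfolded that(2)] ** ne2[OF *] S'])
        (use pos in \<open>simp_all add: field_simps\<close>)
  qed

  have b_iii: "n = (Q - 1) / (2 * K) \<and>
         (let w1 = (P - 1) / (2 * P * K) * (Q - (2 * K - 1) * s);
              w2 = (P - 1) / (2 * P * K) * (Q + s)
          in w1 \<noteq> w2 \<and> real ` nonzero_weights C = {w1, w2} \<and>
             weight_count C w1 = (Q - 1) / (2 * K) \<and>
             weight_count C w2 = (Q - 1) / (2 * K) * (2 * K - 1))"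
    if "\<alpha> \<noteq> 0" "\<beta> = 0"
      "(a1 = 0 \<and> a3 = 0 \<and> a2 \<noteq> 0 \<and> a4 \<noteq> 0) \<or> (a2 = 0 \<and> a4 = 0 \<and> a1 \<noteq> 0 \<and> a3 \<noteq> 0)"
  proof -
    have S: "I.sigma = l"
      by (rule sig_3[OF that(1,3)])
    then have *: "I.sigma \<ge> 2" and S': "real I.sigma = L"
      using l3 by (simp_all add: L)
    then have **: "I.sigma > 0"
      by simp
    show ?thesis
      unfolding n
      by (rule zero(3)[OF setD[unfolded that(2)] ** ne2[OF *] S'])
        (use pos LK in \<open>simp_all add: field_simps\<close>)
  qed

  have cd_card: "card (nonzero_weights C) \<le> p + 1" if "\<beta> \<noteq> 0"
    using nonzero(2)[OF that refl] by (simp only: cp)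

  have c_i: "n = Q / P - (s + 1) / M * (M - L + 1) \<and>
         real ` nonzero_weights C \<subseteq>
           insert (1 / (P * M) * ((L - 1) * Q - (M - L + 1) * s)) Wminus"
    if "\<alpha> = 0" "\<beta> \<noteq> 0" "[l = 1] (mod p)" "j \<in> J1_2 l m \<union> J3_2 l m \<union> J1_3 l m \<union> J3_3 l m"
    unfolding n
    by (rule nonzero(3)[OF that(2) S_c[OF that(1) that(3)[unfolded cong]] _ _ _ W(1)])
      (use pos ram_j[OF that(1)] ram_OE[OF that(4)] in \<open>simp_all add: Qs field_simps power2_eq_square\<close>)

  have c_ii: "n = (Q - P) / P + (s + 1) * (L - 1) / M \<and>
         real ` nonzero_weights C \<subseteq>
           insert ((L - 1) / (P * M) * (Q + s)) Wplus"
    if "\<alpha> = 0" "\<beta> \<noteq> 0" "[l = 1] (mod p)" "j \<in> {0} \<union> J2 l m \<union> J1_1 l m \<union> J3_1 l m"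
  proof -
    have A0: "A = 0"
      using that(3) unfolding cong .
    \<comment> \<open>\<open>l ^ m\<close> lies in \<open>J2\<close>; the traces at 0 and at
      \<open>l ^ m\<close> are \<open>A\<close> and \<open>- A\<close>, which vanish here.\<close>
    have "j = 0 \<or> j = l ^ m \<or> j \<in> (J2 l m - {l ^ m}) \<union> J1_1 l m \<union> J3_1 l m"
      using that(4) by blast
    then have "ramanujan_sum l m j = (0 :: 'p mod_ring)"
      using class_values(1,2) ram_rest' A0 by (metis neg_equal_0_iff_equal)
    then have "ramanujan_sum l m (I.adjusted_index \<beta>) = \<alpha>"
      using ram_j[OF that(1)] by blast
    then show ?thesis
      unfolding n
      by (rule nonzero(4)[OF that(2) S_c[OF that(1) A0] _ _ _ W(2)])
        (use pos in \<open>simp_all add: Qs field_simps power2_eq_square\<close>)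
  qed

  have c_iii: "n = Q / P + (s + 1) * (- K + 1) / K \<and>
         real ` nonzero_weights C \<subseteq>
           insert (1 / (P * K) * Q + (1 - K) / (P * K) * s) Wminus"
    if "\<alpha> = 0" "\<beta> \<noteq> 0" "\<not> [l = 1] (mod p)"
      "j \<in> {0, l ^ m} \<union> J1_2 l m \<union> J3_2 l m \<union> J1_3 l m \<union> J3_3 l m"
  proof -
    \<comment> \<open>Now the traces at 0 and \<open>l ^ m\<close> are nonzero, which moves these
      two indices to the other side of the dichotomy.\<close>
    have A0: "A \<noteq> 0"
      using that(3) unfolding cong .
    have "j = 0 \<or> j = l ^ m \<or> j \<in> J1_2 l m \<union> J3_2 l m \<union> J1_3 l m \<union> J3_3 l m"
      using that(4) by blast
    then have "ramanujan_sum l m j \<noteq> (0 :: 'p mod_ring)"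
      using class_values(1,2) ram_OE A0 by (metis neg_equal_0_iff_equal)
    then have "ramanujan_sum l m (I.adjusted_index \<beta>) \<noteq> \<alpha>"
      using ram_j[OF that(1)] by blast
    then show ?thesis
      unfolding n
      by (rule nonzero(3)[OF that(2) S_nc[OF that(1) A0] _ _ _ W(1)])
        (use pos LK in \<open>simp_all add: Qs field_simps power2_eq_square\<close>)
  qed

  have c_iv: "n = Q / P + (s + 1) / K - 1 \<and>
         real ` nonzero_weights C \<subseteq>
           insert (1 / (P * K) * (Q + s)) Wplus"
    if "\<alpha> = 0" "\<beta> \<noteq> 0" "\<not> [l = 1] (mod p)" "j \<in> (J2 l m - {l ^ m}) \<union> J1_1 l m \<union> J3_1 l m"
  proof -
    have A0: "A \<noteq> 0"
      using that(3) unfolding cong .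
    have "ramanujan_sum l m (I.adjusted_index \<beta>) = \<alpha>"
      using ram_j[OF that(1)] ram_rest'[OF that(4)] by blast
    then show ?thesis
      unfolding n
      by (rule nonzero(4)[OF that(2) S_nc[OF that(1) A0] _ _ _ W(2)])
        (use pos LK in \<open>simp_all add: Qs field_simps power2_eq_square\<close>)
  qed

  have d_0: "two_weight_code C \<and>
       n = Q / P \<and>
       (let w1 = Q / P; w2 = (P - 1) * Q / P\<^sup>2
        in w1 \<noteq> w2 \<and> real ` nonzero_weights C = {w1, w2} \<and>
           weight_count C w1 = P - 1 \<and>
           weight_count C w2 = Q - P)"
    if "\<alpha> \<noteq> 0" "\<beta> \<noteq> 0" "a1 \<noteq> 0" "a2 \<noteq> 0" "a3 \<noteq> 0" "a4 \<noteq> 0"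
    unfolding n by (rule I.sigma_0_rule[OF ctx reals ds(1) C setD that(2) sig_0[OF that(1,3-6)]])

  have d_i: "((a1 = 0 \<and> j' = 0) \<or> (a2 = 0 \<and> j' = l ^ m) \<longrightarrow>
           n = (Q - P) / P + (s + 1) * (2 * M - 1) / (2 * M) \<and>
           real ` nonzero_weights C \<subseteq>
             insert ((2 * M - 1) / (2 * P * M) * (Q + s)) Wplus) \<and>
         ((a1 = 0 \<and> j' \<noteq> 0) \<or> (a2 = 0 \<and> j' \<noteq> l ^ m) \<longrightarrow>
           n = Q / P - (s + 1) / (2 * M) \<and>
           real ` nonzero_weights C \<subseteq>
             insert ((2 * M - 1) / (2 * P * M) * Q - 1 / (2 * P * M) * s) Wminus)"
    if "\<alpha> \<noteq> 0" "\<beta> \<noteq> 0" "a1 = 0 \<or> a2 = 0" "a3 \<noteq> 0" "a4 \<noteq> 0"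
  proof (rule conjI; rule impI)
    have S: "real I.sigma = 1"
      using sig_1[OF that(1,3-5)] by simp
    \<comment> \<open>With at most one of \<open>a1\<close>, \<open>a2\<close> zero, the two
      hypotheses below are complementary, and the second refutes every disjunct of
      \<open>ram_j'\<close>.\<close>
    have ex: "\<not> (a1 = 0 \<and> a2 = 0)"
      using excl(1)[OF that(1)] unfolding a .
    show "n = (Q - P) / P + (s + 1) * (2 * M - 1) / (2 * M) \<and>
           real ` nonzero_weights C \<subseteq> insert ((2 * M - 1) / (2 * P * M) * (Q + s)) Wplus"
      if "(a1 = 0 \<and> j' = 0) \<or> (a2 = 0 \<and> j' = l ^ m)"
    proof -
      have "ramanujan_sum l m (I.adjusted_index \<beta>) = \<alpha>"
        using that ram_j'[OF \<open>\<alpha> \<noteq> 0\<close>] by blast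
      then show ?thesis
        unfolding n
        by (rule nonzero(4)[OF \<open>\<beta> \<noteq> 0\<close> S _ _ _ W(2)])
          (use pos in \<open>simp_all add: Qs field_simps power2_eq_square\<close>)
    qed
    show "n = Q / P - (s + 1) / (2 * M) \<and>
           real ` nonzero_weights C \<subseteq>
             insert ((2 * M - 1) / (2 * P * M) * Q - 1 / (2 * P * M) * s) Wminus"
      if "(a1 = 0 \<and> j' \<noteq> 0) \<or> (a2 = 0 \<and> j' \<noteq> l ^ m)"
    proof -
      have "ramanujan_sum l m (I.adjusted_index \<beta>) \<noteq> \<alpha>"
        using that ram_j'[OF \<open>\<alpha> \<noteq> 0\<close>] ex \<open>a3 \<noteq> 0\<close> \<open>a4 \<noteq> 0\<close> by blast
      then show ?thesis
        unfolding n
        by (rule nonzero(3)[OF \<open>\<beta> \<noteq> 0\<close> S _ _ _ W(1)])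
          (use pos in \<open>simp_all add: Qs field_simps power2_eq_square\<close>)
    qed
  qed

  have d_ii: "((a3 = 0 \<and> j' \<notin> J1_2 l m \<union> J3_2 l m) \<or> (a4 = 0 \<and> j' \<notin> J1_3 l m \<union> J3_3 l m) \<longrightarrow>
           n = Q / P - (s + 1) * (L - 1) / (2 * M) \<and>
           real ` nonzero_weights C \<subseteq>
             insert ((2 * M - L + 1) / (2 * P * M) * Q - (L - 1) / (2 * P * M) * s) Wminus) \<and>
         ((a3 = 0 \<and> j' \<in> J1_2 l m \<union> J3_2 l m) \<or> (a4 = 0 \<and> j' \<in> J1_3 l m \<union> J3_3 l m) \<longrightarrow>
           n = (Q - P) / P + (s + 1) * (2 * M - L + 1) / (2 * M) \<and>
           real ` nonzero_weights C \<subseteq>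
             insert ((2 * M - L + 1) / (2 * P * M) * (Q + s)) Wplus)"
    if "\<alpha> \<noteq> 0" "\<beta> \<noteq> 0" "a3 = 0 \<or> a4 = 0" "a1 \<noteq> 0" "a2 \<noteq> 0"
  proof (rule conjI; rule impI)
    have S: "real I.sigma = L - 1"
      using sig_2[OF that(1,3-5)] S_2 by simp
    have ex: "\<not> (a3 = 0 \<and> a4 = 0)"
      using excl(2)[OF that(1)] unfolding a .
    show "n = Q / P - (s + 1) * (L - 1) / (2 * M) \<and>
           real ` nonzero_weights C \<subseteq>
             insert ((2 * M - L + 1) / (2 * P * M) * Q - (L - 1) / (2 * P * M) * s) Wminus"
      if "(a3 = 0 \<and> j' \<notin> J1_2 l m \<union> J3_2 l m) \<or> (a4 = 0 \<and> j' \<notin> J1_3 l m \<union> J3_3 l m)"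
    proof -
      have "ramanujan_sum l m (I.adjusted_index \<beta>) \<noteq> \<alpha>"
        using that ram_j'[OF \<open>\<alpha> \<noteq> 0\<close>] ex \<open>a1 \<noteq> 0\<close> \<open>a2 \<noteq> 0\<close> by blast
      then show ?thesis
        unfolding n
        by (rule nonzero(3)[OF \<open>\<beta> \<noteq> 0\<close> S _ _ _ W(1)])
          (use pos in \<open>simp_all add: Qs field_simps power2_eq_square\<close>)
    qed
    show "n = (Q - P) / P + (s + 1) * (2 * M - L + 1) / (2 * M) \<and>
           real ` nonzero_weights C \<subseteq> insert ((2 * M - L + 1) / (2 * P * M) * (Q + s)) Wplus"
      if "(a3 = 0 \<and> j' \<in> J1_2 l m \<union> J3_2 l m) \<or> (a4 = 0 \<and> j' \<in> J1_3 l m \<union> J3_3 l m)"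
    proof -
      have "ramanujan_sum l m (I.adjusted_index \<beta>) = \<alpha>"
        using that ram_j'[OF \<open>\<alpha> \<noteq> 0\<close>] by blast
      then show ?thesis
        unfolding n
        by (rule nonzero(4)[OF \<open>\<beta> \<noteq> 0\<close> S _ _ _ W(2)])
          (use pos in \<open>simp_all add: Qs field_simps power2_eq_square\<close>)
    qed
  qed

  have d_iii: "((a1 = 0 \<and> a3 = 0 \<and> j' \<in> {0} \<union> J1_2 l m \<union> J3_2 l m) \<or>
          (a2 = 0 \<and> a4 = 0 \<and> j' \<in> {l ^ m} \<union> J1_3 l m \<union> J3_3 l m) \<longrightarrow>
           n = (Q - P) / P + (s + 1) * (2 * K - 1) / (2 * K) \<and>
           real ` nonzero_weights C \<subseteq>
             insert ((2 * K - 1) / (2 * P * K) * (Q + s)) Wplus) \<and>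
         ((a1 = 0 \<and> a3 = 0 \<and> j' \<notin> {0} \<union> J1_2 l m \<union> J3_2 l m) \<or>
          (a2 = 0 \<and> a4 = 0 \<and> j' \<notin> {l ^ m} \<union> J1_3 l m \<union> J3_3 l m) \<longrightarrow>
           n = Q / P - (s + 1) / (2 * K) \<and>
           real ` nonzero_weights C \<subseteq>
             insert ((2 * K - 1) / (2 * P * K) * Q - 1 / (2 * P * K) * s) Wminus)"
    if "\<alpha> \<noteq> 0" "\<beta> \<noteq> 0"
      "(a1 = 0 \<and> a3 = 0 \<and> a2 \<noteq> 0 \<and> a4 \<noteq> 0) \<or> (a2 = 0 \<and> a4 = 0 \<and> a1 \<noteq> 0 \<and> a3 \<noteq> 0)"
  proof (rule conjI; rule impI)
    have S: "real I.sigma = L"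
      using sig_3[OF that(1,3)] by (simp add: L)
    show "n = (Q - P) / P + (s + 1) * (2 * K - 1) / (2 * K) \<and>
           real ` nonzero_weights C \<subseteq> insert ((2 * K - 1) / (2 * P * K) * (Q + s)) Wplus"
      if "(a1 = 0 \<and> a3 = 0 \<and> j' \<in> {0} \<union> J1_2 l m \<union> J3_2 l m) \<or>
          (a2 = 0 \<and> a4 = 0 \<and> j' \<in> {l ^ m} \<union> J1_3 l m \<union> J3_3 l m)"
    proof -
      have "ramanujan_sum l m (I.adjusted_index \<beta>) = \<alpha>"
        using that ram_j'[OF \<open>\<alpha> \<noteq> 0\<close>] by blast
      then show ?thesis
        unfolding n
        by (rule nonzero(4)[OF \<open>\<beta> \<noteq> 0\<close> S _ _ _ W(2)])
          (use pos LK in \<open>simp_all add: Qs field_simps power2_eq_square\<close>)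
    qed
    show "n = Q / P - (s + 1) / (2 * K) \<and>
           real ` nonzero_weights C \<subseteq>
             insert ((2 * K - 1) / (2 * P * K) * Q - 1 / (2 * P * K) * s) Wminus"
      if "(a1 = 0 \<and> a3 = 0 \<and> j' \<notin> {0} \<union> J1_2 l m \<union> J3_2 l m) \<or>
          (a2 = 0 \<and> a4 = 0 \<and> j' \<notin> {l ^ m} \<union> J1_3 l m \<union> J3_3 l m)"
    proof -
      have "ramanujan_sum l m (I.adjusted_index \<beta>) \<noteq> \<alpha>"
        using that \<open>_ \<or> a2 = 0 \<and> a4 = 0 \<and> a1 \<noteq> 0 \<and> a3 \<noteq> 0\<close> ram_j'[OF \<open>\<alpha> \<noteq> 0\<close>] by blast
      then show ?thesis
        unfolding n
        by (rule nonzero(3)[OF \<open>\<beta> \<noteq> 0\<close> S _ _ _ W(1)])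
          (use pos LK in \<open>simp_all add: Qs field_simps power2_eq_square\<close>)
    qed
  qed

  show ?thesis
  proof (rule conjI[OF _ conjI[OF _ conjI[OF _ conjI[OF _ conjI[OF _ conjI]]]]], goal_cases)
    case 1
    show ?case
      using dim by blast
  next
    case 2
    show ?case
      using empty by blast
  next
    case 3
    show ?case
      using a_two a_i a_ii by blast
  next
    case 4
    show ?case
    proof (rule impI, elim conjE, rule conjI[OF _ conjI[OF _ conjI]], goal_cases)
      case 1
      then show ?case
        by (intro impI, elim conjE) (rule b_two; assumption)
    next
      case 2
      show ?case
        by (rule impI, elim conjE, rule conjI, rule b_i_len[OF 2],
            assumption+, rule impI, rule b_i[THEN conjunct2, OF 2]; assumption)
    next
      case 3
      show ?case
        by (rule impI, elim conjE, rule b_ii[OF 3]; assumption)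
    next
      case 4
      show ?case
        by (rule impI, rule b_iii[OF 4]; assumption)
    qed
  next
    case 5
    show ?case
    proof (rule impI, elim conjE, rule conjI[OF _ conjI[OF _ conjI[OF _ conjI]]], goal_cases)
      case 1
      show ?case
        by (rule cd_card[OF 1(2)])
    next
      case 2
      show ?case
        by (rule impI, elim conjE, rule c_i[OF 2]; assumption)
    next
      case 3
      show ?case
        by (rule impI, elim conjE, rule c_ii[OF 3]; assumption)
    next
      case 4
      show ?case
        by (rule impI, elim conjE, rule c_iii[OF 4]; assumption)
    next
      case 5
      show ?case
        by (rule impI, elim conjE, rule c_iv[OF 5]; assumption)
    qed
  next
    case 6
    show ?case
      by (rule impI, elim conjE, rule d_0; assumption)
  next
    case 7
    show ?case
    proof (rule impI, elim conjE, rule conjI[OF _ conjI[OF _ conjI]], goal_cases)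
      case 1
      show ?case
        by (rule cd_card[OF 1(2)])
    next
      case 2
      show ?case
        by (rule impI, elim conjE, rule d_i[OF 2(1,2)]; assumption)
    next
      case 3
      show ?case
        by (rule impI, elim conjE, rule d_ii[OF 3(1,2)]; assumption)
    next
      case 4
      show ?case
        by (rule impI, rule d_iii[OF 4(1,2)]; assumption)
    qed
  qed
qed

end
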